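(* Let $(T,C,X,Z)$ be random variables on a common probability space, with $T$ and $C$ real-valued, $X$ taking values in $\mathbb{R}^K$ and $Z$ taking values in $\mathbb{R}^L$. Suppose that $T=X^\top\beta_0+U$ for some fixed $\beta_0\in\mathbb{R}^K$ and some real-valued random variable $U$. Let $Y=\min(T,C)$ and $\delta=I(T\le C)$, and let $\{(Y_i,\delta_i,X_i,Z_i)\}_{i=1}^n$ be an i.i.d. sample from the distribution of $(Y,\delta,X,Z)$. Assume that the distribution of $Y$ is continuous and that: (1) (i) $\mathbb{E}[\|Z\|^2]+\mathbb{E}[\|X\|^2]+\mathbb{E}[|Y|^2]<\infty$; (ii) $\mathbb{E}[ZU]=0$; (iii) $\mathbb{E}[ZZ^\top]$ is positive definite; (iv) $\operatorname{rank}(\mathbb{E}[ZX^\top])=K$. (2) (i) $C$ is independent of $(T,X,Z)$; (ii) $\tau_T<\tau_C$. Then the censored two-stage least squares estimator $\widehat\beta$ converges in probability to $\beta_0$ as $n\to\infty$.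
   Context: $\|\cdot\|$ is the Euclidean norm and $I(\cdot)$ is the indicator function. For a real random variable $R$, $\tau_R=\sup\{t\in\mathbb{R}:\Pr(R\le t)<1\}$ is the upper bound of the support of $R$. Kaplan-Meier weights: let $Y_{(1)}\le\dots\le Y_{(n)}$ be the order statistics of $\{Y_i\}_{i=1}^n$ (almost surely without ties, since $Y$ has a continuous distribution), and let $\delta_{(i)},X_{(i)},Z_{(i)}$ be the values of $\delta,X,Z$ for the observation associated with $Y_{(i)}$. Define, for $i=1,\dots,n$, $$w_{(i)}=\frac{\delta_{(i)}}{n-i+1}\prod_{j=1}^{i-1}\left(\frac{n-j}{n-j+1}\right)^{\delta_{(j)}},$$ where the empty product equals $1$, so $w_{(1)}=\delta_{(1)}/n$. Estimator: the first step is the weighted regression of $X$ on $Z$, $$\widehat\Gamma=\left(\sum_{i=1}^n w_{(i)}Z_{(i)}Z_{(i)}^\top\right)^{-1}\left(\sum_{i=1}^n w_{(i)}Z_{(i)}X_{(i)}^\top\right)\in\mathbb{R}^{L\times K},$$ and the second step minimizes $\sum_{i=1}^n w_{(i)}[Y_{(i)}-(Z_{(i)}^\top\widehat\Gamma)\beta]^2$ over $\beta\in\mathbb{R}^K$, giving $$\widehat\beta=\left[\widehat\Gamma^\top\left(\sum_{i=1}^n w_{(i)}Z_{(i)}Z_{(i)}^\top\right)\widehat\Gamma\right]^{-1}\widehat\Gamma^\top\left(\sum_{i=1}^n w_{(i)}Z_{(i)}Y_{(i)}\right).$$ On the event that one of the inverted matrices is singular, $\widehat\beta$ is given an arbitrary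 (measurable) value. *)

theory Defs
  imports "HOL-Probability.Probability"
begin

definition tau :: "'a measure \<Rightarrow> ('a \<Rightarrow> real) \<Rightarrow> ereal" where
  "tau M R = (SUP t \<in> {t :: real. measure M {\<omega> \<in> space M. R \<omega> \<le> t} < 1}. ereal t)"

text \<open>
  The library's \<open>indep_var\<close> only covers two random variables with values in the same type.
\<close>

definition indep_rv ::
    "'a measure \<Rightarrow> ('a \<Rightarrow> 'b :: topological_space) \<Rightarrow> ('a \<Rightarrow> 'c :: topological_space) \<Rightarrow> bool" where
  "indep_rv M V W \<longleftrightarrow>
     V \<in> borel_measurable M \<and> W \<in> borel_measurable M \<and>
     prob_space.indep_set M {V -` A \<inter> space M | A. A \<in> sets borel}
                            {W -` B \<inter> space M | B. B \<in> sets borel}"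

definition outer :: "real ^ 'm \<Rightarrow> real ^ 'n \<Rightarrow> real ^ 'n ^ 'm" where
  "outer u v = (\<chi> i j. u $ i * v $ j)"

definition pos_definite :: "real ^ 'n ^ 'n \<Rightarrow> bool" where
  "pos_definite A \<longleftrightarrow> transpose A = A \<and> (\<forall>x. x \<noteq> 0 \<longrightarrow> x \<bullet> (A *v x) > 0)"

definition converges_in_probability ::
    "'a measure \<Rightarrow> (nat \<Rightarrow> 'a \<Rightarrow> 'b :: metric_space) \<Rightarrow> 'b \<Rightarrow> bool" where
  "converges_in_probability M f c \<longleftrightarrow>
     (\<forall>\<epsilon>>0. (\<lambda>n. measure M {\<omega> \<in> space M. dist (f n \<omega>) c > \<epsilon>}) \<longlonglongrightarrow> 0)"

text \<open>
  A sample of size \<open>n\<close> is given by the values at the indices \<open>0, \<dots>, n - 1\<close> of sequences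
  \<open>y\<close>, \<open>d\<close> (censoring indicators, with values 0 and 1), \<open>x\<close>, \<open>z\<close>.
  Positions in the ordered sample run from \<open>1\<close> to \<open>n\<close>: \<open>ord_index n y i\<close> is the index of the
  observation associated with the \<open>i\<close>-th order statistic, so that \<open>d (ord_index n y i)\<close> is
  the concomitant of \<open>d\<close> at position \<open>i\<close>.  Since \<open>sort_key\<close> is stable, ties are broken by index.
\<close>

definition ord_index :: "nat \<Rightarrow> (nat \<Rightarrow> real) \<Rightarrow> nat \<Rightarrow> nat" where
  "ord_index n y i = sort_key y [0..<n] ! (i - 1)"

text \<open>
  In the product below \<open>1 \<le> j < i \<le> n\<close>, so every base is positive and \<open>powr\<close> is
  ordinary exponentiation.
\<close>

definition km_weight :: "nat \<Rightarrow> (nat \<Rightarrow> real) \<Rightarrow> (nat \<Rightarrow> real) \<Rightarrow> nat \<Rightarrow> real" where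
  "km_weight n y d i =
     d (ord_index n y i) / (real n - real i + 1) *
     (\<Prod>j = 1..<i. ((real n - real j) / (real n - real j + 1)) powr d (ord_index n y j))"

definition km_sum ::
    "nat \<Rightarrow> (nat \<Rightarrow> real) \<Rightarrow> (nat \<Rightarrow> real) \<Rightarrow> (nat \<Rightarrow> 'b :: real_vector) \<Rightarrow> 'b" where
  "km_sum n y d f = (\<Sum>i = 1..n. km_weight n y d i *\<^sub>R f (ord_index n y i))"

definition km_ZZ ::
    "nat \<Rightarrow> (nat \<Rightarrow> real) \<Rightarrow> (nat \<Rightarrow> real) \<Rightarrow> (nat \<Rightarrow> real ^ 'l) \<Rightarrow> real ^ 'l ^ 'l" where
  "km_ZZ n y d z = km_sum n y d (\<lambda>i. outer (z i) (z i))"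

definition Gamma_hat ::
    "nat \<Rightarrow> (nat \<Rightarrow> real) \<Rightarrow> (nat \<Rightarrow> real) \<Rightarrow> (nat \<Rightarrow> real ^ 'k) \<Rightarrow> (nat \<Rightarrow> real ^ 'l)
       \<Rightarrow> real ^ 'k ^ 'l" where
  "Gamma_hat n y d x z =
     matrix_inv (km_ZZ n y d z) ** km_sum n y d (\<lambda>i. outer (z i) (x i))"

definition second_step_matrix ::
    "nat \<Rightarrow> (nat \<Rightarrow> real) \<Rightarrow> (nat \<Rightarrow> real) \<Rightarrow> (nat \<Rightarrow> real ^ 'k) \<Rightarrow> (nat \<Rightarrow> real ^ 'l)
       \<Rightarrow> real ^ 'k ^ 'k" where
  "second_step_matrix n y d x z =
     transpose (Gamma_hat n y d x z) ** km_ZZ n y d z ** Gamma_hat n y d x z"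

text \<open>Only meaningful when \<open>km_ZZ\<close> and \<open>second_step_matrix\<close> are both invertible.\<close>

definition c2sls ::
    "nat \<Rightarrow> (nat \<Rightarrow> real) \<Rightarrow> (nat \<Rightarrow> real) \<Rightarrow> (nat \<Rightarrow> real ^ 'k) \<Rightarrow> (nat \<Rightarrow> real ^ 'l)
       \<Rightarrow> real ^ 'k" where
  "c2sls n y d x z =
     matrix_inv (second_step_matrix n y d x z) *v
       (transpose (Gamma_hat n y d x z) *v km_sum n y d (\<lambda>i. y i *\<^sub>R z i))"

text \<open>
  \<open>b n\<close> is the estimator computed from the first \<open>n\<close> observations: it is given by the formula
  when both matrices are invertible and is an arbitrary measurable function otherwise.
  Requiring the formula only almost surely leaves the treatment of ties open when the
  \<open>Y i\<close> have a continuous distribution.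
\<close>

definition c2sls_estimator ::
    "'a measure \<Rightarrow> (nat \<Rightarrow> 'a \<Rightarrow> real) \<Rightarrow> (nat \<Rightarrow> 'a \<Rightarrow> real) \<Rightarrow> (nat \<Rightarrow> 'a \<Rightarrow> real ^ 'k) \<Rightarrow>
     (nat \<Rightarrow> 'a \<Rightarrow> real ^ 'l) \<Rightarrow> (nat \<Rightarrow> 'a \<Rightarrow> real ^ 'k) \<Rightarrow> bool" where
  "c2sls_estimator N Y D X Z b \<longleftrightarrow>
     (\<forall>n. b n \<in> borel_measurable N \<and>
        (AE \<omega> in N.
           invertible (km_ZZ n (\<lambda>i. Y i \<omega>) (\<lambda>i. D i \<omega>) (\<lambda>i. Z i \<omega>)) \<and>
           invertible (second_step_matrix n (\<lambda>i. Y i \<omega>) (\<lambda>i. D i \<omega>) (\<lambda>i. X i \<omega>) (\<lambda>i. Z i \<omega>)) \<longrightarrow>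
           b n \<omega> = c2sls n (\<lambda>i. Y i \<omega>) (\<lambda>i. D i \<omega>) (\<lambda>i. X i \<omega>) (\<lambda>i. Z i \<omega>)))"

end

theory Submission
  imports Defs
begin

text \<open>
  With no ties, the product of \<open>(n - j) / (n - j + 1)\<close> over all \<open>j < i\<close> telescopes, so the exponents
  \<open>\<delta>\<close> in a Kaplan-Meier weight can be traded for exponents \<open>1 - \<delta>\<close>: the weight of an uncensored
  observation is \<open>1 / n\<close> times the reciprocal of the Kaplan-Meier estimate, just before that
  observation, of the censoring survival function \<open>G t = P (C \<ge> t)\<close>
  (\<open>km_sum_inverse_censoring\<close>).  With the true \<open>G\<close> in its place, a Kaplan-Meier sum would be an
  average of independent terms with mean \<open>E [1 (T \<le> C) g (T, W) / G T] = E [g (T, W)]\<close>, by the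
  independence of \<open>C\<close> and \<open>(T, W)\<close> (\<open>inverse_censoring\<close>), and the weak law of large numbers would
  finish.  It remains to compare the two reciprocals, uniformly over the uncensored observations.

  The logarithm of the estimated reciprocal at \<open>t\<close> is the sum of \<open>ln (N / (N - 1))\<close> over the censored
  observations before \<open>t\<close>, where \<open>N\<close> is the number still at risk at the observation.  Replace each term
  by \<open>1 / N\<close>, at the cost of at most \<open>2 / N\<^sup>2\<close>, and then by \<open>1 / (n p)\<close>, where \<open>p\<close> is the probability of
  being at risk.  What results is an average of independent variables with mean \<open>- ln (G t)\<close>
  (\<open>nn_integral_censored_hazard\<close>, \<open>integral_hazard\<close>), and it converges uniformly in \<open>t\<close> because it is
  monotone in \<open>t\<close> and the limit is continuous (\<open>oracle_hazard_uniform\<close>).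

  The total replacement error is bounded by a quantity without \<open>t\<close>, and this quantity tends to zero
  in mean (\<open>hazard_error_vanishes\<close>).  Given that the observation equals \<open>s\<close>, the number at risk is one
  plus the number of other observations that are at least \<open>s\<close>; the expectations of its reciprocal
  for the \<open>n\<close> observations add up to at most \<open>1 / p s\<close>, whatever \<open>n\<close>
  (\<open>sum_expectation_leave_one_out\<close>).
  As \<open>1 / p\<close> is integrable over the censored observations, dominated convergence applies.
  This covers also the neighbourhood of the end point \<open>\<tau>\<close> of the support of \<open>T\<close>, where few
  observations are at risk and the error of a single term is not small.  The assumption on the supports enters as \<open>G \<tau> > 0\<close>: it bounds the integral of the censoring
  hazard and makes \<open>1 / G\<close> bounded on the support of \<open>T\<close>.

  The moments entering the estimator are therefore consistent, \<open>E [T Z] = E [Z X\<^sup>T] \<beta>\<^sub>0\<close> by the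
  exogeneity of \<open>Z\<close>, and the two-stage formula is continuous at the limiting moments, with value \<open>\<beta>\<^sub>0\<close>
  (\<open>two_stage_continuous\<close>).
\<close>

section \<open>Kaplan-Meier sums as inverse-probability-of-censoring sums\<close>

definition at_risk :: "nat \<Rightarrow> (nat \<Rightarrow> real) \<Rightarrow> real \<Rightarrow> nat" where
  "at_risk n y s = card {l \<in> {..<n}. s \<le> y l}"

text \<open>
  Minus the logarithm of the Kaplan-Meier estimate, from a sample without ties, of the censoring
  survival function just before \<open>t\<close>: the roles of censored and uncensored observations are exchanged.
\<close>

definition log_inv_cens :: "nat \<Rightarrow> (nat \<Rightarrow> real) \<Rightarrow> (nat \<Rightarrow> real) \<Rightarrow> real \<Rightarrow> real" where
  "log_inv_cens n y d t =
     (\<Sum>j | j < n \<and> y j < t \<and> d j = 0. ln (at_risk n y (y j) / (real (at_risk n y (y j)) - 1)))"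

lemma sort_key_strict:
  fixes y :: "nat \<Rightarrow> real"
  assumes "inj_on y {..<n}" "p < q" "q < n"
  shows "y (sort_key y [0..<n] ! p) < y (sort_key y [0..<n] ! q)"
proof -
  let ?xs = "sort_key y [0..<n]"
  have len: "length ?xs = n" by simp
  have "map y ?xs ! p \<le> map y ?xs ! q"
    by (rule sorted_nth_mono) (use assms in auto)
  hence le: "y (?xs ! p) \<le> y (?xs ! q)" using assms len by simp
  have "distinct ?xs" by simp
  hence ne: "?xs ! p \<noteq> ?xs ! q" using assms len by (simp add: nth_eq_iff_index_eq)
  have mem: "?xs ! r \<in> {..<n}" if "r < n" for r
    using nth_mem[of r ?xs] that len by (simp add: atLeast0LessThan)
  have "y (?xs ! p) \<noteq> y (?xs ! q)"
    using inj_onD[OF assms(1), of "?xs ! p" "?xs ! q"] ne mem[of p] mem[of q] assms by auto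
  thus ?thesis using le by simp
qed

lemma sort_key_bij: "bij_betw (\<lambda>p. sort_key y [0..<n] ! p) {..<n} {..<n}"
  by (rule bij_betw_nth) auto

lemma sort_key_less_iff:
  fixes y :: "nat \<Rightarrow> real"
  assumes "inj_on y {..<n}" "p < n" "q < n"
  shows "y (sort_key y [0..<n] ! p) < y (sort_key y [0..<n] ! q) \<longleftrightarrow> p < q"
  using sort_key_strict[OF assms(1), of p q] sort_key_strict[OF assms(1), of q p] assms
  by (cases p q rule: linorder_cases) auto

lemma at_risk_sort_key:
  fixes y :: "nat \<Rightarrow> real"
  assumes "inj_on y {..<n}" "p < n"
  shows "at_risk n y (y (sort_key y [0..<n] ! p)) = n - p"
proof -
  let ?s = "\<lambda>p. sort_key y [0..<n] ! p"
  have "{l \<in> {..<n}. y (?s p) \<le> y l} = ?s ` {p..<n}"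
  proof (intro equalityI subsetI)
    fix l assume l: "l \<in> {l \<in> {..<n}. y (?s p) \<le> y l}"
    then obtain q where q: "q < n" "l = ?s q"
      using bij_betw_imp_surj_on[OF sort_key_bij[of y n]] by (metis (lifting) imageE lessThan_iff mem_Collect_eq)
    have "p \<le> q" using sort_key_less_iff[OF assms(1) q(1) assms(2)] l q by auto
    thus "l \<in> ?s ` {p..<n}" using q by auto
  next
    fix l assume "l \<in> ?s ` {p..<n}"
    then obtain q where q: "p \<le> q" "q < n" "l = ?s q" by auto
    have "?s q \<in> {..<n}" using bij_betw_apply[OF sort_key_bij[of y n]] q by auto
    thus "l \<in> {l \<in> {..<n}. y (?s p) \<le> y l}"
      using sort_key_less_iff[OF assms(1) q(2) assms(2)] q by auto
  qed
  moreover have "inj_on ?s {p..<n}"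
    using bij_betw_imp_inj_on[OF sort_key_bij[of y n]] by (rule inj_on_subset) auto
  ultimately show ?thesis by (simp add: at_risk_def card_image)
qed

lemma prod_before_sort_key:
  fixes y :: "nat \<Rightarrow> real" and h :: "nat \<Rightarrow> real"
  assumes "inj_on y {..<n}" "q < n"
  shows "(\<Prod>l | l < n \<and> y l < y (sort_key y [0..<n] ! q). h l) = (\<Prod>p<q. h (sort_key y [0..<n] ! p))"
proof -
  let ?s = "\<lambda>p. sort_key y [0..<n] ! p"
  have "{l. l < n \<and> y l < y (?s q)} = ?s ` {..<q}"
  proof (intro equalityI subsetI)
    fix l assume l: "l \<in> {l. l < n \<and> y l < y (?s q)}"
    then obtain p where p: "p < n" "l = ?s p"
      using bij_betw_imp_surj_on[OF sort_key_bij[of y n]] by (metis (lifting) imageE lessThan_iff mem_Collect_eq)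
    thus "l \<in> ?s ` {..<q}" using sort_key_less_iff[OF assms(1) p(1) assms(2)] l by auto
  next
    fix l assume "l \<in> ?s ` {..<q}"
    then obtain p where p: "p < q" "l = ?s p" by auto
    have "?s p \<in> {..<n}" using bij_betw_apply[OF sort_key_bij[of y n]] p assms by auto
    thus "l \<in> {l. l < n \<and> y l < y (?s q)}"
      using sort_key_strict[OF assms(1) p(1) assms(2)] p by auto
  qed
  moreover have "inj_on ?s {..<q}"
    using bij_betw_imp_inj_on[OF sort_key_bij[of y n]] by (rule inj_on_subset) (use assms in auto)
  ultimately show ?thesis by (simp add: prod.reindex)
qed

lemma prod_survivors: "q \<le> n \<Longrightarrow> (\<Prod>p<q. (real (n - p) - 1) / real (n - p)) = real (n - q) / real n" if "n > 0"
proof (induction q)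
  case (Suc q)
  then show ?case by (simp add: of_nat_diff)
qed (use that in auto)

lemma at_risk_two_le:
  assumes "l < n" "k < n" "y l < y k"
  shows "2 \<le> at_risk n y (y l)"
proof -
  have "card {l, k} \<le> at_risk n y (y l)"
    unfolding at_risk_def by (rule card_mono) (use assms in auto)
  moreover have "l \<noteq> k" using assms by auto
  ultimately show ?thesis by simp
qed

text \<open>
  Over all positions before \<open>q\<close>, censored or not, the survival factors multiply to \<open>(n - q) / n\<close>.
  Dividing this by the factors of the censored observations leaves those of the uncensored ones,
  which are the factors of the Kaplan-Meier weight; \<open>n - q\<close> then cancels.
\<close>

lemma km_weight_inverse_censoring:
  fixes y d :: "nat \<Rightarrow> real"
  assumes inj: "inj_on y {..<n}" and d: "\<And>k. k < n \<Longrightarrow> d k = 0 \<or> d k = 1"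
    and q: "q < n"
  defines "k \<equiv> sort_key y [0..<n] ! q"
  shows "km_weight n y d (Suc q) = d k / n * exp (log_inv_cens n y d (y k))"
proof -
  let ?s = "\<lambda>p. sort_key y [0..<n] ! p"
  define r where "r l = (real (at_risk n y (y l)) - 1) / at_risk n y (y l)" for l
  have kn: "k < n" using bij_betw_apply[OF sort_key_bij[of y n]] q by (auto simp: k_def)
  have rs: "r (?s p) = (real (n - p) - 1) / real (n - p)" if "p < n" for p
    using at_risk_sort_key[OF inj that] by (simp add: r_def)
  have "(\<Prod>j = 1..<Suc q. ((real n - real j) / (real n - real j + 1)) powr d (ord_index n y j)) =
        (\<Prod>p<q. r (?s p) powr d (?s p))"
    by (rule prod.reindex_bij_witness[of _ Suc "\<lambda>j. j - 1"])
       (use q in \<open>auto simp: rs ord_index_def of_nat_diff algebra_simps\<close>)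
  also have "\<dots> = (\<Prod>l | l < n \<and> y l < y k. r l powr d l)"
    unfolding k_def by (rule prod_before_sort_key[OF inj q, symmetric])
  finally have P1: "(\<Prod>j = 1..<Suc q. ((real n - real j) / (real n - real j + 1)) powr d (ord_index n y j)) =
     (\<Prod>l | l < n \<and> y l < y k. r l powr d l)" .
  have rpos: "r l > 0" if "l < n" "y l < y k" for l
    using at_risk_two_le[OF that(1) kn that(2)] by (auto simp: r_def)
  have "(\<Prod>l | l < n \<and> y l < y k. r l) = (\<Prod>l | l < n \<and> y l < y k. r l powr d l * r l powr (1 - d l))"
    by (rule prod.cong) (use rpos in \<open>auto simp: powr_add[symmetric] abs_of_pos\<close>)
  also have "\<dots> = (\<Prod>l | l < n \<and> y l < y k. r l powr d l) * (\<Prod>l | l < n \<and> y l < y k. r l powr (1 - d l))"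
    by (rule prod.distrib)
  also have "(\<Prod>l | l < n \<and> y l < y k. r l powr (1 - d l)) = (\<Prod>l | l < n \<and> y l < y k \<and> d l = 0. r l)"
  proof (rule prod.mono_neutral_cong_right)
    show "\<forall>l\<in>{l. l < n \<and> y l < y k} - {l. l < n \<and> y l < y k \<and> d l = 0}. r l powr (1 - d l) = 1"
      using d rpos by fastforce
  qed (use rpos in \<open>auto simp: abs_of_pos\<close>)
  also have "\<dots> = exp (- log_inv_cens n y d (y k))"
  proof -
    have "exp (- log_inv_cens n y d (y k)) = (\<Prod>l | l < n \<and> y l < y k \<and> d l = 0. exp (- ln (at_risk n y (y l) / (real (at_risk n y (y l)) - 1))))"
      unfolding log_inv_cens_def by (simp add: sum_negf[symmetric] exp_sum del: sum_negf)
    also have "\<dots> = (\<Prod>l | l < n \<and> y l < y k \<and> d l = 0. r l)"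
    proof (rule prod.cong)
      fix l assume "l \<in> {l. l < n \<and> y l < y k \<and> d l = 0}"
      hence "r l > 0" "r l = 1 / (at_risk n y (y l) / (real (at_risk n y (y l)) - 1))"
        using rpos[of l] by (auto simp: r_def)
      moreover from this have "at_risk n y (y l) / (real (at_risk n y (y l)) - 1) > 0"
        by (metis zero_less_divide_1_iff)
      ultimately show "exp (- ln (at_risk n y (y l) / (real (at_risk n y (y l)) - 1))) = r l"
        by (simp add: exp_minus inverse_eq_divide)
    qed simp
    finally show ?thesis by simp
  qed
  finally have P2: "(\<Prod>l | l < n \<and> y l < y k. r l) =
     (\<Prod>l | l < n \<and> y l < y k. r l powr d l) * exp (- log_inv_cens n y d (y k))" .
  have "(\<Prod>l | l < n \<and> y l < y k. r l) = (\<Prod>p<q. r (?s p))"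
    unfolding k_def by (rule prod_before_sort_key[OF inj q])
  also have "\<dots> = (\<Prod>p<q. (real (n - p) - 1) / real (n - p))"
    by (rule prod.cong) (use q in \<open>auto simp: rs\<close>)
  also have "\<dots> = real (n - q) / n" using q by (intro prod_survivors) auto
  finally have P3: "(\<Prod>l | l < n \<and> y l < y k. r l powr d l) = real (n - q) / n * exp (log_inv_cens n y d (y k))"
    using P2 by (simp add: exp_minus field_simps)
  show ?thesis
    unfolding km_weight_def P1 P3 using q
    by (simp add: ord_index_def k_def of_nat_diff field_simps)
qed

lemma km_sum_inverse_censoring:
  fixes y d :: "nat \<Rightarrow> real" and f :: "nat \<Rightarrow> 'v :: real_vector"
  assumes inj: "inj_on y {..<n}" and d: "\<And>k. k < n \<Longrightarrow> d k = 0 \<or> d k = 1"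
  shows "km_sum n y d f = (\<Sum>k<n. (d k / n * exp (log_inv_cens n y d (y k))) *\<^sub>R f k)"
proof -
  let ?s = "\<lambda>p. sort_key y [0..<n] ! p"
  have "km_sum n y d f = (\<Sum>q<n. km_weight n y d (Suc q) *\<^sub>R f (?s q))"
    unfolding km_sum_def
    by (rule sum.reindex_bij_witness[of _ Suc "\<lambda>j. j - 1"]) (auto simp: ord_index_def)
  also have "\<dots> = (\<Sum>q<n. (d (?s q) / n * exp (log_inv_cens n y d (y (?s q)))) *\<^sub>R f (?s q))"
    by (rule sum.cong) (use km_weight_inverse_censoring[OF inj d] in auto)
  also have "\<dots> = (\<Sum>k<n. (d k / n * exp (log_inv_cens n y d (y k))) *\<^sub>R f k)"
    by (rule sum.reindex_bij_betw[OF sort_key_bij])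
  finally show ?thesis .
qed

lemma ln_ratio_bounds:
  fixes N :: real
  assumes "N \<ge> 2"
  shows "\<bar>ln (N / (N - 1)) - 1 / N\<bar> \<le> 2 / N\<^sup>2"
proof -
  have pos: "N / (N - 1) > 0" using assms by simp
  have "1 - 1/N = (N - 1) / N" using assms by (simp add: diff_divide_distrib)
  hence e: "ln (N / (N - 1)) = - ln (1 - 1/N)"
    using assms by (simp add: ln_div)
  have a: "ln (1 - 1/N) \<le> - (1/N)" using assms by (intro ln_add_one_self_le_self2[of "-(1/N)", simplified]) (auto simp: field_simps)
  have b: "- (1/N) - 2 * (1/N)^2 \<le> ln (1 - 1/N)"
    using ln_one_minus_pos_lower_bound[of "1/N"] assms by simp
  show ?thesis using a b e by (simp add: power_one_over abs_le_iff)
qed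

text \<open>
  The observations before \<open>y k\<close> have \<open>k\<close> itself among those at risk, so at least two are at risk and
  the logarithm is within \<open>2 / N\<^sup>2\<close> of \<open>1 / N\<close>.  The right-hand side sums over all censored
  observations, which makes it independent of \<open>k\<close>.  In the application \<open>p j\<close> is the reciprocal of the
  expected number at risk.
\<close>

lemma log_inv_cens_approx:
  fixes y d p :: "nat \<Rightarrow> real"
  assumes k: "k < n" 
  shows "\<bar>log_inv_cens n y d (y k) - (\<Sum>j | j < n \<and> y j < y k \<and> d j = 0. p j)\<bar>
     \<le> (\<Sum>j | j < n \<and> d j = 0. \<bar>1 / at_risk n y (y j) - p j\<bar> + 2 / (at_risk n y (y j))\<^sup>2)"
proof -
  have "\<bar>log_inv_cens n y d (y k) - (\<Sum>j | j < n \<and> y j < y k \<and> d j = 0. p j)\<bar> 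
    \<le> (\<Sum>j | j < n \<and> y j < y k \<and> d j = 0. \<bar>ln (at_risk n y (y j) / (real (at_risk n y (y j)) - 1)) - p j\<bar>)"
    unfolding log_inv_cens_def sum_subtractf[symmetric] by (rule sum_abs)
  also have "\<dots> \<le> (\<Sum>j | j < n \<and> y j < y k \<and> d j = 0. \<bar>1 / at_risk n y (y j) - p j\<bar> + 2 / (at_risk n y (y j))\<^sup>2)"
  proof (rule sum_mono)
    fix j assume "j \<in> {j. j < n \<and> y j < y k \<and> d j = 0}"
    hence "2 \<le> real (at_risk n y (y j))" using at_risk_two_le[of j n k y] k by auto
    from ln_ratio_bounds[OF this]
    show "\<bar>ln (at_risk n y (y j) / (real (at_risk n y (y j)) - 1)) - p j\<bar> \<le> \<bar>1 / at_risk n y (y j) - p j\<bar> + 2 / (at_risk n y (y j))\<^sup>2"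
      by simp
  qed
  also have "\<dots> \<le> (\<Sum>j | j < n \<and> d j = 0. \<bar>1 / at_risk n y (y j) - p j\<bar> + 2 / (at_risk n y (y j))\<^sup>2)"
    by (rule sum_mono2) auto
  finally show ?thesis .
qed

lemma km_sum_vec_nth: "km_sum n y d f $ i = km_sum n y d (\<lambda>k. f k $ i)"
  by (simp add: km_sum_def)

section \<open>Continuity of the two-stage least squares formula\<close>

lemma matrix_inv_unique:
  fixes A :: "real ^ 'n ^ 'n"
  assumes "A ** B = mat 1"
  shows "matrix_inv A = B"
proof -
  have BA: "B ** A = mat 1" using assms by (simp add: matrix_left_right_inverse)
  have "A ** matrix_inv A = mat 1 \<and> matrix_inv A ** A = mat 1"
    unfolding matrix_inv_def by (rule someI[of _ B]) (use assms BA in auto)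
  hence "B ** (A ** matrix_inv A) = B" by simp
  thus ?thesis by (simp add: matrix_mul_assoc BA)
qed

text \<open>
  Cramer's rule for the columns of the inverse.  It makes the entries of the inverse rational
  functions of the entries of the matrix, hence continuous.
\<close>

lemma matrix_inv_entry_det:
  fixes A :: "real ^ 'n ^ 'n"
  assumes "invertible A"
  shows "matrix_inv A $ k $ m = det (\<chi> i j. if j = k then (if i = m then 1 else 0) else A $ i $ j) / det A"
proof -
  obtain B where B: "A ** B = mat 1" using assms by (auto simp: invertible_def)
  have d: "det A \<noteq> 0" using assms by (simp add: invertible_det_nz)
  have "A *v column m B = column m (A ** B)"
    by (simp add: vec_eq_iff column_def matrix_vector_mult_def matrix_matrix_mult_def)
  also have "\<dots> = (\<chi> i. if i = m then 1 else 0)"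
    by (simp add: B vec_eq_iff column_def mat_def)
  finally have "column m B = (\<chi> k. det (\<chi> i j. if j = k then (if i = m then 1 else 0) else A $ i $ j) / det A)"
    using cramer[OF d, of "column m B" "\<chi> i. if i = m then 1 else 0"] by (simp cong: if_cong)
  thus ?thesis by (simp add: matrix_inv_unique[OF B] vec_eq_iff column_def)
qed

lemma tendsto_det:
  fixes f :: "'a \<Rightarrow> real ^ 'n ^ 'n"
  assumes "\<And>i j. ((\<lambda>x. f x $ i $ j) \<longlongrightarrow> A $ i $ j) F"
  shows "((\<lambda>x. det (f x)) \<longlongrightarrow> det A) F"
  unfolding det_def by (intro tendsto_intros assms)

lemma eventually_invertible:
  fixes f :: "'a \<Rightarrow> real ^ 'n ^ 'n"
  assumes "(f \<longlongrightarrow> A) F" "invertible A"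
  shows "eventually (\<lambda>x. invertible (f x)) F"
proof -
  have "((\<lambda>x. det (f x)) \<longlongrightarrow> det A) F"
    by (intro tendsto_det tendsto_vec_nth assms)
  hence "eventually (\<lambda>x. det (f x) \<noteq> 0) F"
    by (rule tendsto_imp_eventually_ne) (use assms in \<open>simp add: invertible_det_nz\<close>)
  thus ?thesis by (simp add: invertible_det_nz)
qed

lemma tendsto_matrix_inv:
  fixes f :: "'a \<Rightarrow> real ^ 'n ^ 'n"
  assumes lim: "(f \<longlongrightarrow> A) F" and inv: "invertible A"
  shows "((\<lambda>x. matrix_inv (f x)) \<longlongrightarrow> matrix_inv A) F"
proof (intro vec_tendstoI)
  fix k m
  let ?C = "\<lambda>B. (\<chi> i j. if j = k then (if i = m then 1 else 0) else B $ i $ j) :: real ^ 'n ^ 'n"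
  have "((\<lambda>x. det (?C (f x)) / det (f x)) \<longlongrightarrow> det (?C A) / det A) F"
  proof (intro tendsto_divide tendsto_det)
    show "((\<lambda>x. ?C (f x) $ i $ j) \<longlongrightarrow> ?C A $ i $ j) F" for i j
      by (cases "j = k") (auto intro!: tendsto_vec_nth lim)
    show "((\<lambda>x. f x $ i $ j) \<longlongrightarrow> A $ i $ j) F" for i j
      by (intro tendsto_vec_nth lim)
  qed (use inv in \<open>simp add: invertible_det_nz\<close>)
  moreover have "eventually (\<lambda>x. det (?C (f x)) / det (f x) = matrix_inv (f x) $ k $ m) F"
    using eventually_invertible[OF lim inv] by eventually_elim (simp add: matrix_inv_entry_det)
  ultimately show "((\<lambda>x. matrix_inv (f x) $ k $ m) \<longlongrightarrow> matrix_inv A $ k $ m) F"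
    by (simp add: matrix_inv_entry_det[OF inv] tendsto_cong)
qed

lemma tendsto_matrix_mult:
  fixes f :: "'a \<Rightarrow> real ^ 'n ^ 'm" and g :: "'a \<Rightarrow> real ^ 'p ^ 'n"
  assumes "(f \<longlongrightarrow> A) F" "(g \<longlongrightarrow> B) F"
  shows "((\<lambda>x. f x ** g x) \<longlongrightarrow> A ** B) F"
  unfolding matrix_matrix_mult_def
  by (intro vec_tendstoI) (simp add: assms tendsto_sum tendsto_mult tendsto_vec_nth)

lemma tendsto_matrix_vector_mult:
  fixes f :: "'a \<Rightarrow> real ^ 'n ^ 'm" and g :: "'a \<Rightarrow> real ^ 'n"
  assumes "(f \<longlongrightarrow> A) F" "(g \<longlongrightarrow> b) F"
  shows "((\<lambda>x. f x *v g x) \<longlongrightarrow> A *v b) F"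
  unfolding matrix_vector_mult_def
  by (intro vec_tendstoI) (simp add: assms tendsto_sum tendsto_mult tendsto_vec_nth)

lemma tendsto_transpose:
  fixes f :: "'a \<Rightarrow> real ^ 'n ^ 'm"
  assumes "(f \<longlongrightarrow> A) F"
  shows "((\<lambda>x. transpose (f x)) \<longlongrightarrow> transpose A) F"
  unfolding transpose_def
  by (intro vec_tendstoI) (simp add: assms tendsto_vec_nth)

lemma invertible_matrix_inv:
  fixes A :: "real ^ 'n ^ 'n"
  assumes "invertible A"
  shows "A ** matrix_inv A = mat 1" "matrix_inv A ** A = mat 1"
proof -
  obtain B where B: "A ** B = mat 1" "B ** A = mat 1" using assms by (auto simp: invertible_def)
  thus "A ** matrix_inv A = mat 1" "matrix_inv A ** A = mat 1" by (simp_all add: matrix_inv_unique)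
qed

lemma invertible_iff_kernel:
  fixes A :: "real ^ 'n ^ 'n"
  assumes "\<And>x. A *v x = 0 \<Longrightarrow> x = 0"
  shows "invertible A"
proof -
  obtain B where "B ** A = mat 1"
    using matrix_left_invertible_ker[of A] assms by blast
  thus ?thesis by (auto simp: invertible_def matrix_left_right_inverse)
qed

lemma pos_definite_invertible:
  assumes "pos_definite A"
  shows "invertible A"
proof (rule invertible_iff_kernel)
  fix x assume "A *v x = 0"
  with assms show "x = 0" by (force simp: pos_definite_def)
qed

definition two_stage :: "real ^ 'l ^ 'l \<Rightarrow> real ^ 'k ^ 'l \<Rightarrow> real ^ 'l \<Rightarrow> real ^ 'k" where
  "two_stage A B c = matrix_inv (transpose (matrix_inv A ** B) ** A ** (matrix_inv A ** B)) *v
     (transpose (matrix_inv A ** B) *v c)"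

text \<open>
  If the second-step matrix kills \<open>x\<close>, its quadratic form shows that the positive definite \<open>A\<close> has
  \<open>v \<bullet> A v = 0\<close> for \<open>v = matrix_inv A ** B *v x\<close>; so \<open>B x = A v = 0\<close>, and full column rank gives \<open>x = 0\<close>.
\<close>

lemma second_step_invertible:
  fixes A :: "real ^ 'l ^ 'l" and B :: "real ^ 'k ^ 'l"
  assumes A: "pos_definite A" and B: "rank B = CARD('k)"
  shows "invertible (transpose (matrix_inv A ** B) ** A ** (matrix_inv A ** B))"
proof (rule invertible_iff_kernel)
  fix x assume 0: "(transpose (matrix_inv A ** B) ** A ** (matrix_inv A ** B)) *v x = 0"
  define v where "v = (matrix_inv A ** B) *v x"
  let ?G = "matrix_inv A ** B"
  have "v \<bullet> (A *v v) = ((A *v v) v* ?G) \<bullet> x"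
    by (subst inner_commute) (simp only: dot_lmul_matrix, simp only: v_def)
  also have "(A *v v) v* ?G = (transpose ?G ** A ** ?G) *v x"
    by (simp only: transpose_matrix_vector[symmetric] v_def matrix_vector_mul_assoc matrix_mul_assoc)
  finally have "v \<bullet> (A *v v) = ((transpose ?G ** A ** ?G) *v x) \<bullet> x" .
  hence "v = 0" using A 0 by (force simp: pos_definite_def)
  hence "A *v v = 0" by simp
  hence "B *v x = 0"
    unfolding v_def matrix_vector_mul_assoc matrix_mul_assoc
    by (simp add: invertible_matrix_inv[OF pos_definite_invertible[OF A]])
  moreover have "inj ((*v) B)" using B full_rank_injective[of B] by simp
  ultimately show "x = 0" using injD[of "(*v) B" x 0] by simp
qed

text \<open>
  For moments satisfying the instrumental variable equation \<open>c = B b\<close> exactly, the formula recovers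
  \<open>b\<close>, because \<open>B = A (matrix_inv A ** B)\<close>.
\<close>

lemma two_stage_eq:
  fixes A :: "real ^ 'l ^ 'l" and B :: "real ^ 'k ^ 'l"
  assumes A: "pos_definite A" and B: "rank B = CARD('k)"
  shows "two_stage A B (B *v b) = b"
proof -
  let ?G = "matrix_inv A ** B"
  have "A ** ?G = B"
    by (simp add: matrix_mul_assoc invertible_matrix_inv[OF pos_definite_invertible[OF A]])
  hence "transpose ?G *v (B *v b) = (transpose ?G ** A ** ?G) *v b"
    by (simp add: matrix_vector_mul_assoc matrix_mul_assoc[symmetric])
  thus ?thesis
    unfolding two_stage_def
    by (simp only: matrix_vector_mul_assoc invertible_matrix_inv[OF second_step_invertible[OF A B]] matrix_vector_mul_lid)
qed

lemma tendsto_second_step: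
  fixes A :: "real ^ 'l ^ 'l" and B :: "real ^ 'k ^ 'l"
  assumes f: "(f \<longlongrightarrow> A) F" and g: "(g \<longlongrightarrow> B) F" and A: "invertible A"
  shows "((\<lambda>x. transpose (matrix_inv (f x) ** g x) ** f x ** (matrix_inv (f x) ** g x)) \<longlongrightarrow>
           transpose (matrix_inv A ** B) ** A ** (matrix_inv A ** B)) F"
  by (intro tendsto_matrix_mult tendsto_transpose tendsto_matrix_inv assms)

lemma two_stage_continuous:
  fixes A0 :: "real ^ 'l ^ 'l" and B0 :: "real ^ 'k ^ 'l"
  assumes A: "pos_definite A0" and B: "rank B0 = CARD('k)" and e: "e > 0"
  shows "\<exists>\<delta>>0. \<forall>A B c. dist A A0 \<le> \<delta> \<longrightarrow> dist B B0 \<le> \<delta> \<longrightarrow> dist c (B0 *v b) \<le> \<delta> \<longrightarrow>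
     invertible A \<and> invertible (transpose (matrix_inv A ** B) ** A ** (matrix_inv A ** B)) \<and>
     dist (two_stage A B c) b \<le> e"
proof -
  let ?F = "nhds A0 \<times>\<^sub>F nhds B0 \<times>\<^sub>F nhds (B0 *v b)"
  note invA = pos_definite_invertible[OF A] and invS = second_step_invertible[OF A B]
  have lim: "(fst \<longlongrightarrow> A0) ?F" "((\<lambda>x. fst (snd x)) \<longlongrightarrow> B0) ?F" "((\<lambda>x. snd (snd x)) \<longlongrightarrow> B0 *v b) ?F"
    by (auto intro: filterlim_fst filterlim_snd filterlim_compose[OF filterlim_fst filterlim_snd]
       filterlim_compose[OF filterlim_snd filterlim_snd])
  have "((\<lambda>x. two_stage (fst x) (fst (snd x)) (snd (snd x))) \<longlongrightarrow> two_stage A0 B0 (B0 *v b)) ?F"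
    unfolding two_stage_def
    by (intro tendsto_matrix_mult tendsto_transpose tendsto_matrix_inv tendsto_matrix_vector_mult lim invA invS)
  hence "eventually (\<lambda>x. dist (two_stage (fst x) (fst (snd x)) (snd (snd x))) b < e) ?F"
    using e unfolding two_stage_eq[OF A B] tendsto_iff by blast
  moreover note eventually_invertible[OF lim(1) invA]
    eventually_invertible[OF tendsto_second_step[OF lim(1,2) invA] invS]
  ultimately have "eventually (\<lambda>x. invertible (fst x) \<and> invertible (transpose (matrix_inv (fst x) ** fst (snd x)) ** fst x ** (matrix_inv (fst x) ** fst (snd x)))
     \<and> dist (two_stage (fst x) (fst (snd x)) (snd (snd x))) b < e) (nhds (A0, B0, B0 *v b))"
    unfolding nhds_prod[symmetric] by eventually_elim auto
  then obtain d where d: "d > 0" "\<And>A B c. dist (A, B, c) (A0, B0, B0 *v b) < d \<Longrightarrow> 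
     invertible A \<and> invertible (transpose (matrix_inv A ** B) ** A ** (matrix_inv A ** B)) \<and>
     dist (two_stage A B c) b < e"
    unfolding eventually_nhds_metric by (metis fst_conv snd_conv)
  have "dist (A, B, c) (A0, B0, B0 *v b) < d"
    if "dist A A0 \<le> d / 4" "dist B B0 \<le> d / 4" "dist c (B0 *v b) \<le> d / 4" for A B c
  proof -
    have "dist (A, B, c) (A0, B0, B0 *v b) \<le> dist A A0 + (dist B B0 + dist c (B0 *v b))"
      unfolding dist_Pair_Pair
      by (intro order.trans[OF sqrt_sum_squares_le_sum] add_left_mono) auto
    thus ?thesis using that d(1) by linarith
  qed
  thus ?thesis using d by (intro exI[of _ "d/4"]) (force intro: less_imp_le)
qed

section \<open>Events of vanishing probability\<close>

text \<open>
  Convergence to zero of an outer probability.  Covering the events by measurable sets, and only up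
  to null sets, avoids having to prove that expressions built from a sorted sample are measurable.
\<close>

definition vanishing :: "'b measure \<Rightarrow> (nat \<Rightarrow> 'b \<Rightarrow> bool) \<Rightarrow> bool" where
  "vanishing N P \<longleftrightarrow> (\<exists>B. (\<forall>n. B n \<in> sets N) \<and> (\<forall>n. AE \<omega> in N. P n \<omega> \<longrightarrow> \<omega> \<in> B n) \<and>
     (\<lambda>n. measure N (B n)) \<longlonglongrightarrow> 0)"

lemma vanishing_imp:
  assumes Q: "vanishing N Q" and PQ: "\<And>n. AE \<omega> in N. P n \<omega> \<longrightarrow> Q n \<omega>"
  shows "vanishing N P"
proof -
  obtain B where B: "\<And>n. B n \<in> sets N" "\<And>n. AE \<omega> in N. Q n \<omega> \<longrightarrow> \<omega> \<in> B n"
      "(\<lambda>n. measure N (B n)) \<longlonglongrightarrow> 0"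
    using Q unfolding vanishing_def by blast
  have "AE \<omega> in N. P n \<omega> \<longrightarrow> \<omega> \<in> B n" for n
    using B(2)[of n] PQ[of n] by eventually_elim blast
  thus ?thesis using B unfolding vanishing_def by blast
qed

lemma (in finite_measure) vanishing_disj:
  assumes "vanishing M P" "vanishing M Q"
  shows "vanishing M (\<lambda>n \<omega>. P n \<omega> \<or> Q n \<omega>)"
proof -
  obtain A where A: "\<And>n. A n \<in> sets M" "\<And>n. AE \<omega> in M. P n \<omega> \<longrightarrow> \<omega> \<in> A n"
      "(\<lambda>n. measure M (A n)) \<longlonglongrightarrow> 0"
    using assms(1) unfolding vanishing_def by blast
  obtain B where B: "\<And>n. B n \<in> sets M" "\<And>n. AE \<omega> in M. Q n \<omega> \<longrightarrow> \<omega> \<in> B n"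
      "(\<lambda>n. measure M (B n)) \<longlonglongrightarrow> 0"
    using assms(2) unfolding vanishing_def by blast
  have "(\<lambda>n. measure M (A n \<union> B n)) \<longlonglongrightarrow> 0"
  proof (rule tendsto_sandwich)
    show "eventually (\<lambda>n. 0 \<le> measure M (A n \<union> B n)) sequentially" by simp
    show "(\<lambda>n. measure M (A n) + measure M (B n)) \<longlonglongrightarrow> 0"
      using tendsto_add[OF A(3) B(3)] by simp
    show "eventually (\<lambda>n. measure M (A n \<union> B n) \<le> measure M (A n) + measure M (B n)) sequentially"
      by (intro always_eventually allI measure_Un_le A B)
  qed (rule tendsto_const)
  moreover have "AE \<omega> in M. P n \<omega> \<or> Q n \<omega> \<longrightarrow> \<omega> \<in> A n \<union> B n" for n
    using A(2)[of n] B(2)[of n] by auto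
  ultimately show ?thesis unfolding vanishing_def using A(1) B(1)
    by (intro exI[of _ "\<lambda>n. A n \<union> B n"]) auto
qed

lemma (in finite_measure) vanishing_finite_ex:
  assumes "finite I" "\<And>i. i \<in> I \<Longrightarrow> vanishing M (P i)"
  shows "vanishing M (\<lambda>n \<omega>. \<exists>i\<in>I. P i n \<omega>)"
  using assms
proof (induction I rule: finite_induct)
  case empty
  show ?case unfolding vanishing_def by (intro exI[of _ "\<lambda>_. {}"]) auto
next
  case (insert i I)
  have "vanishing M (\<lambda>n \<omega>. P i n \<omega> \<or> (\<exists>j\<in>I. P j n \<omega>))"
    using insert by (intro vanishing_disj) auto
  thus ?case by simp
qed

lemma (in finite_measure) vanishing_of_nn_integral:
  assumes [measurable]: "\<And>n. f n \<in> borel_measurable M"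
    and lim: "(\<lambda>n. \<integral>\<^sup>+\<omega>. f n \<omega> \<partial>M) \<longlonglongrightarrow> 0" and e: "e > 0"
  shows "vanishing M (\<lambda>n \<omega>. ennreal e \<le> f n \<omega>)"
proof -
  let ?B = "\<lambda>n. {\<omega> \<in> space M. ennreal e \<le> f n \<omega>}"
  have le: "emeasure M (?B n) \<le> ennreal (1/e) * (\<integral>\<^sup>+\<omega>. f n \<omega> \<partial>M)" for n
  proof -
    have inv: "ennreal e * ennreal (1/e) = 1" "ennreal (1/e) * ennreal e = 1"
      using e by (simp_all add: ennreal_mult[symmetric])
    have "?B n = {\<omega> \<in> space M. 1 \<le> ennreal (1/e) * f n \<omega>}"
    proof (intro Collect_cong conj_cong refl iffI)
      fix \<omega>
      assume "ennreal e \<le> f n \<omega>"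
      from mult_left_mono[OF this, of "ennreal (1/e)"] show "1 \<le> ennreal (1/e) * f n \<omega>"
        by (simp only: inv zero_le)
    next
      fix \<omega>
      assume "1 \<le> ennreal (1/e) * f n \<omega>"
      from mult_left_mono[OF this, of "ennreal e"] have "ennreal e * 1 \<le> (ennreal e * ennreal (1/e)) * f n \<omega>"
        by (simp only: mult.assoc zero_le)
      thus "ennreal e \<le> f n \<omega>" by (simp only: inv mult_1 mult_1_right)
    qed
    thus ?thesis using nn_integral_Markov_inequality[of "f n" "space M" M "ennreal (1/e)"]
      by (simp add: nn_set_integral_space)
  qed
  have "(\<lambda>n. ennreal (1/e) * (\<integral>\<^sup>+\<omega>. f n \<omega> \<partial>M)) \<longlonglongrightarrow> ennreal (1/e) * 0"
    by (intro ennreal_tendsto_cmult lim) simp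
  hence lim': "(\<lambda>n. ennreal (1/e) * (\<integral>\<^sup>+\<omega>. f n \<omega> \<partial>M)) \<longlonglongrightarrow> 0" by simp
  have "(\<lambda>n. emeasure M (?B n)) \<longlonglongrightarrow> 0"
    by (intro tendsto_sandwich[OF _ _ tendsto_const lim'] always_eventually allI le) simp
  hence "(\<lambda>n. measure M (?B n)) \<longlonglongrightarrow> 0"
    by (simp add: emeasure_eq_measure tendsto_ennreal_iff[of _ _ 0, simplified])
  thus ?thesis unfolding vanishing_def by (intro exI[of _ ?B]) auto
qed

lemma (in prob_space) vanishing_of_expectation:
  fixes f :: "nat \<Rightarrow> 'a \<Rightarrow> real"
  assumes [measurable]: "\<And>n. integrable M (f n)" and "\<And>n \<omega>. 0 \<le> f n \<omega>"
    and lim: "(\<lambda>n. expectation (f n)) \<longlonglongrightarrow> 0" and e: "e > 0"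
  shows "vanishing M (\<lambda>n \<omega>. e \<le> f n \<omega>)"
proof -
  have "(\<integral>\<^sup>+\<omega>. ennreal (f n \<omega>) \<partial>M) = ennreal (expectation (f n))" for n
    using assms by (intro nn_integral_eq_integral) auto
  hence "vanishing M (\<lambda>n \<omega>. ennreal e \<le> ennreal (f n \<omega>))"
    using lim e tendsto_ennrealI[OF lim] by (intro vanishing_of_nn_integral) (auto intro!: borel_measurable_integrable assms)
  thus ?thesis using assms(2) by (simp add: ennreal_le_iff)
qed

lemma (in prob_space) vanishing_converges_in_probability:
  fixes f :: "nat \<Rightarrow> 'a \<Rightarrow> 'c :: {metric_space, second_countable_topology}"
  assumes [measurable]: "\<And>n. f n \<in> borel_measurable M"
    and v: "\<And>e. e > 0 \<Longrightarrow> vanishing M (\<lambda>n \<omega>. dist (f n \<omega>) c > e)"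
  shows "converges_in_probability M f c"
  unfolding converges_in_probability_def
proof (intro allI impI)
  fix e :: real assume "e > 0"
  from v[OF this] obtain B where B: "\<And>n. B n \<in> sets M" "\<And>n. AE \<omega> in M. dist (f n \<omega>) c > e \<longrightarrow> \<omega> \<in> B n"
      "(\<lambda>n. measure M (B n)) \<longlonglongrightarrow> 0"
    unfolding vanishing_def by blast
  have "prob {\<omega> \<in> space M. dist (f n \<omega>) c > e} \<le> prob (B n)" for n
    using B(2)[of n] by (intro finite_measure_mono_AE B) auto
  thus "(\<lambda>n. prob {\<omega> \<in> space M. dist (f n \<omega>) c > e}) \<longlonglongrightarrow> 0"
    by (intro tendsto_sandwich[OF _ _ tendsto_const B(3)] always_eventually allI) simp_all
qed

lemma (in prob_space) vanishing_dist_vec: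
  fixes f :: "nat \<Rightarrow> 'a \<Rightarrow> 'c :: real_normed_vector ^ 'n"
  assumes "\<And>i e. e > 0 \<Longrightarrow> vanishing M (\<lambda>n \<omega>. e \<le> dist (f n \<omega> $ i) (c $ i))" and e: "e > 0"
  shows "vanishing M (\<lambda>n \<omega>. e < dist (f n \<omega>) c)"
proof -
  have "vanishing M (\<lambda>n \<omega>. \<exists>i\<in>UNIV. e / CARD('n) \<le> dist (f n \<omega> $ i) (c $ i))"
    using e by (intro vanishing_finite_ex assms) auto
  thus ?thesis
  proof (rule vanishing_imp, intro AE_I2 impI)
    fix n \<omega> assume far: "e < dist (f n \<omega>) c"
    show "\<exists>i\<in>UNIV. e / CARD('n) \<le> dist (f n \<omega> $ i) (c $ i)"
    proof (rule ccontr)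
      assume "\<not> ?thesis"
      hence "(\<Sum>i\<in>UNIV. dist (f n \<omega> $ i) (c $ i)) \<le> (\<Sum>i\<in>(UNIV :: 'n set). e / CARD('n))"
        by (intro sum_mono) (auto simp: not_le less_imp_le)
      hence "(\<Sum>i\<in>UNIV. dist (f n \<omega> $ i) (c $ i)) \<le> e" by simp
      moreover have "dist (f n \<omega>) c \<le> (\<Sum>i\<in>UNIV. dist (f n \<omega> $ i) (c $ i))"
        unfolding dist_vec_def by (rule L2_set_le_sum) auto
      ultimately show False using far by linarith
    qed
  qed
qed

section \<open>Independence and the weak law of large numbers\<close>

text \<open>
  Fubini for two independent variables.  Independence is stated as the factorization of the joint
  law, so that the variables may take values in different types.
\<close>

lemma (in prob_space) nn_integral_independent:
  assumes [measurable]: "A \<in> measurable M S" "B \<in> measurable M S'"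
    and prod: "distr M (S \<Otimes>\<^sub>M S') (\<lambda>\<omega>. (A \<omega>, B \<omega>)) = distr M S A \<Otimes>\<^sub>M distr M S' B"
    and [measurable]: "h \<in> borel_measurable (S \<Otimes>\<^sub>M S')"
  shows "(\<integral>\<^sup>+\<omega>. h (A \<omega>, B \<omega>) \<partial>M) = (\<integral>\<^sup>+\<omega>. \<integral>\<^sup>+\<omega>'. h (A \<omega>, B \<omega>') \<partial>M \<partial>M)"
    and "(\<integral>\<^sup>+\<omega>. h (A \<omega>, B \<omega>) \<partial>M) = (\<integral>\<^sup>+\<omega>'. \<integral>\<^sup>+\<omega>. h (A \<omega>, B \<omega>') \<partial>M \<partial>M)"
proof -
  interpret A: prob_space "distr M S A" by (rule prob_space_distr) measurable
  interpret B: prob_space "distr M S' B" by (rule prob_space_distr) measurable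
  interpret AB: pair_prob_space "distr M S A" "distr M S' B" ..
  have h': "h \<in> borel_measurable (distr M S A \<Otimes>\<^sub>M distr M S' B)" by measurable
  have "(\<integral>\<^sup>+\<omega>. h (A \<omega>, B \<omega>) \<partial>M) = (\<integral>\<^sup>+z. h z \<partial>distr M (S \<Otimes>\<^sub>M S') (\<lambda>\<omega>. (A \<omega>, B \<omega>)))"
    by (subst nn_integral_distr) auto
  hence eq: "(\<integral>\<^sup>+\<omega>. h (A \<omega>, B \<omega>) \<partial>M) = (\<integral>\<^sup>+z. h z \<partial>(distr M S A \<Otimes>\<^sub>M distr M S' B))"
    by (simp add: prod)
  have sA: "a \<in> space S" if "a = A \<omega>" "\<omega> \<in> space M" for a \<omega>
    using that measurable_space[of A M S] by simp
  have sB: "a \<in> space S'" if "a = B \<omega>" "\<omega> \<in> space M" for a \<omega>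
    using that measurable_space[of B M S'] by simp
  have "(\<integral>\<^sup>+z. h z \<partial>(distr M S A \<Otimes>\<^sub>M distr M S' B)) = (\<integral>\<^sup>+a. \<integral>\<^sup>+b. h (a, b) \<partial>distr M S' B \<partial>distr M S A)"
    by (rule B.nn_integral_fst[symmetric]) (rule h')
  also have "\<dots> = (\<integral>\<^sup>+\<omega>. \<integral>\<^sup>+b. h (A \<omega>, b) \<partial>distr M S' B \<partial>M)"
    by (subst nn_integral_distr) auto
  also have "\<dots> = (\<integral>\<^sup>+\<omega>. \<integral>\<^sup>+\<omega>'. h (A \<omega>, B \<omega>') \<partial>M \<partial>M)"
    by (intro nn_integral_cong nn_integral_distr) (auto intro!: measurable_compose_Pair1 sA)
  finally show "(\<integral>\<^sup>+\<omega>. h (A \<omega>, B \<omega>) \<partial>M) = (\<integral>\<^sup>+\<omega>. \<integral>\<^sup>+\<omega>'. h (A \<omega>, B \<omega>') \<partial>M \<partial>M)"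
    using eq by simp
  have "(\<integral>\<^sup>+z. h z \<partial>(distr M S A \<Otimes>\<^sub>M distr M S' B)) = (\<integral>\<^sup>+b. \<integral>\<^sup>+a. h (a, b) \<partial>distr M S A \<partial>distr M S' B)"
    by (rule AB.nn_integral_snd[symmetric]) (rule h')
  also have "\<dots> = (\<integral>\<^sup>+\<omega>'. \<integral>\<^sup>+a. h (a, B \<omega>') \<partial>distr M S A \<partial>M)"
    by (subst nn_integral_distr) auto
  also have "\<dots> = (\<integral>\<^sup>+\<omega>'. \<integral>\<^sup>+\<omega>. h (A \<omega>, B \<omega>') \<partial>M \<partial>M)"
    by (intro nn_integral_cong nn_integral_distr) (auto intro!: measurable_compose_Pair1 sB)
  finally show "(\<integral>\<^sup>+\<omega>. h (A \<omega>, B \<omega>) \<partial>M) = (\<integral>\<^sup>+\<omega>'. \<integral>\<^sup>+\<omega>. h (A \<omega>, B \<omega>') \<partial>M \<partial>M)"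
    using eq by simp
qed

lemma (in prob_space) expectation_abs_le_sqrt:
  assumes "integrable M X" "integrable M (\<lambda>\<omega>. (X \<omega>)\<^sup>2)"
  shows "expectation (\<lambda>\<omega>. \<bar>X \<omega>\<bar>) \<le> sqrt (expectation (\<lambda>\<omega>. (X \<omega>)\<^sup>2))"
proof -
  have "0 \<le> variance (\<lambda>\<omega>. \<bar>X \<omega>\<bar>)" by (rule variance_positive)
  also have "\<dots> = expectation (\<lambda>\<omega>. (X \<omega>)\<^sup>2) - (expectation (\<lambda>\<omega>. \<bar>X \<omega>\<bar>))\<^sup>2"
    using variance_eq[of "\<lambda>\<omega>. \<bar>X \<omega>\<bar>"] assms by simp
  finally show ?thesis by (intro real_le_rsqrt) simp
qed

locale iid_sample = prob_space N for N :: "'b measure" +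
  fixes V :: "nat \<Rightarrow> 'b \<Rightarrow> 'v :: topological_space" and \<mu> :: "'v measure"
  assumes indep: "indep_vars (\<lambda>_. borel) V UNIV"
    and law: "\<And>i. distr N borel (V i) = \<mu>"
begin

lemma measurable_V [measurable]: "V i \<in> borel_measurable N"
  using indep by (auto simp: indep_vars_def)

lemma sets_law [measurable_cong, simp]: "sets \<mu> = sets borel"
  using law[of 0] by auto

lemma prob_space_law: "prob_space \<mu>"
  using prob_space_distr[OF measurable_V[of 0]] law[of 0] by simp

lemma integral_law:
  fixes g :: "'v \<Rightarrow> real"
  assumes "g \<in> borel_measurable borel"
  shows "expectation (\<lambda>\<omega>. g (V i \<omega>)) = (\<integral>v. g v \<partial>\<mu>)"
  using integral_distr[OF measurable_V[of i] assms] law[of i] by simp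

lemma integrable_law:
  fixes g :: "'v \<Rightarrow> real"
  assumes "g \<in> borel_measurable borel"
  shows "integrable N (\<lambda>\<omega>. g (V i \<omega>)) \<longleftrightarrow> integrable \<mu> g"
  using integrable_distr_eq[OF measurable_V[of i] assms] law[of i] by simp

text \<open>
  The centred terms are uncorrelated and bounded by \<open>2 K\<close>, so the second moment of their sum is at
  most \<open>4 K\<^sup>2 n\<close>.
\<close>

lemma wlln_bounded:
  fixes g :: "'v \<Rightarrow> real"
  assumes [measurable]: "g \<in> borel_measurable borel" and K: "\<And>v. \<bar>g v\<bar> \<le> K" and n: "n > 0"
  shows "expectation (\<lambda>\<omega>. \<bar>(\<Sum>i<n. g (V i \<omega>)) / n - (\<integral>v. g v \<partial>\<mu>)\<bar>) \<le> 2 * K / sqrt n"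
proof -
  interpret \<mu>: prob_space \<mu> by (rule prob_space_law)
  have K0: "K \<ge> 0" using K[of undefined] by linarith
  define m where "m = (\<integral>v. g v \<partial>\<mu>)"
  have ig: "integrable \<mu> g" using K by (intro \<mu>.integrable_const_bound[of g K]) auto
  have "\<bar>m\<bar> \<le> (\<integral>v. \<bar>g v\<bar> \<partial>\<mu>)" unfolding m_def by (rule integral_abs_bound)
  also have "\<dots> \<le> (\<integral>v. K \<partial>\<mu>)" using ig K by (intro integral_mono) auto
  finally have m: "\<bar>m\<bar> \<le> K" by (simp add: \<mu>.prob_space)
  define h where "h i \<omega> = g (V i \<omega>) - m" for i \<omega>
  have [measurable]: "h i \<in> borel_measurable N" for i unfolding h_def by measurable
  have hb: "\<bar>h i \<omega>\<bar> \<le> 2 * K" for i \<omega> using K[of "V i \<omega>"] m unfolding h_def by linarith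
  have hhb: "\<bar>h i \<omega> * h j \<omega>\<bar> \<le> 2 * K * (2 * K)" for i j \<omega>
    unfolding abs_mult by (intro mult_mono hb) (use K0 in auto)
  have ih: "integrable N (h i)" for i using hb by (intro integrable_const_bound[of _ "2*K"]) auto
  have ihh: "integrable N (\<lambda>\<omega>. h i \<omega> * h j \<omega>)" for i j
    using hhb by (intro integrable_const_bound[of _ "2*K*(2*K)"]) auto
  have Eh: "expectation (h i) = 0" for i
  proof -
    have "integrable N (\<lambda>\<omega>. g (V i \<omega>))" using ig by (simp add: integrable_law)
    thus ?thesis unfolding h_def by (simp add: integral_law m_def prob_space)
  qed
  have off: "expectation (\<lambda>\<omega>. h i \<omega> * h j \<omega>) = 0" if "i \<noteq> j" for i j
  proof -
    have "indep_vars (\<lambda>_. borel) (\<lambda>i \<omega>. h i \<omega>) UNIV"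
      unfolding h_def by (rule indep_vars_compose2[OF indep, where Y="\<lambda>_ v. g v - m"]) measurable
    hence "indep_vars (\<lambda>_. borel) h {i, j}" by (rule indep_vars_subset) simp
    hence "indep_var borel (h i) borel (h j)"
      using indep_vars_sum[of "{j}" i h] that by simp
    from indep_var_lebesgue_integral[OF this ih ih] show ?thesis by (simp add: Eh)
  qed
  have sq: "(\<Sum>i<n. h i \<omega>)\<^sup>2 = (\<Sum>i<n. \<Sum>j<n. h i \<omega> * h j \<omega>)" for \<omega>
    by (simp add: power2_eq_square sum_product)
  have iS: "integrable N (\<lambda>\<omega>. \<Sum>i<n. h i \<omega>)" by (intro Bochner_Integration.integrable_sum ih)
  have iS2: "integrable N (\<lambda>\<omega>. (\<Sum>i<n. h i \<omega>)\<^sup>2)"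
    unfolding sq by (intro Bochner_Integration.integrable_sum ihh)
  have "expectation (\<lambda>\<omega>. (\<Sum>i<n. h i \<omega>)\<^sup>2) = (\<Sum>i<n. \<Sum>j<n. expectation (\<lambda>\<omega>. h i \<omega> * h j \<omega>))"
    unfolding sq by (simp add: ihh Bochner_Integration.integral_sum Bochner_Integration.integrable_sum)
  also have "\<dots> = (\<Sum>i<n. \<Sum>j<n. if j = i then expectation (\<lambda>\<omega>. h i \<omega> * h i \<omega>) else 0)"
    by (intro sum.cong) (auto simp: off)
  also have "\<dots> = (\<Sum>i<n. expectation (\<lambda>\<omega>. h i \<omega> * h i \<omega>))" by simp
  also have "\<dots> \<le> (\<Sum>i<n. 2 * K * (2 * K))"
  proof (rule sum_mono)
    fix i
    have "expectation (\<lambda>\<omega>. h i \<omega> * h i \<omega>) \<le> expectation (\<lambda>\<omega>. 2 * K * (2 * K))"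
      using hhb[of i _ i] by (intro integral_mono ihh) (auto simp: abs_le_iff)
    thus "expectation (\<lambda>\<omega>. h i \<omega> * h i \<omega>) \<le> 2 * K * (2 * K)" by (simp add: prob_space)
  qed
  finally have "expectation (\<lambda>\<omega>. (\<Sum>i<n. h i \<omega>)\<^sup>2) \<le> n * (2 * K)\<^sup>2" by (simp add: power2_eq_square)
  hence "expectation (\<lambda>\<omega>. \<bar>\<Sum>i<n. h i \<omega>\<bar>) \<le> sqrt (n * (2 * K)\<^sup>2)"
    using expectation_abs_le_sqrt[OF iS iS2] real_sqrt_le_mono order.trans by blast
  also have "\<dots> = sqrt n * (2 * K)" using K0 by (simp add: real_sqrt_mult)
  finally have 1: "expectation (\<lambda>\<omega>. \<bar>\<Sum>i<n. h i \<omega>\<bar>) \<le> sqrt n * (2 * K)" .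
  have "\<bar>(\<Sum>i<n. g (V i \<omega>)) / n - m\<bar> = \<bar>\<Sum>i<n. h i \<omega>\<bar> / n" for \<omega>
  proof -
    have "(\<Sum>i<n. g (V i \<omega>)) / n - m = (\<Sum>i<n. h i \<omega>) / n"
      using n by (simp add: h_def sum_subtractf diff_divide_distrib)
    thus ?thesis by simp
  qed
  hence "expectation (\<lambda>\<omega>. \<bar>(\<Sum>i<n. g (V i \<omega>)) / n - m\<bar>) = expectation (\<lambda>\<omega>. \<bar>\<Sum>i<n. h i \<omega>\<bar>) / n"
    by simp
  also have "\<dots> \<le> sqrt n * (2 * K) / n" using 1 by (intro divide_right_mono) auto
  also have "\<dots> = 2 * K / sqrt n"
    using n by (simp add: field_simps)
  finally show ?thesis by (simp add: m_def)
qed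

text \<open>
  Truncate \<open>g\<close> at a level where the remainder has small mean.  The bounded part has small variance,
  and the remainder contributes at most twice its mean.  A first moment has to suffice, since the
  summands will be products of variables that have second moments.
\<close>

lemma wlln_L1:
  fixes g :: "'v \<Rightarrow> real"
  assumes [measurable]: "g \<in> borel_measurable borel" and ig: "integrable \<mu> g"
  shows "(\<lambda>n. expectation (\<lambda>\<omega>. \<bar>(\<Sum>i<n. g (V i \<omega>)) / n - (\<integral>v. g v \<partial>\<mu>)\<bar>)) \<longlonglongrightarrow> 0"
proof (rule LIMSEQ_I)
  fix e :: real assume e: "e > 0"
  interpret \<mu>: prob_space \<mu> by (rule prob_space_law)
  define gK where "gK K v = (if \<bar>g v\<bar> \<le> real K then g v else 0)" for K :: nat and v
  have [measurable]: "gK K \<in> borel_measurable borel" for K unfolding gK_def by measurable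
  have gKb: "\<bar>gK K v\<bar> \<le> K" for K v by (simp add: gK_def)
  have "(\<lambda>K. \<integral>v. \<bar>g v - gK K v\<bar> \<partial>\<mu>) \<longlonglongrightarrow> (\<integral>v. 0 \<partial>\<mu>)"
  proof (rule integral_dominated_convergence[where w="\<lambda>v. \<bar>g v\<bar>"])
    show "AE v in \<mu>. (\<lambda>K. \<bar>g v - gK K v\<bar>) \<longlonglongrightarrow> 0"
    proof (intro AE_I2 tendsto_eventually)
      fix v
      show "eventually (\<lambda>K. \<bar>g v - gK K v\<bar> = 0) sequentially"
        using eventually_ge_at_top[of "nat \<lceil>\<bar>g v\<bar>\<rceil>"]
        by eventually_elim (auto simp: gK_def nat_le_iff ceiling_le_iff)
    qed
  qed (use ig in \<open>auto simp: gK_def\<close>)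
  from order_tendstoD(2)[OF this, of "e / 4"]
  have "eventually (\<lambda>K. (\<integral>v. \<bar>g v - gK K v\<bar> \<partial>\<mu>) < e / 4) sequentially"
    using e by simp
  then obtain K where K: "(\<integral>v. \<bar>g v - gK K v\<bar> \<partial>\<mu>) < e / 4"
    using eventually_happens'[OF sequentially_bot] by blast
  have iK: "integrable \<mu> (gK K)" using gKb by (intro \<mu>.integrable_const_bound[of _ K]) auto
  have "((\<lambda>n. 2 * real K / sqrt (real n)) \<longlongrightarrow> 0) sequentially"
    by (intro real_tendsto_divide_at_top[OF tendsto_const] filterlim_compose[OF sqrt_at_top] filterlim_real_sequentially)
  from order_tendstoD(2)[OF this, of "e / 2"]
  have "eventually (\<lambda>n. 2 * real K / sqrt (real n) < e / 2) sequentially"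
    using e by simp
  hence "eventually (\<lambda>n. norm (expectation (\<lambda>\<omega>. \<bar>(\<Sum>i<n. g (V i \<omega>)) / n - (\<integral>v. g v \<partial>\<mu>)\<bar>) - 0) < e) sequentially"
    using eventually_gt_at_top[of 0]
  proof eventually_elim
    case (elim n)
    let ?D = "\<lambda>v. g v - gK K v"
    have iV: "integrable N (\<lambda>\<omega>. g (V i \<omega>))" "integrable N (\<lambda>\<omega>. gK K (V i \<omega>))" for i
      using ig iK by (simp_all add: integrable_law)
    have iD: "integrable N (\<lambda>\<omega>. \<bar>?D (V i \<omega>)\<bar>)" for i using iV by auto
    have pt: "\<bar>(\<Sum>i<n. g (V i \<omega>)) / n - (\<integral>v. g v \<partial>\<mu>)\<bar> \<le>
       \<bar>(\<Sum>i<n. gK K (V i \<omega>)) / n - (\<integral>v. gK K v \<partial>\<mu>)\<bar> + ((\<Sum>i<n. \<bar>?D (V i \<omega>)\<bar>) / n + (\<integral>v. \<bar>?D v\<bar> \<partial>\<mu>))" for \<omega>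
    proof -
      have "(\<Sum>i<n. g (V i \<omega>)) / n = (\<Sum>i<n. gK K (V i \<omega>)) / n + (\<Sum>i<n. ?D (V i \<omega>)) / n"
        by (simp add: add_divide_distrib[symmetric] sum.distrib[symmetric])
      moreover have "(\<integral>v. g v \<partial>\<mu>) = (\<integral>v. gK K v \<partial>\<mu>) + (\<integral>v. ?D v \<partial>\<mu>)"
        using ig iK by simp
      moreover have "\<bar>(\<Sum>i<n. ?D (V i \<omega>)) / n\<bar> \<le> (\<Sum>i<n. \<bar>?D (V i \<omega>)\<bar>) / n"
        by (simp add: divide_right_mono)
      moreover have "\<bar>\<integral>v. ?D v \<partial>\<mu>\<bar> \<le> (\<integral>v. \<bar>?D v\<bar> \<partial>\<mu>)" by (rule integral_abs_bound)
      ultimately show ?thesis by linarith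
    qed
    have "expectation (\<lambda>\<omega>. \<bar>(\<Sum>i<n. g (V i \<omega>)) / n - (\<integral>v. g v \<partial>\<mu>)\<bar>) \<le>
       expectation (\<lambda>\<omega>. \<bar>(\<Sum>i<n. gK K (V i \<omega>)) / n - (\<integral>v. gK K v \<partial>\<mu>)\<bar> + ((\<Sum>i<n. \<bar>?D (V i \<omega>)\<bar>) / n + (\<integral>v. \<bar>?D v\<bar> \<partial>\<mu>)))"
      using iV iD pt by (intro integral_mono) auto
    also have "\<dots> = expectation (\<lambda>\<omega>. \<bar>(\<Sum>i<n. gK K (V i \<omega>)) / n - (\<integral>v. gK K v \<partial>\<mu>)\<bar>) +
        (expectation (\<lambda>\<omega>. (\<Sum>i<n. \<bar>?D (V i \<omega>)\<bar>) / n) + (\<integral>v. \<bar>?D v\<bar> \<partial>\<mu>))"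
      using iV iD by (simp add: prob_space)
    also have "expectation (\<lambda>\<omega>. (\<Sum>i<n. \<bar>?D (V i \<omega>)\<bar>) / n) = (\<Sum>i<n. expectation (\<lambda>\<omega>. \<bar>?D (V i \<omega>)\<bar>)) / n"
      using iD by simp
    also have "\<dots> = (\<integral>v. \<bar>?D v\<bar> \<partial>\<mu>)"
      using elim by (simp add: integral_law[of "\<lambda>v. \<bar>?D v\<bar>"])
    also have "expectation (\<lambda>\<omega>. \<bar>(\<Sum>i<n. gK K (V i \<omega>)) / n - (\<integral>v. gK K v \<partial>\<mu>)\<bar>) \<le> 2 * real K / sqrt n"
      using elim by (intro wlln_bounded gKb) auto
    finally have "expectation (\<lambda>\<omega>. \<bar>(\<Sum>i<n. g (V i \<omega>)) / n - (\<integral>v. g v \<partial>\<mu>)\<bar>) < e"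
      using K elim by linarith
    moreover have "expectation (\<lambda>\<omega>. \<bar>(\<Sum>i<n. g (V i \<omega>)) / n - (\<integral>v. g v \<partial>\<mu>)\<bar>) \<ge> 0" by simp
    ultimately show ?case by simp
  qed
  thus "\<exists>no. \<forall>n\<ge>no. norm (expectation (\<lambda>\<omega>. \<bar>(\<Sum>i<n. g (V i \<omega>)) / n - (\<integral>v. g v \<partial>\<mu>)\<bar>) - 0) < e"
    by (simp add: eventually_at_top_linorder)
qed

lemma wlln:
  fixes g :: "'v \<Rightarrow> real"
  assumes [measurable]: "g \<in> borel_measurable borel" and ig: "integrable \<mu> g" and e: "e > 0"
  shows "vanishing N (\<lambda>n \<omega>. e \<le> \<bar>(\<Sum>i<n. g (V i \<omega>)) / n - (\<integral>v. g v \<partial>\<mu>)\<bar>)"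
proof (rule vanishing_of_expectation[OF _ _ _ e])
  show "integrable N (\<lambda>\<omega>. \<bar>(\<Sum>i<n. g (V i \<omega>)) / n - (\<integral>v. g v \<partial>\<mu>)\<bar>)" for n
    using ig by (auto simp: integrable_law intro!: Bochner_Integration.integrable_diff Bochner_Integration.integrable_sum integrable_divide)
qed (use wlln_L1[OF _ ig] in auto)

end

section \<open>Numbers at risk in an independent sample\<close>

context iid_sample
begin

text \<open>
  The number of sample members other than \<open>j\<close> that are still at risk at \<open>s\<close>.  Unlike the full number
  at risk, it is independent of the \<open>j\<close>-th observation.
\<close>

definition others :: "('v \<Rightarrow> real) \<Rightarrow> nat \<Rightarrow> nat \<Rightarrow> real \<Rightarrow> 'b \<Rightarrow> real" where
  "others y n j s \<omega> = (\<Sum>k\<in>{..<n} - {j}. of_bool (s \<le> y (V k \<omega>)))"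

lemma others_nonneg: "others y n j s \<omega> \<ge> 0"
  unfolding others_def by (intro sum_nonneg) auto

lemma measurable_others [measurable (raw)]:
  assumes [measurable]: "y \<in> borel_measurable borel" "f \<in> borel_measurable L" "X \<in> measurable L N"
  shows "(\<lambda>z. others y n j (f z) (X z)) \<in> borel_measurable L"
  unfolding others_def of_bool_def by measurable

lemma indep_leave_one_out:
  "indep_var (PiM {j} (\<lambda>_. borel)) (\<lambda>\<omega>. \<lambda>k\<in>{j}. V k \<omega>)
     (PiM ({..<n} - {j}) (\<lambda>_. borel)) (\<lambda>\<omega>. \<lambda>k\<in>{..<n} - {j}. V k \<omega>)"
  by (rule indep_var_restrict[OF indep]) auto

text \<open>
  The \<open>j\<close>-th observation may be integrated out separately, at a fixed value \<open>v\<close>, because the count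
  only looks at the other observations.
\<close>

lemma nn_integral_leave_one_out:
  assumes y [measurable]: "y \<in> borel_measurable borel"
    and h [measurable]: "h \<in> borel_measurable (borel \<Otimes>\<^sub>M borel)"
  shows "(\<integral>\<^sup>+\<omega>. h (V j \<omega>, others y n j (y (V j \<omega>)) \<omega>) \<partial>N) =
    (\<integral>\<^sup>+v. \<integral>\<^sup>+\<omega>. h (v, others y n j (y v) \<omega>) \<partial>N \<partial>\<mu>)"
proof -
  let ?K = "{..<n} - {j}"
  let ?R = "\<lambda>\<omega>. \<lambda>k\<in>?K. V k \<omega>"
  let ?c = "\<lambda>s x. \<Sum>k\<in>?K. if s \<le> y (x k) then 1 else 0 :: real"
  let ?S = "\<lambda>\<omega>. \<lambda>k\<in>{j}. V k \<omega>"
  define H where "H z = h (fst z j, ?c (y (fst z j)) (snd z))" for z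
  have [measurable]: "H \<in> borel_measurable (PiM {j} (\<lambda>_. borel) \<Otimes>\<^sub>M PiM ?K (\<lambda>_. borel))"
    unfolding H_def by measurable
  have R [measurable]: "?R \<in> measurable N (PiM ?K (\<lambda>_. borel))" by measurable
  have S: "?S \<in> measurable N (PiM {j} (\<lambda>_. borel))" by measurable
  have c: "?c s (?R \<omega>) = others y n j s \<omega>" for s \<omega>
    unfolding others_def of_bool_def by (rule sum.cong) simp_all
  have Sj: "?S \<omega> j = V j \<omega>" for \<omega> by simp
  have "distr N (PiM {j} (\<lambda>_. borel) \<Otimes>\<^sub>M PiM ?K (\<lambda>_. borel)) (\<lambda>\<omega>. (?S \<omega>, ?R \<omega>)) =
      distr N (PiM {j} (\<lambda>_. borel)) ?S \<Otimes>\<^sub>M distr N (PiM ?K (\<lambda>_. borel)) ?R"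
    using indep_leave_one_out[of j n] by (simp add: indep_var_distribution_eq)
  from nn_integral_independent(1)[OF S R this, of H]
  have "(\<integral>\<^sup>+\<omega>. H (?S \<omega>, ?R \<omega>) \<partial>N) = (\<integral>\<^sup>+\<omega>. \<integral>\<^sup>+\<omega>'. H (?S \<omega>, ?R \<omega>') \<partial>N \<partial>N)" by simp
  hence eq: "(\<integral>\<^sup>+\<omega>. h (V j \<omega>, others y n j (y (V j \<omega>)) \<omega>) \<partial>N) = (\<integral>\<^sup>+\<omega>. \<integral>\<^sup>+\<omega>'. h (V j \<omega>, others y n j (y (V j \<omega>)) \<omega>') \<partial>N \<partial>N)"
    unfolding H_def fst_conv snd_conv c Sj .
  have "(\<lambda>v. \<integral>\<^sup>+\<omega>. h (v, ?c (y v) (?R \<omega>)) \<partial>N) \<in> borel_measurable borel"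
    by measurable
  hence "(\<lambda>v. \<integral>\<^sup>+\<omega>. h (v, others y n j (y v) \<omega>) \<partial>N) \<in> borel_measurable borel"
    unfolding c .
  hence "(\<integral>\<^sup>+v. \<integral>\<^sup>+\<omega>. h (v, others y n j (y v) \<omega>) \<partial>N \<partial>distr N borel (V j)) = (\<integral>\<^sup>+\<omega>. \<integral>\<^sup>+\<omega>'. h (V j \<omega>, others y n j (y (V j \<omega>)) \<omega>') \<partial>N \<partial>N)"
    by (intro nn_integral_distr) auto
  thus ?thesis using eq law[of j] by simp
qed

text \<open>
  Multiplying the \<open>j\<close>-th expectation by \<open>p\<close>, the probability that the independent observation \<open>j\<close> is at
  risk at \<open>s\<close>, turns \<open>1 / (1 + others)\<close> into the indicator of \<open>j\<close> being at risk divided by the full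
  number at risk.  Summed over \<open>j\<close> these quotients are at most one.
\<close>

lemma sum_expectation_leave_one_out:
  fixes s :: real
  assumes y [measurable]: "y \<in> borel_measurable borel"
  defines "p \<equiv> measure \<mu> {v. s \<le> y v}"
  assumes p: "p > 0"
  shows "(\<Sum>j<n. expectation (\<lambda>\<omega>. 1 / (1 + others y n j s \<omega>))) \<le> 1 / p"
proof -
  let ?I = "\<lambda>j \<omega>. of_bool (s \<le> y (V j \<omega>)) :: real"
  have [measurable]: "?I j \<in> borel_measurable N" for j unfolding of_bool_def by measurable
  have iI: "integrable N (?I j)" for j by (intro integrable_const_bound[of _ 1]) auto
  have q1: "1 / (1 + others y n j s \<omega>) \<le> 1" for j \<omega> using others_nonneg[of y n j s \<omega>] by simp
  have q0: "0 \<le> 1 / (1 + others y n j s \<omega>)" for j \<omega> using others_nonneg[of y n j s \<omega>] by simp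
  have iq: "integrable N (\<lambda>\<omega>. 1 / (1 + others y n j s \<omega>))" for j
    using q0 q1 by (intro integrable_const_bound[of _ 1]) auto
  have p_eq: "expectation (?I j) = p" for j
  proof -
    have "expectation (?I j) = (\<integral>v. of_bool (s \<le> y v) \<partial>\<mu>)"
      by (rule integral_law) (simp add: of_bool_def)
    also have "\<dots> = (\<integral>v. indicator {v. s \<le> y v} v \<partial>\<mu>)"
      by (intro Bochner_Integration.integral_cong) (auto simp: indicator_def)
    also have "\<dots> = p"
      using sets_eq_imp_space_eq[OF sets_law] by (simp add: p_def)
    finally show ?thesis .
  qed
  have ij: "integrable N (\<lambda>\<omega>. ?I j \<omega> * (1 / (1 + others y n j s \<omega>)))"
    and eq: "expectation (\<lambda>\<omega>. ?I j \<omega> * (1 / (1 + others y n j s \<omega>))) = p * expectation (\<lambda>\<omega>. 1 / (1 + others y n j s \<omega>))"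
    for j
  proof -
    let ?K = "{..<n} - {j}"
    let ?q = "\<lambda>x. 1 / (1 + (\<Sum>k\<in>?K. if s \<le> y (x k) then 1 else 0 :: real))"
    have c: "?q (\<lambda>k\<in>?K. V k \<omega>) = 1 / (1 + others y n j s \<omega>)" for \<omega>
      unfolding others_def by (intro arg_cong[where f="\<lambda>x. 1 / (1 + x)"] sum.cong) auto
    have "indep_var borel ((\<lambda>x. if s \<le> y (x j) then 1 else 0 :: real) \<circ> (\<lambda>\<omega>. \<lambda>k\<in>{j}. V k \<omega>)) borel (?q \<circ> (\<lambda>\<omega>. \<lambda>k\<in>?K. V k \<omega>))"
      by (rule indep_var_compose[OF indep_leave_one_out]) measurable
    moreover have "(\<lambda>x. if s \<le> y (x j) then 1 else 0 :: real) \<circ> (\<lambda>\<omega>. \<lambda>k\<in>{j}. V k \<omega>) = ?I j" by (auto simp: fun_eq_iff)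
    ultimately have iv: "indep_var borel (?I j) borel (\<lambda>\<omega>. 1 / (1 + others y n j s \<omega>))"
      unfolding comp_def[of ?q] c by simp
    show "integrable N (\<lambda>\<omega>. ?I j \<omega> * (1 / (1 + others y n j s \<omega>)))"
      by (rule indep_var_integrable[OF iv iI iq])
    show "expectation (\<lambda>\<omega>. ?I j \<omega> * (1 / (1 + others y n j s \<omega>))) = p * expectation (\<lambda>\<omega>. 1 / (1 + others y n j s \<omega>))"
      using indep_var_lebesgue_integral[OF iv iI iq] p_eq by simp
  qed
  have pt: "(\<Sum>j<n. ?I j \<omega> * (1 / (1 + others y n j s \<omega>))) \<le> 1" for \<omega>
  proof -
    define R where "R = (\<Sum>k<n. ?I k \<omega>)"
    have "(\<Sum>j<n. ?I j \<omega> * (1 / (1 + others y n j s \<omega>))) = (\<Sum>j<n. ?I j \<omega> / R)"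
    proof (rule sum.cong)
      fix j assume "j \<in> {..<n}"
      hence "R = ?I j \<omega> + others y n j s \<omega>"
        unfolding R_def others_def by (subst sum.remove[of _ j]) auto
      thus "?I j \<omega> * (1 / (1 + others y n j s \<omega>)) = ?I j \<omega> / R" by (auto simp: of_bool_def)
    qed simp
    also have "\<dots> = R / R" unfolding R_def by (rule sum_divide_distrib[symmetric])
    also have "\<dots> \<le> 1" by simp
    finally show ?thesis .
  qed
  have "p * (\<Sum>j<n. expectation (\<lambda>\<omega>. 1 / (1 + others y n j s \<omega>))) = (\<Sum>j<n. expectation (\<lambda>\<omega>. ?I j \<omega> * (1 / (1 + others y n j s \<omega>))))"
    unfolding sum_distrib_left by (rule sum.cong[OF refl]) (rule eq[symmetric])
  also have "\<dots> = expectation (\<lambda>\<omega>. \<Sum>j<n. ?I j \<omega> * (1 / (1 + others y n j s \<omega>)))"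
    by (rule Bochner_Integration.integral_sum[symmetric]) (use ij in auto)
  also have "\<dots> \<le> expectation (\<lambda>\<omega>. 1)"
    by (intro integral_mono pt Bochner_Integration.integrable_sum ij) auto
  finally show ?thesis using p by (simp add: field_simps prob_space)
qed

text \<open>
  The expected error, summed over the members of the sample as if each of them were observed at \<open>s\<close>,
  of replacing the reciprocal number at risk by \<open>1 / (n p)\<close> and of linearizing the logarithm.
\<close>

definition risk_error :: "('v \<Rightarrow> real) \<Rightarrow> nat \<Rightarrow> real \<Rightarrow> real" where
  "risk_error y n s = (\<Sum>j<n. expectation (\<lambda>\<omega>. \<bar>1 / (1 + others y n j s \<omega>) - 1 / (n * measure \<mu> {v. s \<le> y v})\<bar> + 2 / (1 + others y n j s \<omega>)\<^sup>2))"

text \<open>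
  The first bound is uniform in \<open>n\<close> and serves as the dominating function.  For the limit, with
  \<open>a = 1 / (n p)\<close>, write \<open>\<bar>x - a\<bar>\<close> as \<open>x - a\<close> plus twice the positive part of \<open>a - x\<close>.  The terms \<open>x - a\<close>
  have a nonpositive total mean by \<open>sum_expectation_leave_one_out\<close>.  The positive part of \<open>a - x\<close> only
  arises when more than \<open>n p\<close> observations are at risk, so its denominator is harmless and the weak
  law of large numbers applies.  Small numbers at risk, where the reciprocal is large, are thus never
  estimated directly.
\<close>

lemma risk_error:
  fixes s :: real
  assumes y [measurable]: "y \<in> borel_measurable borel"
  defines "p \<equiv> measure \<mu> {v. s \<le> y v}"
  assumes p: "p > 0"
  shows "risk_error y n s \<le> 4 / p"
    and "(\<lambda>n. risk_error y n s) \<longlonglongrightarrow> 0"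
proof -
  define x where "x n j \<omega> = 1 / (1 + others y n j s \<omega>)" for n j \<omega>
  have [measurable]: "x n j \<in> borel_measurable N" for n j unfolding x_def by measurable
  have x: "0 \<le> x n j \<omega>" "x n j \<omega> \<le> 1" for n j \<omega> using others_nonneg[of y n j s \<omega>] by (auto simp: x_def)
  have ix: "integrable N (x n j)" for n j using x by (intro integrable_const_bound[of _ 1]) auto
  have x2: "(x n j \<omega>)\<^sup>2 \<le> x n j \<omega>" for n j \<omega>
    using mult_left_mono[OF x(2) x(1)] by (simp add: power2_eq_square)
  have ix2: "integrable N (\<lambda>\<omega>. (x n j \<omega>)\<^sup>2)" for n j
    using x by (intro integrable_const_bound[of _ 1]) (auto simp: power_le_one)
  have err: "risk_error y n s = (\<Sum>j<n. expectation (\<lambda>\<omega>. \<bar>x n j \<omega> - 1 / (n * p)\<bar> + 2 * (x n j \<omega>)\<^sup>2))" for n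
    unfolding risk_error_def x_def p_def by (simp add: power_divide)
  have ia: "integrable N (\<lambda>\<omega>. \<bar>x n j \<omega> - 1 / (n * p)\<bar>)" for n j using ix by auto
  have sx: "(\<Sum>j<n. expectation (x n j)) \<le> 1 / p" for n
    unfolding x_def using sum_expectation_leave_one_out[OF y p[unfolded p_def]] by (simp add: p_def)
  show "risk_error y n s \<le> 4 / p"
  proof -
    have "risk_error y n s \<le> (\<Sum>j<n. expectation (\<lambda>\<omega>. 3 * x n j \<omega> + 1 / (n * p)))"
      unfolding err
    proof (intro sum_mono integral_mono)
      fix j \<omega>
      have "\<bar>x n j \<omega> - 1 / (n * p)\<bar> \<le> x n j \<omega> + 1 / (n * p)"
        using x(1)[of n j \<omega>] p by (simp add: abs_le_iff)
      hence "\<bar>x n j \<omega> - 1 / (n * p)\<bar> + 2 * (x n j \<omega>)\<^sup>2 \<le> (x n j \<omega> + 1 / (n * p)) + 2 * x n j \<omega>"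
        using x2[of n j \<omega>] by (intro add_mono mult_left_mono) auto
      thus "\<bar>x n j \<omega> - 1 / (n * p)\<bar> + 2 * (x n j \<omega>)\<^sup>2 \<le> 3 * x n j \<omega> + 1 / (n * p)"
        by simp
    qed (use ix ix2 ia in auto)
    also have "\<dots> = 3 * (\<Sum>j<n. expectation (x n j)) + n * (1 / (n * p))"
      using ix by (simp add: sum.distrib sum_distrib_left prob_space)
    also have "n * (1 / (n * p)) \<le> 1 / p" using p by simp
    finally show ?thesis using sx[of n] by simp
  qed
  define r where "r n = expectation (\<lambda>\<omega>. \<bar>(\<Sum>i<n. if s \<le> y (V i \<omega>) then 1 else 0) / n - p\<bar>)" for n
  have r: "r \<longlonglongrightarrow> 0"
  proof -
    interpret \<mu>: prob_space \<mu> by (rule prob_space_law)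
    have "(\<integral>v. (if s \<le> y v then 1 else 0) \<partial>\<mu>) = (\<integral>v. indicator {v. s \<le> y v} v \<partial>\<mu>)"
      by (intro Bochner_Integration.integral_cong) (auto simp: indicator_def)
    also have "\<dots> = p" using sets_eq_imp_space_eq[OF sets_law] by (simp add: p_def)
    finally have eq: "(\<integral>v. (if s \<le> y v then 1 else 0) \<partial>\<mu>) = p" .
    have "integrable \<mu> (\<lambda>v. if s \<le> y v then 1 else 0 :: real)"
      by (intro \<mu>.integrable_const_bound[of _ 1]) auto
    from wlln_L1[OF _ this] show ?thesis unfolding eq r_def by simp
  qed
  have bound: "risk_error y n s \<le> 6 * ((r n + 1 / n) / p\<^sup>2) + 2 / (n * p\<^sup>2)" if n: "n > 0" for n
  proof -
    define a where "a = 1 / (n * p)"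
    have a: "a > 0" using n p by (simp add: a_def)
    let ?R = "\<lambda>\<omega>. \<Sum>i<n. if s \<le> y (V i \<omega>) then 1 else 0 :: real"
    have iR: "integrable N (\<lambda>\<omega>. \<bar>?R \<omega> / n - p\<bar>)"
      by (intro integrable_abs Bochner_Integration.integrable_diff integrable_divide Bochner_Integration.integrable_sum)
         (auto intro!: integrable_const_bound[of _ 1])
    have pt: "\<bar>x n j \<omega> - a\<bar> \<le> (x n j \<omega> - a) + 2 * ((n * \<bar>?R \<omega> / n - p\<bar> + 1) * a\<^sup>2)" if j: "j < n" for j \<omega>
    proof (cases "x n j \<omega> \<ge> a")
      case True
      thus ?thesis by simp
    next
      case False
      define b where "b = 1 + others y n j s \<omega>"
      have b: "b > 0" using others_nonneg[of y n j s \<omega>] by (simp add: b_def)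
      have xb: "x n j \<omega> = 1 / b" by (simp add: x_def b_def)
      have lt: "1 / b < 1 / (n * p)" using False by (simp add: xb a_def)
      hence bnp: "n * p < b" using b n p by (simp add: field_simps)
      have "?R \<omega> = (if s \<le> y (V j \<omega>) then 1 else 0) + others y n j s \<omega>"
        unfolding others_def by (subst sum.remove[of _ j]) (use j in \<open>auto simp: of_bool_def\<close>)
      hence "b \<le> ?R \<omega> + 1" by (auto simp: b_def)
      moreover have "?R \<omega> - n * p \<le> n * \<bar>?R \<omega> / n - p\<bar>"
      proof -
        have "?R \<omega> - n * p = n * (?R \<omega> / n - p)" using n by (simp add: right_diff_distrib)
        also have "\<dots> \<le> n * \<bar>?R \<omega> / n - p\<bar>" by (intro mult_left_mono) auto
        finally show ?thesis .
      qed
      ultimately have bd: "b - n * p \<le> n * \<bar>?R \<omega> / n - p\<bar> + 1" by linarith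
      have "a - 1 / b = (b - n * p) * (a * (1 / b))"
        using b n p by (simp add: a_def field_simps)
      also have "\<dots> \<le> (b - n * p) * (a * a)"
        using lt bnp a by (intro mult_left_mono) (auto simp: a_def)
      also have "\<dots> \<le> (n * \<bar>?R \<omega> / n - p\<bar> + 1) * (a * a)"
        using bd by (intro mult_right_mono) auto
      finally show ?thesis using False by (simp add: xb power2_eq_square)
    qed
    have A: "(\<Sum>j<n. expectation (\<lambda>\<omega>. \<bar>x n j \<omega> - a\<bar>)) \<le> 2 * ((r n + 1 / n) / p\<^sup>2)"
    proof -
      have "(\<Sum>j<n. expectation (\<lambda>\<omega>. \<bar>x n j \<omega> - a\<bar>)) \<le>
          (\<Sum>j<n. expectation (\<lambda>\<omega>. (x n j \<omega> - a) + 2 * ((n * \<bar>?R \<omega> / n - p\<bar> + 1) * a\<^sup>2)))"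
        by (intro sum_mono integral_mono pt) (use ix iR in auto)
      also have "\<dots> = (\<Sum>j<n. expectation (x n j)) - n * a + n * (2 * ((n * r n + 1) * a\<^sup>2))"
        unfolding r_def using ix iR by (simp add: sum.distrib sum_subtractf prob_space)
      also have "\<dots> \<le> 1 / p - n * a + n * (2 * ((n * r n + 1) * a\<^sup>2))"
        using sx[of n] by simp
      also have "\<dots> = 2 * ((r n + 1 / n) / p\<^sup>2)"
        using n p by (simp add: a_def field_simps power2_eq_square)
      finally show ?thesis .
    qed
    have pt2: "\<bar>x n j \<omega> - a\<bar> + 2 * (x n j \<omega>)\<^sup>2 \<le> 3 * \<bar>x n j \<omega> - a\<bar> + 2 * (a * x n j \<omega>)" for j \<omega>
    proof -
      have "(x n j \<omega> - a) * x n j \<omega> \<le> \<bar>x n j \<omega> - a\<bar> * 1"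
        using x[of n j \<omega>] by (intro mult_mono) auto
      hence "(x n j \<omega>)\<^sup>2 \<le> \<bar>x n j \<omega> - a\<bar> + a * x n j \<omega>"
        by (simp add: power2_eq_square algebra_simps)
      hence "\<bar>x n j \<omega> - a\<bar> + 2 * (x n j \<omega>)\<^sup>2 \<le> \<bar>x n j \<omega> - a\<bar> + 2 * (\<bar>x n j \<omega> - a\<bar> + a * x n j \<omega>)"
        by (intro add_left_mono mult_left_mono) auto
      thus ?thesis by simp
    qed
    have "risk_error y n s \<le> (\<Sum>j<n. expectation (\<lambda>\<omega>. 3 * \<bar>x n j \<omega> - a\<bar> + 2 * (a * x n j \<omega>)))"
      unfolding err a_def[symmetric] by (intro sum_mono integral_mono pt2) (use ix ix2 in auto)
    also have "\<dots> = 3 * (\<Sum>j<n. expectation (\<lambda>\<omega>. \<bar>x n j \<omega> - a\<bar>)) + 2 * (a * (\<Sum>j<n. expectation (x n j)))"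
      using ix by (simp add: sum.distrib sum_distrib_left)
    also have "\<dots> \<le> 3 * (2 * ((r n + 1 / n) / p\<^sup>2)) + 2 * (a * (1 / p))"
      using A sx[of n] a by (intro add_mono mult_left_mono) auto
    also have "\<dots> = 6 * ((r n + 1 / n) / p\<^sup>2) + 2 / (n * p\<^sup>2)"
      by (simp add: a_def power2_eq_square)
    finally show ?thesis .
  qed
  have "(\<lambda>n. 6 * ((r n + 1 / n) / p\<^sup>2) + 2 / p\<^sup>2 / n) \<longlonglongrightarrow> 6 * ((0 + 0) / p\<^sup>2) + 0"
    using p by (intro tendsto_intros r lim_const_over_n) auto
  hence lim: "(\<lambda>n. 6 * ((r n + 1 / n) / p\<^sup>2) + 2 / (n * p\<^sup>2)) \<longlonglongrightarrow> 0"
    by (simp add: mult.commute)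
  have nn: "0 \<le> risk_error y n s" for n
    unfolding risk_error_def by (intro sum_nonneg integral_nonneg_AE) auto
  show "(\<lambda>n. risk_error y n s) \<longlonglongrightarrow> 0"
  proof (rule tendsto_sandwich[OF _ _ tendsto_const lim])
    show "eventually (\<lambda>n. 0 \<le> risk_error y n s) sequentially" using nn by simp
    show "eventually (\<lambda>n. risk_error y n s \<le> 6 * ((r n + 1 / n) / p\<^sup>2) + 2 / (n * p\<^sup>2)) sequentially"
      using eventually_gt_at_top[of 0] by eventually_elim (rule bound)
  qed
qed

end

section \<open>Survival functions and integrated hazards\<close>

lemma (in real_distribution) survival_eq_cdf:
  "measure M {s..} = 1 - measure M {..<s}"
proof -
  have "measure M (UNIV - {..<s}) = 1 - measure M {..<s}"
    using prob_compl[of "{..<s}"] by simp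
  moreover have "UNIV - {..<s} = {s..}" by auto
  ultimately show ?thesis by simp
qed

lemma (in real_distribution) survival_diff:
  assumes "a \<le> b"
  shows "measure M {a..<b} = measure M {a..} - measure M {b..}"
proof -
  have "measure M ({a..} - {b..}) = measure M {a..} - measure M {b..}"
    using assms by (intro finite_measure_Diff) auto
  moreover have "{a..} - {b..} = {a..<b}" by auto
  ultimately show ?thesis by simp
qed

text \<open>
  Without atoms below \<open>\<tau>\<close> the survival function is continuous on the closed half-line up to \<open>\<tau>\<close>: at \<open>\<tau>\<close>
  only left continuity is needed, which holds because the interval \<open>{s..}\<close> contains its end point.
\<close>

lemma (in real_distribution) survival_attains:
  assumes noatom: "\<And>s. s < \<tau> \<Longrightarrow> measure M {s} = 0" and u: "measure M {\<tau>..} \<le> u" "u < 1"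
  shows "\<exists>x\<le>\<tau>. measure M {x..} = u"
proof -
  have eq: "measure M {s..} = 1 - cdf M s" if "s < \<tau>" for s
  proof -
    have "measure M {..s} = measure M {..<s} + measure M {s}"
      by (subst finite_measure_Union[symmetric]) (auto intro!: arg_cong[where f="measure M"])
    thus ?thesis using noatom[OF that] by (simp add: survival_eq_cdf cdf_def)
  qed
  have "eventually (\<lambda>a. cdf M a < 1 - u) at_bot"
    using order_tendstoD(2)[OF cdf_lim_at_bot, of "1 - u"] u by simp
  hence "eventually (\<lambda>a. cdf M a < 1 - u \<and> a < \<tau>) at_bot"
    using eventually_gt_at_bot by (intro eventually_conj) (auto simp: eventually_at_bot_dense)
  then obtain a where a: "cdf M a < 1 - u" "a < \<tau>"
    by (metis (mono_tags, lifting) eventually_at_bot_linorder order_refl)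
  have "continuous_on {a..\<tau>} (\<lambda>s. measure M {s..})"
    unfolding continuous_on_eq_continuous_within
  proof
    fix s assume s: "s \<in> {a..\<tau>}"
    show "continuous (at s within {a..\<tau>}) (\<lambda>s. measure M {s..})"
    proof (cases "s = \<tau>")
      case True
      have "((\<lambda>s. 1 - cdf M s) \<longlongrightarrow> 1 - measure M {..<\<tau>}) (at_left \<tau>)"
        by (intro tendsto_intros cdf_at_left)
      moreover have "eventually (\<lambda>s. measure M {s..} = 1 - cdf M s) (at_left \<tau>)"
        using eventually_at_left_real[OF a(2)] by eventually_elim (auto simp: eq)
      ultimately have "((\<lambda>s. measure M {s..}) \<longlongrightarrow> measure M {\<tau>..}) (at_left \<tau>)"
        by (simp add: survival_eq_cdf[of \<tau>] tendsto_cong)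
      thus ?thesis using True a by (simp add: continuous_within at_within_Icc_at_left)
    next
      case False
      hence s': "s < \<tau>" using s by auto
      have "isCont (cdf M) s" using noatom[OF s'] by (simp add: isCont_cdf)
      hence "((\<lambda>s. 1 - cdf M s) \<longlongrightarrow> 1 - cdf M s) (at s)"
        unfolding isCont_def by (intro tendsto_intros)
      moreover have "eventually (\<lambda>r. r < \<tau>) (nhds s)"
        using s' by (intro eventually_nhds_in_open[of "{..<\<tau>}", simplified]) auto
      hence "eventually (\<lambda>r. measure M {r..} = 1 - cdf M r) (at s)"
        unfolding eventually_at_filter by eventually_elim (simp add: eq)
      ultimately have "((\<lambda>s. measure M {s..}) \<longlongrightarrow> measure M {s..}) (at s)"
        by (simp add: eq[OF s'] tendsto_cong)
      hence "isCont (\<lambda>s. measure M {s..}) s" by (simp add: isCont_def)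
      thus ?thesis by (rule continuous_at_imp_continuous_at_within)
    qed
  qed
  from IVT2'[OF u(1) _ _ this] a eq[OF a(2)] show ?thesis by force
qed

lemma (in real_distribution) survival_antimono: "s \<le> t \<Longrightarrow> measure M {t..} \<le> measure M {s..}"
  by (intro finite_measure_mono) auto

lemma (in real_distribution) measurable_survival [measurable]:
  "(\<lambda>s. measure M {s..}) \<in> borel_measurable borel"
proof -
  have "(\<lambda>s. - measure M {s..}) \<in> borel_measurable borel"
    by (rule borel_measurable_mono) (auto simp: mono_def survival_antimono)
  thus ?thesis using borel_measurable_uminus_eq by simp
qed

text \<open>
  On an interval the integral of the hazard and the increment of \<open>- ln G\<close> obey the same two bounds,
  the mass of the interval divided by \<open>G\<close> at one or at the other end.  They therefore differ by at most
  a multiple of the squared mass.  Cutting the half-line below \<open>t\<close> into \<open>n\<close> pieces of equal mass leaves a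
  total discrepancy of order \<open>1 / n\<close>.
\<close>

lemma (in real_distribution) integral_hazard:
  assumes noatom: "\<And>s. s < \<tau> \<Longrightarrow> measure M {s} = 0"
    and pos: "measure M {\<tau>..} > 0" and t: "t \<le> \<tau>"
  shows "integrable M (\<lambda>s. indicator {..<t} s / measure M {s..})"
    and "(\<integral>s. indicator {..<t} s / measure M {s..} \<partial>M) = - ln (measure M {t..})"
proof -
  let ?G = "\<lambda>s. measure M {s..}"
  define \<gamma> where "\<gamma> = ?G \<tau>"
  have Gge: "\<gamma> \<le> ?G s" if "s \<le> \<tau>" for s unfolding \<gamma>_def by (rule survival_antimono[OF that])
  have Gpos: "0 < ?G s" if "s \<le> \<tau>" for s using Gge[OF that] pos unfolding \<gamma>_def by linarith
  have \<gamma>: "\<gamma> > 0" using pos by (simp add: \<gamma>_def)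
  have int: "integrable M (\<lambda>s. indicator A s / ?G s)" if "A \<subseteq> {..<\<tau>}" "A \<in> sets borel" for A
  proof (rule integrable_const_bound[of _ "1 / \<gamma>"])
    show "AE s in M. norm (indicator A s / ?G s) \<le> 1 / \<gamma>"
      using that(1) Gge Gpos \<gamma> by (auto simp: indicator_def frac_le intro!: AE_I2)
  qed (use that in auto)
  show "integrable M (\<lambda>s. indicator {..<t} s / ?G s)" using t by (intro int) auto
  define L where "L t = (\<integral>s. indicator {..<t} s / ?G s \<partial>M)" for t
  define \<psi> where "\<psi> s = L s + ln (?G s)" for s
  \<comment> \<open>Both increments lie between the mass over \<open>G a\<close> and the mass over \<open>G b\<close>.\<close>
  have step: "\<bar>\<psi> b - \<psi> a\<bar> \<le> (?G a - ?G b)\<^sup>2 / \<gamma>\<^sup>2" if "a \<le> b" "b \<le> \<tau>" for a b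
  proof -
    have "L b - L a = (\<integral>s. indicator {..<b} s / ?G s - indicator {..<a} s / ?G s \<partial>M)"
      unfolding L_def using that by (intro Bochner_Integration.integral_diff[symmetric] int) auto
    also have "\<dots> = (\<integral>s. indicator {a..<b} s / ?G s \<partial>M)"
      using that by (intro Bochner_Integration.integral_cong) (auto simp: indicator_def)
    finally have eq: "L b - L a = (\<integral>s. indicator {a..<b} s / ?G s \<partial>M)" .
    have i0: "integrable M (\<lambda>s. indicator {a..<b} s / ?G x)" for x
      by (intro integrable_divide) (simp add: integrable_indicator_iff less_top[symmetric])
    have I0: "(\<integral>s. indicator {a..<b} s / ?G x \<partial>M) = (?G a - ?G b) / ?G x" for x
      using survival_diff[OF that(1)] by simp
    have up: "L b - L a \<le> (?G a - ?G b) / ?G b"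
      unfolding eq I0[symmetric] using that Gpos survival_antimono
      by (intro integral_mono i0 int) (auto simp: indicator_def intro!: divide_left_mono mult_pos_pos)
    have lo: "(?G a - ?G b) / ?G a \<le> L b - L a"
      unfolding eq I0[symmetric] using that Gpos survival_antimono
      by (intro integral_mono i0 int) (auto simp: indicator_def intro!: divide_left_mono mult_pos_pos)
    have Ga: "?G a > 0" and Gb: "?G b > 0" using Gpos that by auto
    have "ln (?G a / ?G b) \<le> ?G a / ?G b - 1" using Ga Gb by (intro ln_le_minus_one) simp
    also have "\<dots> = (?G a - ?G b) / ?G b" using Gb by (simp add: diff_divide_distrib)
    finally have up': "ln (?G a) - ln (?G b) \<le> (?G a - ?G b) / ?G b" using Ga Gb by (simp add: ln_div)
    have "ln (?G b / ?G a) \<le> ?G b / ?G a - 1" using Ga Gb by (intro ln_le_minus_one) simp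
    also have "\<dots> = - ((?G a - ?G b) / ?G a)" using Ga by (simp add: diff_divide_distrib)
    finally have lo': "(?G a - ?G b) / ?G a \<le> ln (?G a) - ln (?G b)" using Ga Gb by (simp add: ln_div)
    have "\<bar>\<psi> b - \<psi> a\<bar> \<le> (?G a - ?G b) / ?G b - (?G a - ?G b) / ?G a"
      using up lo up' lo' unfolding \<psi>_def by linarith
    also have "\<dots> = (?G a - ?G b)\<^sup>2 / (?G a * ?G b)"
      using Ga Gb by (simp add: field_simps power2_eq_square)
    also have "\<dots> \<le> (?G a - ?G b)\<^sup>2 / (\<gamma> * \<gamma>)"
      using Gge[of a] Gge[of b] that \<gamma> Ga Gb
      by (intro divide_left_mono mult_mono mult_pos_pos) auto
    finally show ?thesis by (simp add: power2_eq_square)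
  qed
  have step': "\<bar>\<psi> b - \<psi> a\<bar> \<le> (?G a - ?G b)\<^sup>2 / \<gamma>\<^sup>2" if "a \<le> \<tau>" "b \<le> \<tau>" for a b
    using step[of a b] step[of b a] that by (cases "a \<le> b") (auto simp: abs_minus_commute power2_commute)
  \<comment> \<open>The piece below the first cut point is unbounded; its mass is small.\<close>
  have start: "\<bar>\<psi> a\<bar> \<le> (1 - ?G a) / \<gamma>" if "a \<le> \<tau>" for a
  proof -
    have L0: "0 \<le> L a" unfolding L_def by (intro integral_nonneg_AE AE_I2) simp
    have "integrable M (\<lambda>s. indicator {..<a} s / \<gamma>)"
      by (intro integrable_divide) (simp add: integrable_indicator_iff less_top[symmetric])
    hence "L a \<le> (\<integral>s. indicator {..<a} s / \<gamma> \<partial>M)"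
      unfolding L_def using that Gge \<gamma>
      by (intro integral_mono int) (auto simp: indicator_def frac_le)
    also have "\<dots> = (1 - ?G a) / \<gamma>" by (simp add: survival_eq_cdf)
    finally have L1: "L a \<le> (1 - ?G a) / \<gamma>" .
    have G: "?G a > 0" using Gpos that by auto
    have "- ln (?G a) = ln (1 / ?G a)" using G by (simp add: ln_div)
    also have "\<dots> \<le> 1 / ?G a - 1" using G by (intro ln_le_minus_one) simp
    also have "\<dots> = (1 - ?G a) / ?G a" using G by (simp add: diff_divide_distrib)
    also have "\<dots> \<le> (1 - ?G a) / \<gamma>" using Gge[OF that] \<gamma> G by (intro divide_left_mono) auto
    finally have l1: "- ln (?G a) \<le> (1 - ?G a) / \<gamma>" .
    have "ln (?G a) \<le> 0" using G by (simp add: ln_le_zero_iff)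
    thus ?thesis using L0 L1 l1 unfolding \<psi>_def by linarith
  qed
  have "\<psi> t = 0"
  proof (cases "?G t = 1")
    case True
    thus ?thesis using start[OF t] by simp
  next
    case False
    hence G1: "?G t < 1" using prob_le_1[of "{t..}"] by linarith
    define c where "c = 1 / \<gamma> + 1 / \<gamma>\<^sup>2"
    have bound: "\<bar>\<psi> t\<bar> \<le> c / real n" if n: "n > 0" for n :: nat
    proof -
      define h where "h = (1 - ?G t) / n"
      have h: "0 < h" "h \<le> 1 / n" using G1 n by (auto simp: h_def field_simps)
      have "\<exists>x\<le>\<tau>. ?G x = 1 - Suc k * h" if "k < n" for k
      proof (rule survival_attains[OF noatom])
        have "Suc k * h \<le> n * h" using that h by (intro mult_right_mono) auto
        also have "n * h = 1 - ?G t" using n by (simp add: h_def)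
        finally show "?G \<tau> \<le> 1 - Suc k * h" using survival_antimono[OF t] by simp
      qed (use h in auto)
      then obtain x where x: "\<And>k. k < n \<Longrightarrow> x k \<le> \<tau>" "\<And>k. k < n \<Longrightarrow> ?G (x k) = 1 - Suc k * h"
        by metis
      have ind: "\<bar>\<psi> (x k)\<bar> \<le> h / \<gamma> + k * (h\<^sup>2 / \<gamma>\<^sup>2)" if "k < n" for k
        using that
      proof (induction k)
        case 0
        thus ?case using start[OF x(1)[of 0]] x(2)[of 0] by simp
      next
        case (Suc k)
        have "?G (x k) - ?G (x (Suc k)) = h" using x(2)[of k] x(2)[of "Suc k"] Suc.prems
          by (simp add: algebra_simps)
        hence "\<bar>\<psi> (x (Suc k)) - \<psi> (x k)\<bar> \<le> h\<^sup>2 / \<gamma>\<^sup>2"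
          using step'[of "x k" "x (Suc k)"] x(1)[of k] x(1)[of "Suc k"] Suc.prems by simp
        moreover have "\<bar>\<psi> (x k)\<bar> \<le> h / \<gamma> + k * (h\<^sup>2 / \<gamma>\<^sup>2)" using Suc by simp
        moreover have "real (Suc k) * (h\<^sup>2 / \<gamma>\<^sup>2) = k * (h\<^sup>2 / \<gamma>\<^sup>2) + h\<^sup>2 / \<gamma>\<^sup>2"
          by (simp add: algebra_simps add_divide_distrib)
        ultimately show ?case by linarith
      qed
      have xn: "?G (x (n - 1)) = ?G t" "x (n - 1) \<le> \<tau>"
        using x[of "n - 1"] n by (auto simp: h_def)
      hence "\<psi> t = \<psi> (x (n - 1))" using step'[of "x (n - 1)" t] t by simp
      hence "\<bar>\<psi> t\<bar> \<le> h / \<gamma> + (n - 1) * (h\<^sup>2 / \<gamma>\<^sup>2)" using ind[of "n - 1"] n by simp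
      also have "\<dots> \<le> (1 / n) / \<gamma> + n * ((1 / n)\<^sup>2 / \<gamma>\<^sup>2)"
        using h \<gamma> by (intro add_mono divide_right_mono mult_mono power_mono) auto
      also have "\<dots> = c / n" using n \<gamma> by (simp add: c_def field_simps power2_eq_square)
      finally show ?thesis .
    qed
    have "eventually (\<lambda>n. \<bar>\<psi> t\<bar> \<le> c / real n) sequentially"
      using eventually_gt_at_top[of 0] by eventually_elim (rule bound)
    hence "\<bar>\<psi> t\<bar> \<le> 0"
      by (rule tendsto_lowerbound[OF lim_const_over_n]) simp
    thus ?thesis by simp
  qed
  thus "(\<integral>s. indicator {..<t} s / ?G s \<partial>M) = - ln (?G t)" by (simp add: \<psi>_def L_def)
qed

text \<open>
  \<open>W\<close> stands for the covariates.  The number \<open>\<tau>\<close> is the upper end point of the support of \<open>T\<close>, and the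
  last assumption says that censoring leaves positive mass at or beyond it.
\<close>

locale random_censoring = prob_space M for M :: "'a measure" +
  fixes T C :: "'a \<Rightarrow> real" and W :: "'a \<Rightarrow> 'w :: second_countable_topology" and \<tau> :: real
  assumes T [measurable]: "T \<in> borel_measurable M"
    and C [measurable]: "C \<in> borel_measurable M"
    and W [measurable]: "W \<in> borel_measurable M"
    and indep: "indep_rv M C (\<lambda>\<omega>. (T \<omega>, W \<omega>))"
    and no_atom: "\<And>s. prob {\<omega> \<in> space M. min (T \<omega>) (C \<omega>) = s} = 0"
    and T_le: "AE \<omega> in M. T \<omega> \<le> \<tau>"
    and T_reaches: "\<And>s. s < \<tau> \<Longrightarrow> prob {\<omega> \<in> space M. s \<le> T \<omega>} > 0"
    and C_exceeds: "prob {\<omega> \<in> space M. \<tau> \<le> C \<omega>} > 0"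
begin

definition cens_surv :: "real \<Rightarrow> real" where
  "cens_surv s = prob {\<omega> \<in> space M. s \<le> C \<omega>}"

definition obs_surv :: "real \<Rightarrow> real" where
  "obs_surv s = prob {\<omega> \<in> space M. s \<le> min (T \<omega>) (C \<omega>)}"

sublocale cens: real_distribution "distr M borel C"
  by simp

lemma cens_surv_eq: "cens_surv s = measure (distr M borel C) {s..}"
  unfolding cens_surv_def by (subst measure_distr) (auto intro!: arg_cong[where f=prob])

lemma joint_law:
  "distr M (borel \<Otimes>\<^sub>M borel) (\<lambda>\<omega>. (C \<omega>, (T \<omega>, W \<omega>))) = distr M borel C \<Otimes>\<^sub>M distr M borel (\<lambda>\<omega>. (T \<omega>, W \<omega>))"
proof (rule pair_measure_eqI[symmetric])
  have TW [measurable]: "(\<lambda>\<omega>. (T \<omega>, W \<omega>)) \<in> borel_measurable M" by measurable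
  show "sigma_finite_measure (distr M borel C)" "sigma_finite_measure (distr M borel (\<lambda>\<omega>. (T \<omega>, W \<omega>)))"
    by (auto intro!: prob_space_imp_sigma_finite prob_space_distr TW)
  fix A :: "real set" and B :: "(real \<times> 'w) set" assume "A \<in> sets (distr M borel C)" "B \<in> sets (distr M borel (\<lambda>\<omega>. (T \<omega>, W \<omega>)))"
  hence [measurable]: "A \<in> sets borel" "B \<in> sets borel" by auto
  have "prob ((C -` A \<inter> space M) \<inter> ((\<lambda>\<omega>. (T \<omega>, W \<omega>)) -` B \<inter> space M)) =
     prob (C -` A \<inter> space M) * prob ((\<lambda>\<omega>. (T \<omega>, W \<omega>)) -` B \<inter> space M)"
    using indep unfolding indep_rv_def by (intro indep_setD) auto
  moreover have "(C -` A \<inter> space M) \<inter> ((\<lambda>\<omega>. (T \<omega>, W \<omega>)) -` B \<inter> space M) = (\<lambda>\<omega>. (C \<omega>, (T \<omega>, W \<omega>))) -` (A \<times> B) \<inter> space M"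
    by auto
  ultimately show "emeasure (distr M borel C) A * emeasure (distr M borel (\<lambda>\<omega>. (T \<omega>, W \<omega>))) B =
      emeasure (distr M (borel \<Otimes>\<^sub>M borel) (\<lambda>\<omega>. (C \<omega>, (T \<omega>, W \<omega>)))) (A \<times> B)"
    by (simp add: emeasure_distr emeasure_eq_measure ennreal_mult[symmetric])
qed simp

lemma prob_indep:
  assumes [measurable]: "Measurable.pred borel P" "Measurable.pred borel Q"
  shows "prob {\<omega> \<in> space M. P (C \<omega>) \<and> Q (T \<omega>)} = prob {\<omega> \<in> space M. P (C \<omega>)} * prob {\<omega> \<in> space M. Q (T \<omega>)}"
proof -
  have [measurable]: "Measurable.pred (borel :: (real \<times> 'w) measure) (\<lambda>z. Q (fst z))"
    unfolding borel_prod[symmetric] by measurable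
  have "{c. P c} \<in> sets borel" "{z :: real \<times> 'w. Q (fst z)} \<in> sets borel"
    using assms by (simp_all add: pred_def)
  note sets = this
  have ind: "indep_set {C -` A \<inter> space M |A. A \<in> sets borel} {(\<lambda>\<omega>. (T \<omega>, W \<omega>)) -` B \<inter> space M |B. B \<in> sets borel}"
    using indep unfolding indep_rv_def by blast
  have "prob ((C -` {c. P c} \<inter> space M) \<inter> ((\<lambda>\<omega>. (T \<omega>, W \<omega>)) -` {z. Q (fst z)} \<inter> space M)) =
     prob (C -` {c. P c} \<inter> space M) * prob ((\<lambda>\<omega>. (T \<omega>, W \<omega>)) -` {z. Q (fst z)} \<inter> space M)"
    by (rule indep_setD[OF ind]) (rule CollectI, rule exI, rule conjI[OF refl], rule sets)+
  moreover have "C -` {c. P c} \<inter> space M = {\<omega> \<in> space M. P (C \<omega>)}"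
     "(\<lambda>\<omega>. (T \<omega>, W \<omega>)) -` {z. Q (fst z)} \<inter> space M = {\<omega> \<in> space M. Q (T \<omega>)}" by auto
  moreover have "{\<omega> \<in> space M. P (C \<omega>)} \<inter> {\<omega> \<in> space M. Q (T \<omega>)} = {\<omega> \<in> space M. P (C \<omega>) \<and> Q (T \<omega>)}" by auto
  ultimately show ?thesis by simp
qed

lemma cens_surv_ge: "s \<le> \<tau> \<Longrightarrow> cens_surv \<tau> \<le> cens_surv s"
  unfolding cens_surv_eq by (rule cens.survival_antimono)

lemma cens_surv_pos: "s \<le> \<tau> \<Longrightarrow> cens_surv s > 0"
  using cens_surv_ge[of s] C_exceeds unfolding cens_surv_def by linarith

lemma measurable_cens_surv [measurable]: "cens_surv \<in> borel_measurable borel"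
  unfolding cens_surv_eq[abs_def] by (rule cens.measurable_survival)

lemma obs_surv_eq: "obs_surv s = cens_surv s * prob {\<omega> \<in> space M. s \<le> T \<omega>}"
  unfolding obs_surv_def cens_surv_def using prob_indep[of "\<lambda>c. s \<le> c" "\<lambda>t. s \<le> t"]
  by (simp add: conj_commute)

lemma obs_surv_pos: "s < \<tau> \<Longrightarrow> obs_surv s > 0"
  using T_reaches[of s] cens_surv_pos[of s] by (simp add: obs_surv_eq)

lemma measurable_obs_surv [measurable]: "obs_surv \<in> borel_measurable borel"
proof -
  have "(\<lambda>s. - obs_surv s) \<in> borel_measurable borel"
    unfolding obs_surv_def by (rule borel_measurable_mono) (auto simp: mono_def intro!: finite_measure_mono)
  thus ?thesis using borel_measurable_uminus_eq by simp
qed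

lemma T_no_atom:
  assumes "s \<le> \<tau>"
  shows "prob {\<omega> \<in> space M. T \<omega> = s} = 0"
proof -
  have "cens_surv s * prob {\<omega> \<in> space M. T \<omega> = s} = prob {\<omega> \<in> space M. s \<le> C \<omega> \<and> T \<omega> = s}"
    unfolding cens_surv_def by (rule prob_indep[symmetric]) measurable
  also have "\<dots> \<le> prob {\<omega> \<in> space M. min (T \<omega>) (C \<omega>) = s}" by (intro finite_measure_mono) auto
  finally show ?thesis using no_atom[of s] cens_surv_pos[OF assms] measure_nonneg[of M]
    by (smt (verit) mult_pos_pos)
qed

lemma C_no_atom:
  assumes "s < \<tau>"
  shows "prob {\<omega> \<in> space M. C \<omega> = s} = 0"
proof -
  have "prob {\<omega> \<in> space M. C \<omega> = s} * prob {\<omega> \<in> space M. s \<le> T \<omega>} = prob {\<omega> \<in> space M. C \<omega> = s \<and> s \<le> T \<omega>}"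
    by (rule prob_indep[symmetric]) measurable
  also have "\<dots> \<le> prob {\<omega> \<in> space M. min (T \<omega>) (C \<omega>) = s}" by (intro finite_measure_mono) auto
  finally show ?thesis using no_atom[of s] T_reaches[OF assms] measure_nonneg[of M]
    by (smt (verit) mult_pos_pos)
qed

lemma T_less: "AE \<omega> in M. T \<omega> < \<tau>"
proof -
  have "AE \<omega> in M. T \<omega> \<noteq> \<tau>"
    using T_no_atom[of \<tau>] by (subst AE_iff_measurable[OF _ refl]) (auto simp: emeasure_eq_measure)
  with T_le show ?thesis by eventually_elim auto
qed

lemma cens_surv_attains:
  assumes "cens_surv \<tau> \<le> u" "u < 1"
  shows "\<exists>x\<le>\<tau>. cens_surv x = u"
  unfolding cens_surv_eq
  by (rule cens.survival_attains)
     (use assms C_no_atom in \<open>auto simp: cens_surv_eq measure_distr vimage_def Int_def conj_commute\<close>)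

lemma prob_T_greater:
  assumes "s \<le> \<tau>"
  shows "prob {\<omega> \<in> space M. s < T \<omega>} = prob {\<omega> \<in> space M. s \<le> T \<omega>}"
proof -
  have "prob {\<omega> \<in> space M. s \<le> T \<omega>} = prob ({\<omega> \<in> space M. s < T \<omega>} \<union> {\<omega> \<in> space M. T \<omega> = s})"
    by (intro arg_cong[where f=prob]) auto
  also have "\<dots> = prob {\<omega> \<in> space M. s < T \<omega>} + prob {\<omega> \<in> space M. T \<omega> = s}"
    by (rule finite_measure_Union) auto
  finally show ?thesis using T_no_atom[OF assms] by simp
qed

text \<open>
  By independence the probability \<open>P (T > s)\<close> of being censored at \<open>s\<close>, given \<open>C = s\<close>, cancels against the
  factor \<open>P (T \<ge> s)\<close> of the probability of being at risk, since \<open>T\<close> has no atoms.  Only the censoring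
  hazard is left.
\<close>

lemma nn_integral_censored_hazard:
  assumes t: "t \<le> \<tau>"
  shows "(\<integral>\<^sup>+\<omega>. ennreal (if C \<omega> < T \<omega> \<and> C \<omega> < t then 1 / obs_surv (C \<omega>) else 0) \<partial>M) = ennreal (- ln (cens_surv t))"
proof -
  define h where "h z = ennreal (if fst z < fst (snd z) \<and> fst z < t then 1 / obs_surv (fst z) else 0)" for z :: "real \<times> real \<times> 'w"
  have [measurable]: "h \<in> borel_measurable (borel \<Otimes>\<^sub>M borel)"
    unfolding h_def[abs_def] borel_prod[symmetric] by measurable
  have TW: "(\<lambda>\<omega>. (T \<omega>, W \<omega>)) \<in> borel_measurable M" by measurable
  have "(\<integral>\<^sup>+\<omega>. h (C \<omega>, (T \<omega>, W \<omega>)) \<partial>M) = (\<integral>\<^sup>+\<omega>. \<integral>\<^sup>+\<omega>'. h (C \<omega>, (T \<omega>', W \<omega>')) \<partial>M \<partial>M)"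
    by (rule nn_integral_independent(1)[OF C TW joint_law]) measurable
  also have "\<dots> = (\<integral>\<^sup>+\<omega>. ennreal (indicator {..<t} (C \<omega>) / cens_surv (C \<omega>)) \<partial>M)"
  proof (rule nn_integral_cong)
    fix \<omega>
    show "(\<integral>\<^sup>+\<omega>'. h (C \<omega>, (T \<omega>', W \<omega>')) \<partial>M) = ennreal (indicator {..<t} (C \<omega>) / cens_surv (C \<omega>))"
    proof (cases "C \<omega> < t")
      case True
      hence c: "C \<omega> < \<tau>" using t by simp
      have "(\<integral>\<^sup>+\<omega>'. h (C \<omega>, (T \<omega>', W \<omega>')) \<partial>M) =
         (\<integral>\<^sup>+\<omega>'. ennreal (1 / obs_surv (C \<omega>)) * indicator {\<omega>' \<in> space M. C \<omega> < T \<omega>'} \<omega>' \<partial>M)"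
        using True by (intro nn_integral_cong) (auto simp: h_def indicator_def)
      also have "\<dots> = ennreal (1 / obs_surv (C \<omega>)) * emeasure M {\<omega>' \<in> space M. C \<omega> < T \<omega>'}"
        by (rule nn_integral_cmult_indicator) measurable
      also have "\<dots> = ennreal (1 / obs_surv (C \<omega>) * prob {\<omega>' \<in> space M. C \<omega> < T \<omega>'})"
        using obs_surv_pos[OF c] by (simp add: emeasure_eq_measure ennreal_mult''[symmetric])
      also have "1 / obs_surv (C \<omega>) * prob {\<omega>' \<in> space M. C \<omega> < T \<omega>'} = indicator {..<t} (C \<omega>) / cens_surv (C \<omega>)"
        using True c T_reaches[OF c] cens_surv_pos[of "C \<omega>"] by (simp add: obs_surv_eq prob_T_greater)
      finally show ?thesis .
    qed (simp add: h_def)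
  qed
  also have "\<dots> = (\<integral>\<^sup>+s. ennreal (indicator {..<t} s / cens_surv s) \<partial>distr M borel C)"
    by (subst nn_integral_distr) auto
  also have "\<dots> = ennreal (\<integral>s. indicator {..<t} s / cens_surv s \<partial>distr M borel C)"
    unfolding cens_surv_eq using C_no_atom C_exceeds t
    by (intro nn_integral_eq_integral cens.integral_hazard(1)[of \<tau>])
       (auto simp: measure_distr vimage_def Int_def conj_commute)
  also have "(\<integral>s. indicator {..<t} s / cens_surv s \<partial>distr M borel C) = - ln (cens_surv t)"
    unfolding cens_surv_eq using C_no_atom C_exceeds t
    by (intro cens.integral_hazard(2)[of \<tau>])
       (auto simp: measure_distr vimage_def Int_def conj_commute)
  finally show ?thesis unfolding h_def fst_conv snd_conv .
qed

text \<open>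
  Given \<open>(T, W)\<close>, an observation is uncensored with probability \<open>G T\<close>, which is positive on the support of \<open>T\<close>.
\<close>

lemma nn_integral_inverse_censoring:
  assumes [measurable]: "g \<in> borel_measurable (borel \<Otimes>\<^sub>M borel)"
  shows "(\<integral>\<^sup>+\<omega>. ennreal (if T \<omega> \<le> C \<omega> then g (T \<omega>, W \<omega>) / cens_surv (T \<omega>) else 0) \<partial>M) = (\<integral>\<^sup>+\<omega>. ennreal (g (T \<omega>, W \<omega>)) \<partial>M)"
proof -
  define h where "h z = ennreal (if fst (snd z) \<le> fst z then g (snd z) / cens_surv (fst (snd z)) else 0)" for z :: "real \<times> real \<times> 'w"
  have [measurable]: "h \<in> borel_measurable (borel \<Otimes>\<^sub>M borel)"
    unfolding h_def[abs_def] borel_prod[symmetric] by measurable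
  have TW: "(\<lambda>\<omega>. (T \<omega>, W \<omega>)) \<in> borel_measurable M" by measurable
  have "(\<integral>\<^sup>+\<omega>. h (C \<omega>, (T \<omega>, W \<omega>)) \<partial>M) = (\<integral>\<^sup>+\<omega>. \<integral>\<^sup>+\<omega>'. h (C \<omega>', (T \<omega>, W \<omega>)) \<partial>M \<partial>M)"
    by (rule nn_integral_independent(2)[OF C TW joint_law]) measurable
  also have "\<dots> = (\<integral>\<^sup>+\<omega>. ennreal (g (T \<omega>, W \<omega>)) \<partial>M)"
  proof (rule nn_integral_cong_AE)
    show "AE \<omega> in M. (\<integral>\<^sup>+\<omega>'. h (C \<omega>', (T \<omega>, W \<omega>)) \<partial>M) = ennreal (g (T \<omega>, W \<omega>))"
      using T_le
    proof eventually_elim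
      case (elim \<omega>)
      have G: "cens_surv (T \<omega>) > 0" by (rule cens_surv_pos[OF elim])
      have "(\<integral>\<^sup>+\<omega>'. h (C \<omega>', (T \<omega>, W \<omega>)) \<partial>M) =
         (\<integral>\<^sup>+\<omega>'. ennreal (g (T \<omega>, W \<omega>) / cens_surv (T \<omega>)) * indicator {\<omega>' \<in> space M. T \<omega> \<le> C \<omega>'} \<omega>' \<partial>M)"
        by (intro nn_integral_cong) (auto simp: h_def indicator_def)
      also have "\<dots> = ennreal (g (T \<omega>, W \<omega>) / cens_surv (T \<omega>)) * ennreal (cens_surv (T \<omega>))"
        by (subst nn_integral_cmult_indicator) (auto simp: cens_surv_def emeasure_eq_measure)
      also have "\<dots> = ennreal (g (T \<omega>, W \<omega>))"
        using G by (simp add: ennreal_mult''[symmetric] less_imp_le)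
      finally show ?case .
    qed
  qed
  finally show ?thesis unfolding h_def fst_conv snd_conv .
qed

lemma inverse_censoring:
  assumes [measurable]: "g \<in> borel_measurable (borel \<Otimes>\<^sub>M borel)" and g: "integrable M (\<lambda>\<omega>. g (T \<omega>, W \<omega>))"
  shows "integrable M (\<lambda>\<omega>. if T \<omega> \<le> C \<omega> then g (T \<omega>, W \<omega>) / cens_surv (T \<omega>) else 0)"
    and "expectation (\<lambda>\<omega>. if T \<omega> \<le> C \<omega> then g (T \<omega>, W \<omega>) / cens_surv (T \<omega>) else 0) = expectation (\<lambda>\<omega>. g (T \<omega>, W \<omega>))"
proof -
  let ?f = "\<lambda>\<omega>. if T \<omega> \<le> C \<omega> then g (T \<omega>, W \<omega>) / cens_surv (T \<omega>) else 0"
  have pos: "cens_surv s \<ge> 0" for s by (simp add: cens_surv_def)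
  have "(\<integral>\<^sup>+\<omega>. ennreal (norm (?f \<omega>)) \<partial>M) = (\<integral>\<^sup>+\<omega>. ennreal (if T \<omega> \<le> C \<omega> then \<bar>g (T \<omega>, W \<omega>)\<bar> / cens_surv (T \<omega>) else 0) \<partial>M)"
    using pos by (intro nn_integral_cong arg_cong[where f=ennreal]) auto
  also have "\<dots> = (\<integral>\<^sup>+\<omega>. ennreal \<bar>g (T \<omega>, W \<omega>)\<bar> \<partial>M)"
    by (rule nn_integral_inverse_censoring[of "\<lambda>z. \<bar>g z\<bar>"]) measurable
  also have "\<dots> < \<infinity>" using g by (simp add: integrable_iff_bounded)
  finally show int: "integrable M ?f" by (intro integrableI_bounded) auto
  have "(\<integral>\<^sup>+\<omega>. ennreal (- ?f \<omega>) \<partial>M) = (\<integral>\<^sup>+\<omega>. ennreal (if T \<omega> \<le> C \<omega> then - g (T \<omega>, W \<omega>) / cens_surv (T \<omega>) else 0) \<partial>M)"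
    by (intro nn_integral_cong arg_cong[where f=ennreal]) auto
  also have "\<dots> = (\<integral>\<^sup>+\<omega>. ennreal (- g (T \<omega>, W \<omega>)) \<partial>M)"
    by (rule nn_integral_inverse_censoring[of "\<lambda>z. - g z"]) measurable
  finally have neg: "(\<integral>\<^sup>+\<omega>. ennreal (- ?f \<omega>) \<partial>M) = (\<integral>\<^sup>+\<omega>. ennreal (- g (T \<omega>, W \<omega>)) \<partial>M)" .
  show "expectation ?f = expectation (\<lambda>\<omega>. g (T \<omega>, W \<omega>))"
    unfolding real_lebesgue_integral_def[OF int] real_lebesgue_integral_def[OF g] neg
    by (simp add: nn_integral_inverse_censoring)
qed

end

text \<open>
  A second moment is assumed for the censored variable only.  It carries over to \<open>T\<close> because \<open>T\<close> is
  observed with a conditional probability of at least \<open>G \<tau>\<close>.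
\<close>

lemma (in random_censoring) integrable_square_uncensored:
  assumes "integrable M (\<lambda>\<omega>. (min (T \<omega>) (C \<omega>))\<^sup>2)"
  shows "integrable M (\<lambda>\<omega>. (T \<omega>)\<^sup>2)"
proof -
  define \<gamma> where "\<gamma> = cens_surv \<tau>"
  have \<gamma>: "\<gamma> > 0" unfolding \<gamma>_def by (rule cens_surv_pos) simp
  have "(\<integral>\<^sup>+\<omega>. ennreal ((T \<omega>)\<^sup>2) \<partial>M) = (\<integral>\<^sup>+\<omega>. ennreal (if T \<omega> \<le> C \<omega> then (T \<omega>)\<^sup>2 / cens_surv (T \<omega>) else 0) \<partial>M)"
    by (rule nn_integral_inverse_censoring[of "\<lambda>z. (fst z)\<^sup>2", unfolded fst_conv, symmetric]) measurable
  also have "\<dots> \<le> (\<integral>\<^sup>+\<omega>. ennreal (1 / \<gamma>) * ennreal ((min (T \<omega>) (C \<omega>))\<^sup>2) \<partial>M)"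
  proof (rule nn_integral_mono_AE)
    show "AE \<omega> in M. ennreal (if T \<omega> \<le> C \<omega> then (T \<omega>)\<^sup>2 / cens_surv (T \<omega>) else 0) \<le> ennreal (1 / \<gamma>) * ennreal ((min (T \<omega>) (C \<omega>))\<^sup>2)"
      using T_le
    proof eventually_elim
      case (elim \<omega>)
      have "(T \<omega>)\<^sup>2 / cens_surv (T \<omega>) \<le> (T \<omega>)\<^sup>2 / \<gamma>"
        using cens_surv_ge[OF elim] \<gamma> by (intro divide_left_mono) (auto simp: \<gamma>_def)
      thus ?case using \<gamma> by (auto simp: ennreal_mult[symmetric] min_def intro!: ennreal_leI)
    qed
  qed
  also have "\<dots> = ennreal (1 / \<gamma>) * (\<integral>\<^sup>+\<omega>. ennreal ((min (T \<omega>) (C \<omega>))\<^sup>2) \<partial>M)"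
    by (rule nn_integral_cmult) measurable
  also have "\<dots> < \<infinity>"
    using assms by (auto simp: integrable_iff_bounded ennreal_mult_less_top)
  finally show ?thesis by (intro integrableI_bounded) auto
qed

text \<open>
  The end point of the support of \<open>T\<close> is a real number: it is below that of \<open>C\<close>, hence not \<open>\<infinity>\<close>, and the
  law of \<open>T\<close> puts mass on some half-line \<open>{t<..}\<close>, hence it is not \<open>-\<infinity>\<close>.
\<close>

lemma (in prob_space) tau_less_separates:
  assumes [measurable]: "T \<in> borel_measurable M" "C \<in> borel_measurable M" and less: "tau M T < tau M C"
  obtains \<tau> :: real where "AE \<omega> in M. T \<omega> \<le> \<tau>" "\<And>s. s < \<tau> \<Longrightarrow> prob {\<omega> \<in> space M. s \<le> T \<omega>} > 0"
    "prob {\<omega> \<in> space M. \<tau> \<le> C \<omega>} > 0"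
proof -
  have compl: "prob {\<omega> \<in> space M. t < R \<omega>} = 1 - prob {\<omega> \<in> space M. R \<omega> \<le> t}"
    if [measurable]: "R \<in> borel_measurable M" for R :: "'a \<Rightarrow> real" and t
  proof -
    have "{\<omega> \<in> space M. t < R \<omega>} = space M - {\<omega> \<in> space M. R \<omega> \<le> t}" by auto
    thus ?thesis by (simp add: prob_compl)
  qed
  obtain t1 where t1: "prob {\<omega> \<in> space M. C \<omega> \<le> t1} < 1" "tau M T < ereal t1"
    using less unfolding tau_def[of M C] less_SUP_iff by auto
  interpret D: real_distribution "distr M borel T" by simp
  have "eventually (\<lambda>t. cdf (distr M borel T) t < 1) at_bot"
    using order_tendstoD(2)[OF D.cdf_lim_at_bot, of 1] by simp
  then obtain t0 where "cdf (distr M borel T) t0 < 1"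
    using eventually_happens'[OF trivial_limit_at_bot_linorder] by blast
  hence "prob {\<omega> \<in> space M. T \<omega> \<le> t0} < 1"
    by (simp add: cdf_def measure_distr vimage_def Int_def conj_commute)
  hence "ereal t0 \<le> tau M T" unfolding tau_def by (intro SUP_upper) simp
  with t1(2) obtain \<tau> where \<tau>: "tau M T = ereal \<tau>" by (cases "tau M T") auto
  show thesis
  proof (rule that[of \<tau>])
    have "AE \<omega> in M. T \<omega> \<le> \<tau> + 1 / real (Suc n)" for n
    proof -
      have "\<not> prob {\<omega> \<in> space M. T \<omega> \<le> \<tau> + 1 / real (Suc n)} < 1"
      proof
        assume "prob {\<omega> \<in> space M. T \<omega> \<le> \<tau> + 1 / real (Suc n)} < 1"
        hence "ereal (\<tau> + 1 / real (Suc n)) \<le> tau M T" unfolding tau_def by (intro SUP_upper) simp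
        thus False by (simp add: \<tau>)
      qed
      hence "prob {\<omega> \<in> space M. T \<omega> \<le> \<tau> + 1 / real (Suc n)} = 1"
        using prob_le_1[of "{\<omega> \<in> space M. T \<omega> \<le> \<tau> + 1 / real (Suc n)}"] by linarith
      thus ?thesis by (subst (asm) prob_Collect_eq_1) auto
    qed
    hence "AE \<omega> in M. \<forall>n. T \<omega> \<le> \<tau> + 1 / real (Suc n)" by (simp add: AE_all_countable)
    thus "AE \<omega> in M. T \<omega> \<le> \<tau>"
    proof eventually_elim
      case (elim \<omega>)
      have "(\<lambda>n. \<tau> + 1 / real (Suc n)) \<longlonglongrightarrow> \<tau> + 0" by (intro tendsto_intros LIMSEQ_Suc lim_1_over_n)
      thus ?case using elim by (intro LIMSEQ_le_const[of _ \<tau>]) auto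
    qed
    show "prob {\<omega> \<in> space M. s \<le> T \<omega>} > 0" if "s < \<tau>" for s
    proof -
      have "ereal s < tau M T" using that \<tau> by simp
      then obtain t where t: "prob {\<omega> \<in> space M. T \<omega> \<le> t} < 1" "s < t"
        unfolding tau_def less_SUP_iff by auto
      have "0 < prob {\<omega> \<in> space M. t < T \<omega>}" using t(1) by (simp add: compl)
      also have "\<dots> \<le> prob {\<omega> \<in> space M. s \<le> T \<omega>}" using t(2) by (intro finite_measure_mono) auto
      finally show ?thesis .
    qed
    have "0 < prob {\<omega> \<in> space M. t1 < C \<omega>}" using t1(1) by (simp add: compl)
    also have "\<dots> \<le> prob {\<omega> \<in> space M. \<tau> \<le> C \<omega>}" using t1(2) \<tau> by (intro finite_measure_mono) auto
    finally show "prob {\<omega> \<in> space M. \<tau> \<le> C \<omega>} > 0" .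
  qed
qed

lemma (in prob_space) continuous_cdf_no_atom:
  fixes R :: "'a \<Rightarrow> real"
  assumes [measurable]: "R \<in> borel_measurable M" and cont: "continuous_on UNIV (cdf (distr M borel R))"
  shows "prob {\<omega> \<in> space M. R \<omega> = s} = 0"
proof -
  interpret D: real_distribution "distr M borel R" by simp
  have "measure (distr M borel R) {s} = 0"
    using cont D.isCont_cdf[of s] by (simp add: continuous_on_eq_continuous_at)
  thus ?thesis by (simp add: measure_distr vimage_def Int_def conj_commute)
qed

section \<open>Consistency of Kaplan-Meier sums\<close>

locale censored_sample =
  random_censoring M T C W \<tau> +
  S: iid_sample N V "distr M borel (\<lambda>\<omega>. (min (T \<omega>) (C \<omega>), (if T \<omega> \<le> C \<omega> then 1 else 0), W \<omega>))"
  for M :: "'a measure" and T C W \<tau> and N :: "'b measure"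
    and V :: "nat \<Rightarrow> 'b \<Rightarrow> real \<times> real \<times> 'w :: second_countable_topology"
begin

abbreviation obs :: "'a \<Rightarrow> real \<times> real \<times> 'w" where
  "obs \<omega> \<equiv> (min (T \<omega>) (C \<omega>), (if T \<omega> \<le> C \<omega> then 1 else 0), W \<omega>)"
abbreviation Y where "Y i \<omega> \<equiv> fst (V i \<omega>)"
abbreviation D where "D i \<omega> \<equiv> fst (snd (V i \<omega>))"

lemma measurable_fst_obs [measurable]: "(fst :: real \<times> real \<times> 'w \<Rightarrow> real) \<in> borel_measurable borel"
  unfolding borel_prod[symmetric] by measurable

lemma measurable_fst_snd_obs [measurable]: "(\<lambda>v :: real \<times> real \<times> 'w. fst (snd v)) \<in> borel_measurable borel"
  unfolding borel_prod[symmetric] by measurable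

lemma measurable_obs [measurable]: "obs \<in> borel_measurable M"
  by measurable

lemma AE_sample:
  assumes [measurable]: "Measurable.pred borel P" and "AE \<omega> in M. P (obs \<omega>)"
  shows "AE \<omega> in N. P (V i \<omega>)"
proof -
  have "AE v in distr M borel obs. P v"
    using assms(2) by (subst AE_distr_iff) (use assms(1) in \<open>auto simp: pred_def\<close>)
  hence "AE v in distr N borel (V i). P v" by (subst S.law)
  thus ?thesis by (subst (asm) AE_distr_iff) (use assms(1) in \<open>auto simp: pred_def\<close>)
qed

lemma obs_surv_law: "measure (distr M borel obs) {v. s \<le> fst v} = obs_surv s"
proof -
  have "{v :: real \<times> real \<times> 'w. s \<le> fst v} \<in> sets borel"
    using measurable_sets[OF measurable_fst_obs, of "{s..}"] by (simp add: vimage_def)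
  thus ?thesis unfolding obs_surv_def
    by (subst measure_distr) (auto intro!: arg_cong[where f=prob])
qed

lemma AE_indicator_values: "AE \<omega> in N. D i \<omega> = 0 \<or> D i \<omega> = 1"
  by (rule AE_sample[where P="\<lambda>v. fst (snd v) = 0 \<or> fst (snd v) = 1"]) auto

lemma AE_below: "AE \<omega> in N. Y i \<omega> < \<tau>"
proof (rule AE_sample[where P="\<lambda>v. fst v < \<tau>"])
  show "AE \<omega> in M. fst (obs \<omega>) < \<tau>" using T_less by eventually_elim auto
qed auto

text \<open>
  Fubini: the law of an observed time has no atoms.
\<close>

lemma AE_no_ties:
  assumes "i \<noteq> j"
  shows "AE \<omega> in N. Y i \<omega> \<noteq> Y j \<omega>"
proof -
  have "S.indep_vars (\<lambda>_. borel) (\<lambda>i \<omega>. Y i \<omega>) UNIV"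
    by (rule S.indep_vars_compose2[OF S.indep, where Y="\<lambda>_. fst"]) measurable
  hence "S.indep_vars (\<lambda>_. borel) (\<lambda>i \<omega>. Y i \<omega>) {i, j}" by (rule S.indep_vars_subset) simp
  hence "S.indep_var borel (Y i) borel (Y j)"
    using S.indep_vars_sum[of "{j}" i "\<lambda>i \<omega>. Y i \<omega>"] assms by simp
  hence "distr N (borel \<Otimes>\<^sub>M borel) (\<lambda>\<omega>. (Y i \<omega>, Y j \<omega>)) = distr N borel (Y i) \<Otimes>\<^sub>M distr N borel (Y j)"
    by (simp add: S.indep_var_distribution_eq)
  from S.nn_integral_independent(2)[OF _ _ this, of "\<lambda>z. if fst z = snd z then 1 else 0"]
  have "(\<integral>\<^sup>+\<omega>. (if Y i \<omega> = Y j \<omega> then 1 else 0) \<partial>N) = (\<integral>\<^sup>+\<omega>'. \<integral>\<^sup>+\<omega>. (if Y i \<omega> = Y j \<omega>' then 1 else 0) \<partial>N \<partial>N)"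
    by simp
  also have "\<dots> = (\<integral>\<^sup>+\<omega>'. 0 \<partial>N)"
  proof (rule nn_integral_cong)
    fix \<omega>'
    define s where "s = Y j \<omega>'"
    have "AE \<omega> in M. fst (obs \<omega>) \<noteq> s"
      using no_atom[of s] by (subst AE_iff_measurable[OF _ refl]) (auto simp: emeasure_eq_measure)
    hence "AE \<omega> in N. Y i \<omega> \<noteq> s" by (rule AE_sample[where P="\<lambda>v. fst v \<noteq> s", rotated]) measurable
    hence "(\<integral>\<^sup>+\<omega>. (if Y i \<omega> = s then 1 else 0 :: ennreal) \<partial>N) = (\<integral>\<^sup>+\<omega>. 0 \<partial>N)"
      by (intro nn_integral_cong_AE) auto
    thus "(\<integral>\<^sup>+\<omega>. (if Y i \<omega> = Y j \<omega>' then 1 else 0 :: ennreal) \<partial>N) = 0" by (simp add: s_def)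
  qed
  finally have "(\<integral>\<^sup>+\<omega>. (if Y i \<omega> = Y j \<omega> then 1 else 0 :: ennreal) \<partial>N) = 0" by simp
  hence "AE \<omega> in N. (if Y i \<omega> = Y j \<omega> then 1 else 0 :: ennreal) = 0"
    by (subst (asm) nn_integral_0_iff_AE) auto
  thus ?thesis by eventually_elim (auto split: if_splits)
qed

text \<open>
  The bound of \<open>log_inv_cens_approx\<close> for the sample, with the expected numbers at risk.
\<close>

definition hazard_error :: "nat \<Rightarrow> 'b \<Rightarrow> real" where
  "hazard_error n \<omega> = (\<Sum>j | j < n \<and> D j \<omega> = 0.
     \<bar>1 / at_risk n (\<lambda>i. Y i \<omega>) (Y j \<omega>) - 1 / (n * obs_surv (Y j \<omega>))\<bar> + 2 / (at_risk n (\<lambda>i. Y i \<omega>) (Y j \<omega>))\<^sup>2)"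

text \<open>
  The estimated cumulative hazard of censoring with the numbers at risk replaced by their
  expectations, which makes it an average of independent terms.
\<close>

definition oracle_hazard :: "nat \<Rightarrow> 'b \<Rightarrow> real \<Rightarrow> real" where
  "oracle_hazard n \<omega> t = (\<Sum>j<n. if D j \<omega> = 0 \<and> Y j \<omega> < t then 1 / obs_surv (Y j \<omega>) else 0) / n"

lemma at_risk_others:
  assumes "j < n"
  shows "real (at_risk n (\<lambda>i. Y i \<omega>) (Y j \<omega>)) = 1 + S.others fst n j (Y j \<omega>) \<omega>"
proof -
  have "real (at_risk n (\<lambda>i. Y i \<omega>) s) = (\<Sum>k<n. of_bool (s \<le> Y k \<omega>))" for s
    unfolding at_risk_def by (simp add: Int_def)
  thus ?thesis using assms unfolding S.others_def
    by (subst (asm) sum.remove[of _ j]) auto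
qed

lemma hazard_error_others:
  "ennreal (hazard_error n \<omega>) = (\<Sum>j<n. ennreal (if D j \<omega> = 0 then
      \<bar>1 / (1 + S.others fst n j (Y j \<omega>) \<omega>) - 1 / (n * obs_surv (Y j \<omega>))\<bar> + 2 / (1 + S.others fst n j (Y j \<omega>) \<omega>)\<^sup>2 else 0))"
proof -
  have "hazard_error n \<omega> = (\<Sum>j<n. if D j \<omega> = 0 then
      \<bar>1 / (1 + S.others fst n j (Y j \<omega>) \<omega>) - 1 / (n * obs_surv (Y j \<omega>))\<bar> + 2 / (1 + S.others fst n j (Y j \<omega>) \<omega>)\<^sup>2 else 0)"
    unfolding hazard_error_def by (rule sum.mono_neutral_cong_left) (auto simp: at_risk_others)
  thus ?thesis by (simp add: sum_ennreal)
qed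

text \<open>
  Each summand depends on the rest of the sample through a leave-one-out count only, so its
  expectation is an integral over the law of one observation.
\<close>

lemma nn_integral_hazard_error:
  "(\<integral>\<^sup>+\<omega>. ennreal (hazard_error n \<omega>) \<partial>N) =
    (\<integral>\<^sup>+v. ennreal (if fst (snd v) = 0 then S.risk_error fst n (fst v) else 0) \<partial>distr M borel obs)"
  and measurable_hazard_error [measurable]: "hazard_error n \<in> borel_measurable N"
proof -
  let ?h = "\<lambda>(v :: real \<times> real \<times> 'w) x. if fst (snd v) = 0 then \<bar>1 / (1 + x) - 1 / (n * obs_surv (fst v))\<bar> + 2 / (1 + x)\<^sup>2 else 0 :: real"
  have mh: "(\<lambda>z. ennreal (?h (fst z) (snd z))) \<in> borel_measurable (borel \<Otimes>\<^sub>M borel)"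
    unfolding borel_prod[symmetric] by measurable
  have mo: "(\<lambda>\<omega>. S.others fst n j (Y j \<omega>) \<omega>) \<in> borel_measurable N" for j
    by measurable
  have inner: "(\<integral>\<^sup>+\<omega>. ennreal (?h v (S.others fst n j (fst v) \<omega>)) \<partial>N) =
     ennreal (if fst (snd v) = 0 then S.expectation (\<lambda>\<omega>. \<bar>1 / (1 + S.others fst n j (fst v) \<omega>) - 1 / (n * obs_surv (fst v))\<bar> + 2 / (1 + S.others fst n j (fst v) \<omega>)\<^sup>2) else 0)" for j v
  proof (cases "fst (snd v) = 0")
    case True
    let ?o = "S.others fst n j (fst v)"
    have [measurable]: "?o \<in> borel_measurable N" by measurable
    have "norm (1 / (1 + ?o \<omega>)) \<le> 1" for \<omega>
      using S.others_nonneg[of fst n j "fst v" \<omega>] by simp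
    hence i1: "integrable N (\<lambda>\<omega>. 1 / (1 + ?o \<omega>))"
      by (intro S.integrable_const_bound[of _ 1]) auto
    have "norm (2 / (1 + ?o \<omega>)\<^sup>2) \<le> 2" for \<omega>
    proof -
      have "1 \<le> (1 + ?o \<omega>)\<^sup>2" using S.others_nonneg[of fst n j "fst v" \<omega>] by (intro one_le_power) simp
      hence "2 / (1 + ?o \<omega>)\<^sup>2 \<le> 2 / 1" by (intro divide_left_mono) auto
      thus ?thesis by simp
    qed
    hence i2: "integrable N (\<lambda>\<omega>. 2 / (1 + ?o \<omega>)\<^sup>2)"
      by (intro S.integrable_const_bound[of _ 2]) auto
    have "integrable N (\<lambda>\<omega>. \<bar>1 / (1 + ?o \<omega>) - 1 / (n * obs_surv (fst v))\<bar> + 2 / (1 + ?o \<omega>)\<^sup>2)"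
      using i1 i2 by (intro Bochner_Integration.integrable_add integrable_abs Bochner_Integration.integrable_diff) auto
    hence "(\<integral>\<^sup>+\<omega>. ennreal (\<bar>1 / (1 + ?o \<omega>) - 1 / (n * obs_surv (fst v))\<bar> + 2 / (1 + ?o \<omega>)\<^sup>2) \<partial>N) =
       ennreal (S.expectation (\<lambda>\<omega>. \<bar>1 / (1 + ?o \<omega>) - 1 / (n * obs_surv (fst v))\<bar> + 2 / (1 + ?o \<omega>)\<^sup>2))"
      by (rule nn_integral_eq_integral) auto
    thus ?thesis using True by simp
  qed simp
  have mt: "(\<lambda>\<omega>. ennreal (?h (V j \<omega>) (S.others fst n j (Y j \<omega>) \<omega>))) \<in> borel_measurable N" for j
    using mo[of j] by measurable
  have "(\<integral>\<^sup>+\<omega>. ennreal (hazard_error n \<omega>) \<partial>N) = (\<integral>\<^sup>+\<omega>. (\<Sum>j<n. ennreal (?h (V j \<omega>) (S.others fst n j (Y j \<omega>) \<omega>))) \<partial>N)"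
    by (intro nn_integral_cong hazard_error_others)
  also have "\<dots> = (\<Sum>j<n. \<integral>\<^sup>+\<omega>. ennreal (?h (V j \<omega>) (S.others fst n j (Y j \<omega>) \<omega>)) \<partial>N)"
    by (rule nn_integral_sum) (rule mt)
  also have "\<dots> = (\<Sum>j<n. \<integral>\<^sup>+v. \<integral>\<^sup>+\<omega>. ennreal (?h v (S.others fst n j (fst v) \<omega>)) \<partial>N \<partial>distr M borel obs)"
    using S.nn_integral_leave_one_out[OF measurable_fst_obs mh]
    unfolding fst_conv snd_conv by (intro sum.cong) auto
  also have "\<dots> = (\<integral>\<^sup>+v. (\<Sum>j<n. \<integral>\<^sup>+\<omega>. ennreal (?h v (S.others fst n j (fst v) \<omega>)) \<partial>N) \<partial>distr M borel obs)"
  proof (rule nn_integral_sum[symmetric])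
    fix j
    have [measurable]: "(\<lambda>z :: (real \<times> real \<times> 'w) \<times> 'b. S.others fst n j (fst (fst z)) (snd z)) \<in> borel_measurable (borel \<Otimes>\<^sub>M N)"
      by (intro S.measurable_others measurable_compose[OF measurable_fst measurable_fst_obs] measurable_fst_obs measurable_snd)
    have "(\<lambda>z. ennreal (?h (fst z) (S.others fst n j (fst (fst z)) (snd z)))) \<in> borel_measurable (borel \<Otimes>\<^sub>M N)"
      using measurable_compose[OF measurable_fst measurable_fst_obs] measurable_compose[OF measurable_fst measurable_fst_snd_obs]
      by measurable
    from S.borel_measurable_nn_integral_fst[OF this]
    have "(\<lambda>v. \<integral>\<^sup>+\<omega>. ennreal (?h v (S.others fst n j (fst v) \<omega>)) \<partial>N) \<in> borel_measurable borel"
      unfolding fst_conv snd_conv .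
    thus "(\<lambda>v. \<integral>\<^sup>+\<omega>. ennreal (?h v (S.others fst n j (fst v) \<omega>)) \<partial>N) \<in> borel_measurable (distr M borel obs)" by simp
  qed
  also have "\<dots> = (\<integral>\<^sup>+v. ennreal (if fst (snd v) = 0 then S.risk_error fst n (fst v) else 0) \<partial>distr M borel obs)"
    unfolding inner S.risk_error_def obs_surv_law
    by (intro nn_integral_cong) (auto simp: sum_ennreal)
  finally show "(\<integral>\<^sup>+\<omega>. ennreal (hazard_error n \<omega>) \<partial>N) =
    (\<integral>\<^sup>+v. ennreal (if fst (snd v) = 0 then S.risk_error fst n (fst v) else 0) \<partial>distr M borel obs)" .
  have "(\<lambda>\<omega>. enn2real (\<Sum>j<n. ennreal (?h (V j \<omega>) (S.others fst n j (Y j \<omega>) \<omega>)))) \<in> borel_measurable N"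
    using mt by measurable
  moreover have "hazard_error n \<omega> \<ge> 0" for \<omega> unfolding hazard_error_def by (intro sum_nonneg) auto
  hence "hazard_error n \<omega> = enn2real (\<Sum>j<n. ennreal (?h (V j \<omega>) (S.others fst n j (Y j \<omega>) \<omega>)))" for \<omega>
    unfolding hazard_error_others[symmetric] by simp
  ultimately show "hazard_error n \<in> borel_measurable N" by (simp add: fun_eq_iff[symmetric] cong: measurable_cong)
qed

text \<open>
  Dominated convergence over the law of one observation.  The dominating function \<open>4 / p\<close>, restricted
  to censored observations, has integral \<open>- 4 ln (G \<tau>)\<close>, finite because \<open>G \<tau> > 0\<close>.
\<close>

lemma hazard_error_vanishes:
  assumes e: "e > 0"
  shows "vanishing N (\<lambda>n \<omega>. e \<le> hazard_error n \<omega>)"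
proof -
  let ?\<mu> = "distr M borel obs"
  let ?u = "\<lambda>n v. ennreal (if fst (snd v) = 0 then S.risk_error fst n (fst v) else 0)"
  have mr: "?u n \<in> borel_measurable ?\<mu>" for n
  proof -
    have "(\<lambda>s. S.expectation (\<lambda>\<omega>. \<bar>1 / (1 + S.others fst n j s \<omega>) - 1 / (n * obs_surv s)\<bar> + 2 / (1 + S.others fst n j s \<omega>)\<^sup>2)) \<in> borel_measurable borel" for j
      by (rule S.borel_measurable_lebesgue_integral) (unfold case_prod_beta', measurable)
    hence [measurable]: "S.risk_error fst n \<in> borel_measurable borel"
      unfolding S.risk_error_def[abs_def] obs_surv_law by measurable
    show ?thesis by measurable
  qed
  have AEp: "AE v in ?\<mu>. fst v < \<tau>"
    using T_less by (subst AE_distr_iff) (auto elim: eventually_mono)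
  have "(\<lambda>n. \<integral>\<^sup>+v. ?u n v \<partial>?\<mu>) \<longlonglongrightarrow> (\<integral>\<^sup>+v. 0 \<partial>?\<mu>)"
  proof (rule nn_integral_dominated_convergence[where w="\<lambda>v. ennreal (if fst (snd v) = 0 then 4 / obs_surv (fst v) else 0)"])
    show "AE v in ?\<mu>. ?u n v \<le> ennreal (if fst (snd v) = 0 then 4 / obs_surv (fst v) else 0)" for n
      using AEp
    proof eventually_elim
      case (elim v)
      thus ?case
        using S.risk_error(1)[OF measurable_fst_obs, of "fst v" n] obs_surv_pos[OF elim]
        unfolding obs_surv_law by (auto intro!: ennreal_leI)
    qed
    show "AE v in ?\<mu>. (\<lambda>n. ?u n v) \<longlonglongrightarrow> 0"
      using AEp
    proof eventually_elim
      case (elim v)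
      thus ?case
        using S.risk_error(2)[OF measurable_fst_obs, of "fst v"] obs_surv_pos[OF elim]
        unfolding obs_surv_law by (cases "fst (snd v) = 0") (auto dest: tendsto_ennrealI)
    qed
    have "(\<integral>\<^sup>+v. ennreal (if fst (snd v) = 0 then 4 / obs_surv (fst v) else 0) \<partial>?\<mu>) =
       (\<integral>\<^sup>+\<omega>. ennreal (if fst (snd (obs \<omega>)) = 0 then 4 / obs_surv (fst (obs \<omega>)) else 0) \<partial>M)"
      by (rule nn_integral_distr) measurable
    also have "\<dots> = (\<integral>\<^sup>+\<omega>. 4 * ennreal (if C \<omega> < T \<omega> \<and> C \<omega> < \<tau> then 1 / obs_surv (C \<omega>) else 0) \<partial>M)"
    proof (rule nn_integral_cong_AE)
      show "AE \<omega> in M. ennreal (if fst (snd (obs \<omega>)) = 0 then 4 / obs_surv (fst (obs \<omega>)) else 0) =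
         4 * ennreal (if C \<omega> < T \<omega> \<and> C \<omega> < \<tau> then 1 / obs_surv (C \<omega>) else 0)"
        using T_less
      proof eventually_elim
        case (elim \<omega>)
        have "ennreal (4 * x) = 4 * ennreal x" if "x \<ge> 0" for x
          using that by (simp add: ennreal_mult'')
        from this[of "1 / obs_surv (C \<omega>)"] show ?case using elim by (auto simp: obs_surv_def min_def)
      qed
    qed
    also have "\<dots> = 4 * (\<integral>\<^sup>+\<omega>. ennreal (if C \<omega> < T \<omega> \<and> C \<omega> < \<tau> then 1 / obs_surv (C \<omega>) else 0) \<partial>M)"
      by (rule nn_integral_cmult) measurable
    also have "\<dots> = 4 * ennreal (- ln (cens_surv \<tau>))"
      by (subst nn_integral_censored_hazard) auto
    also have "\<dots> < \<infinity>" by (simp add: ennreal_mult_less_top)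
    finally show "(\<integral>\<^sup>+v. ennreal (if fst (snd v) = 0 then 4 / obs_surv (fst v) else 0) \<partial>?\<mu>) < \<infinity>" .
  qed (use mr in auto)
  hence "(\<lambda>n. \<integral>\<^sup>+\<omega>. ennreal (hazard_error n \<omega>) \<partial>N) \<longlonglongrightarrow> 0"
    by (simp add: nn_integral_hazard_error)
  hence "vanishing N (\<lambda>n \<omega>. ennreal e \<le> ennreal (hazard_error n \<omega>))"
    by (intro S.vanishing_of_nn_integral e) measurable
  moreover have "hazard_error n \<omega> \<ge> 0" for n \<omega> unfolding hazard_error_def by (intro sum_nonneg) auto
  ultimately show ?thesis by (simp add: ennreal_le_iff)
qed

lemma oracle_hazard_wlln:
  assumes t: "t \<le> \<tau>" and e: "e > 0"
  shows "vanishing N (\<lambda>n \<omega>. e \<le> \<bar>oracle_hazard n \<omega> t - (- ln (cens_surv t))\<bar>)"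
proof -
  let ?g = "\<lambda>v :: real \<times> real \<times> 'w. if fst (snd v) = 0 \<and> fst v < t then 1 / obs_surv (fst v) else 0"
  let ?\<mu> = "distr M borel obs"
  have [measurable]: "?g \<in> borel_measurable borel" by measurable
  have nn: "0 \<le> - ln (cens_surv t)"
    using cens_surv_pos[OF t] by (simp add: ln_le_zero_iff cens_surv_def)
  have "(\<integral>\<^sup>+v. ennreal (?g v) \<partial>?\<mu>) = (\<integral>\<^sup>+\<omega>. ennreal (?g (obs \<omega>)) \<partial>M)"
    by (rule nn_integral_distr) measurable
  also have "\<dots> = (\<integral>\<^sup>+\<omega>. ennreal (if C \<omega> < T \<omega> \<and> C \<omega> < t then 1 / obs_surv (C \<omega>) else 0) \<partial>M)"
    by (intro nn_integral_cong) (auto simp: min_def)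
  also have "\<dots> = ennreal (- ln (cens_surv t))" by (rule nn_integral_censored_hazard[OF t])
  finally have eq: "(\<integral>\<^sup>+v. ennreal (?g v) \<partial>?\<mu>) = ennreal (- ln (cens_surv t))" .
  have g0: "AE v in ?\<mu>. 0 \<le> ?g v" by (simp add: obs_surv_def)
  have mg: "?g \<in> borel_measurable ?\<mu>" by simp
  have int: "integrable ?\<mu> ?g" and val: "(\<integral>v. ?g v \<partial>?\<mu>) = - ln (cens_surv t)"
    using nn_integral_eq_integrable[OF mg g0 nn] eq by auto
  show ?thesis
    using S.wlln[OF _ int e] unfolding val oracle_hazard_def by simp
qed

lemma oracle_hazard_mono: "s \<le> t \<Longrightarrow> oracle_hazard n \<omega> s \<le> oracle_hazard n \<omega> t"
  unfolding oracle_hazard_def by (intro divide_right_mono sum_mono) (auto simp: obs_surv_def)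

lemma oracle_hazard_nonneg: "0 \<le> oracle_hazard n \<omega> t"
  unfolding oracle_hazard_def by (intro divide_nonneg_nonneg sum_nonneg) (auto simp: obs_surv_def)

text \<open>
  Choose points where the continuous limit takes the values \<open>e, 2 e, 3 e, \<dots>\<close>, and \<open>\<tau>\<close> itself.  Below
  the first of them there is no lower bracket, but there the limit is at most \<open>e\<close>.
\<close>

lemma hazard_brackets:
  assumes e: "e > 0"
  shows "\<exists>F. finite F \<and> F \<subseteq> {..\<tau>} \<and> (\<forall>t\<le>\<tau>.
     (\<exists>b\<in>F. t \<le> b \<and> - ln (cens_surv b) \<le> - ln (cens_surv t) + e) \<and>
     (- ln (cens_surv t) \<le> e \<or> (\<exists>a\<in>F. a \<le> t \<and> - ln (cens_surv t) \<le> - ln (cens_surv a) + e)))"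
proof -
  define H where "H t = - ln (cens_surv t)" for t
  have Hmono: "H s \<le> H t" if "s \<le> t" "t \<le> \<tau>" for s t
    using that cens_surv_pos[of t] cens_surv_pos[of s] cens.survival_antimono[of s t] by (simp add: H_def cens_surv_eq)
  have H0: "0 \<le> H t" if "t \<le> \<tau>" for t
    using cens_surv_pos[OF that] by (simp add: H_def ln_le_zero_iff cens_surv_def)
  obtain m where m: "H \<tau> / e < real m" using reals_Archimedean2 by blast
  have "\<exists>x\<le>\<tau>. 0 < k \<and> real k * e \<le> H \<tau> \<longrightarrow> H x = k * e" for k :: nat
  proof (cases "0 < k \<and> real k * e \<le> H \<tau>")
    case True
    have "cens_surv \<tau> = exp (- H \<tau>)" using cens_surv_pos[of \<tau>] by (simp add: H_def)
    also have "\<dots> \<le> exp (- (k * e))" using True by simp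
    finally obtain x where "x \<le> \<tau>" "cens_surv x = exp (- (k * e))"
      using cens_surv_attains[of "exp (- (k * e))"] True e by auto
    thus ?thesis by (auto simp: H_def)
  qed auto
  then obtain x where x: "\<And>k. x k \<le> \<tau>" "\<And>k. 0 < k \<Longrightarrow> real k * e \<le> H \<tau> \<Longrightarrow> H (x k) = k * e"
    by metis
  define F where "F = insert \<tau> (x ` {..m})"
  have small: "k \<le> m" if "real k * e \<le> H \<tau>" for k
  proof -
    have "real k \<le> H \<tau> / e" using that e by (simp add: field_simps)
    thus ?thesis using m by linarith
  qed
  have main: "(\<exists>b\<in>F. t \<le> b \<and> H b \<le> H t + e) \<and> (H t \<le> e \<or> (\<exists>a\<in>F. a \<le> t \<and> H t \<le> H a + e))" if t: "t \<le> \<tau>" for t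
  proof
    define k where "k = nat \<lfloor>H t / e\<rfloor>"
    have "real k \<le> H t / e" "H t / e < real k + 1"
      using H0[OF t] e unfolding k_def by (auto simp: of_nat_nat)
    hence k: "real k * e \<le> H t" "H t < (real k + 1) * e" using e by (auto simp: field_simps)
    show "\<exists>b\<in>F. t \<le> b \<and> H b \<le> H t + e"
    proof (cases "real (Suc k) * e \<le> H \<tau>")
      case True
      hence Hx: "H (x (Suc k)) = Suc k * e" by (intro x) auto
      have "t \<le> x (Suc k)"
      proof (rule ccontr)
        assume "\<not> t \<le> x (Suc k)"
        hence "H (x (Suc k)) \<le> H t" using t by (intro Hmono) auto
        thus False using Hx k(2) by (simp add: algebra_simps)
      qed
      moreover have "H (x (Suc k)) \<le> H t + e" using Hx k(1) by (simp add: algebra_simps)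
      ultimately show ?thesis using small[OF True] by (auto simp: F_def)
    next
      case False
      hence "H \<tau> \<le> H t + e" using k(1) by (simp add: algebra_simps)
      thus ?thesis using t by (auto simp: F_def)
    qed
    show "H t \<le> e \<or> (\<exists>a\<in>F. a \<le> t \<and> H t \<le> H a + e)"
    proof (cases "H t \<le> e")
      case False
      define l where "l = nat (\<lceil>H t / e\<rceil> - 1)"
      have "1 < H t / e" using False e by (simp add: field_simps)
      hence l0: "0 < l" "real l < H t / e" "H t / e \<le> real l + 1"
        unfolding l_def by linarith+
      hence l: "real l * e < H t" "H t \<le> (real l + 1) * e" using e by (auto simp: field_simps)
      have lt: "real l * e \<le> H \<tau>" using l(1) Hmono[OF t] by simp
      hence Hx: "H (x l) = l * e" using l0 by (intro x) auto
      have "x l \<le> t"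
      proof (rule ccontr)
        assume "\<not> x l \<le> t"
        hence "H t \<le> H (x l)" using x(1) by (intro Hmono) auto
        thus False using Hx l(1) by simp
      qed
      moreover have "H t \<le> H (x l) + e" using Hx l(2) by (simp add: algebra_simps)
      ultimately show ?thesis using small[OF lt] by (auto simp: F_def)
    qed simp
  qed
  have "finite F" "F \<subseteq> {..\<tau>}" using x(1) by (auto simp: F_def)
  thus ?thesis using main unfolding H_def by blast
qed

text \<open>
  Pointwise convergence at finitely many brackets suffices, by monotonicity on both sides.
\<close>

lemma oracle_hazard_uniform:
  assumes e: "e > 0"
  shows "vanishing N (\<lambda>n \<omega>. \<exists>t\<le>\<tau>. 2 * e \<le> \<bar>oracle_hazard n \<omega> t - (- ln (cens_surv t))\<bar>)"
proof -
  obtain F where F: "finite F" "F \<subseteq> {..\<tau>}"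
    "\<And>t. t \<le> \<tau> \<Longrightarrow> \<exists>b\<in>F. t \<le> b \<and> - ln (cens_surv b) \<le> - ln (cens_surv t) + e"
    "\<And>t. t \<le> \<tau> \<Longrightarrow> - ln (cens_surv t) \<le> e \<or> (\<exists>a\<in>F. a \<le> t \<and> - ln (cens_surv t) \<le> - ln (cens_surv a) + e)"
    using hazard_brackets[OF e] by auto
  have "vanishing N (\<lambda>n \<omega>. \<exists>a\<in>F. e \<le> \<bar>oracle_hazard n \<omega> a - (- ln (cens_surv a))\<bar>)"
    using F(1,2) e by (intro S.vanishing_finite_ex oracle_hazard_wlln) auto
  thus ?thesis
  proof (rule vanishing_imp, intro AE_I2 impI)
    fix n \<omega>
    assume "\<exists>t\<le>\<tau>. 2 * e \<le> \<bar>oracle_hazard n \<omega> t - (- ln (cens_surv t))\<bar>"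
    then obtain t where t: "t \<le> \<tau>" and d: "2 * e \<le> \<bar>oracle_hazard n \<omega> t - (- ln (cens_surv t))\<bar>" by blast
    show "\<exists>a\<in>F. e \<le> \<bar>oracle_hazard n \<omega> a - (- ln (cens_surv a))\<bar>"
    proof (rule ccontr)
      assume "\<not> ?thesis"
      hence lt: "\<bar>oracle_hazard n \<omega> a - (- ln (cens_surv a))\<bar> < e" if "a \<in> F" for a using that by force
      obtain b where b: "b \<in> F" "t \<le> b" "- ln (cens_surv b) \<le> - ln (cens_surv t) + e" using F(3)[OF t] by blast
      have up: "oracle_hazard n \<omega> t - (- ln (cens_surv t)) < 2 * e"
        using oracle_hazard_mono[OF b(2), of n \<omega>] lt[OF b(1)] b(3) by linarith
      have lo: "- (2 * e) < oracle_hazard n \<omega> t - (- ln (cens_surv t))"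
        using F(4)[OF t]
      proof
        assume "- ln (cens_surv t) \<le> e"
        thus ?thesis using oracle_hazard_nonneg[of n \<omega> t] e by linarith
      next
        assume "\<exists>a\<in>F. a \<le> t \<and> - ln (cens_surv t) \<le> - ln (cens_surv a) + e"
        then obtain a where a: "a \<in> F" "a \<le> t" "- ln (cens_surv t) \<le> - ln (cens_surv a) + e" by blast
        thus ?thesis using oracle_hazard_mono[OF a(2), of n \<omega>] lt[OF a(1)] by linarith
      qed
      show False using up lo d by linarith
    qed
  qed
qed

end

context censored_sample
begin

text \<open>
  If the logarithms of the estimated and of the true weights differ by less than \<open>3 \<eta>\<close>, the weights
  differ by a relative error of at most \<open>exp (3 \<eta>) - 1\<close>.  Relative to the sum with true weights this
  error is multiplied by an average of absolute values, which stays bounded by the weak law.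
\<close>

lemma km_sum_consistent:
  fixes g :: "real \<times> 'w \<Rightarrow> real"
  assumes g [measurable]: "g \<in> borel_measurable (borel \<Otimes>\<^sub>M borel)"
    and int: "integrable M (\<lambda>\<omega>. g (T \<omega>, W \<omega>))" and e: "e > 0"
  shows "vanishing N (\<lambda>n \<omega>. e \<le> \<bar>km_sum n (\<lambda>i. Y i \<omega>) (\<lambda>i. D i \<omega>) (\<lambda>i. g (Y i \<omega>, snd (snd (V i \<omega>)))) - expectation (\<lambda>\<omega>. g (T \<omega>, W \<omega>))\<bar>)"
proof -
  let ?\<mu> = "distr M borel obs"
  let ?Eg = "expectation (\<lambda>\<omega>. g (T \<omega>, W \<omega>))"
  define u where "u v = (if fst (snd v) = 1 then g (fst v, snd (snd v)) / cens_surv (fst v) else 0)" for v :: "real \<times> real \<times> 'w"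
  have u [measurable]: "u \<in> borel_measurable borel"
    unfolding u_def borel_prod[symmetric] by measurable
  have u_obs: "u (obs \<omega>) = (if T \<omega> \<le> C \<omega> then g (T \<omega>, W \<omega>) / cens_surv (T \<omega>) else 0)" for \<omega>
    by (auto simp: u_def min_def)
  have iu: "integrable ?\<mu> u"
    using inverse_censoring(1)[OF g int] by (subst integrable_distr_eq) (simp_all add: u_obs)
  have Eu: "(\<integral>v. u v \<partial>?\<mu>) = ?Eg"
    using inverse_censoring(2)[OF g int] by (subst integral_distr) (simp_all add: u_obs)
  \<comment> \<open>The added \<open>1\<close> leaves room for the fluctuation of the average of \<open>\<bar>u\<bar>\<close>.\<close>
  define K where "K = (\<integral>v. \<bar>u v\<bar> \<partial>?\<mu>) + 1"
  have K: "K > 0" unfolding K_def by (rule add_nonneg_pos) auto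
  \<comment> \<open>Chosen so that the relative error times \<open>K\<close> is \<open>e / 2\<close>.\<close>
  define \<eta> where "\<eta> = ln (1 + e / (2 * K)) / 3"
  have \<eta>: "\<eta> > 0" using e K by (simp add: \<eta>_def ln_gt_zero)
  have exp\<eta>: "exp (3 * \<eta>) - 1 = e / (2 * K)" using e K by (simp add: \<eta>_def add_pos_pos)
  let ?bad = "\<lambda>n \<omega>. \<eta> \<le> hazard_error n \<omega> \<or> (\<exists>t\<le>\<tau>. 2 * \<eta> \<le> \<bar>oracle_hazard n \<omega> t - (- ln (cens_surv t))\<bar>) \<or>
     1 \<le> \<bar>(\<Sum>i<n. \<bar>u (V i \<omega>)\<bar>) / n - (\<integral>v. \<bar>u v\<bar> \<partial>?\<mu>)\<bar> \<or> e / 2 \<le> \<bar>(\<Sum>i<n. u (V i \<omega>)) / n - (\<integral>v. u v \<partial>?\<mu>)\<bar>"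
  have "vanishing N ?bad"
    using e \<eta> iu by (intro S.vanishing_disj hazard_error_vanishes oracle_hazard_uniform S.wlln) auto
  thus ?thesis
  proof (rule vanishing_imp)
    fix n
    have AE_all: "AE \<omega> in N. (\<forall>i. (D i \<omega> = 0 \<or> D i \<omega> = 1) \<and> Y i \<omega> < \<tau>) \<and> (\<forall>i j. i \<noteq> j \<longrightarrow> Y i \<omega> \<noteq> Y j \<omega>)"
      using AE_indicator_values AE_below AE_no_ties by (simp add: AE_all_countable)
    show "AE \<omega> in N. e \<le> \<bar>km_sum n (\<lambda>i. Y i \<omega>) (\<lambda>i. D i \<omega>) (\<lambda>i. g (Y i \<omega>, snd (snd (V i \<omega>)))) - ?Eg\<bar> \<longrightarrow> ?bad n \<omega>"
    proof (rule eventually_mono[OF AE_all], rule impI, rule ccontr)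
      fix \<omega>
      assume a: "(\<forall>i. (D i \<omega> = 0 \<or> D i \<omega> = 1) \<and> Y i \<omega> < \<tau>) \<and> (\<forall>i j. i \<noteq> j \<longrightarrow> Y i \<omega> \<noteq> Y j \<omega>)"
        and far: "e \<le> \<bar>km_sum n (\<lambda>i. Y i \<omega>) (\<lambda>i. D i \<omega>) (\<lambda>i. g (Y i \<omega>, snd (snd (V i \<omega>)))) - ?Eg\<bar>"
        and good: "\<not> ?bad n \<omega>"
      have D: "D i \<omega> = 0 \<or> D i \<omega> = 1" and Yt: "Y i \<omega> < \<tau>" for i using a by auto
      have inj: "inj_on (\<lambda>i. Y i \<omega>) {..<n}" using a by (auto simp: inj_on_def)
      let ?L = "\<lambda>i. log_inv_cens n (\<lambda>i. Y i \<omega>) (\<lambda>i. D i \<omega>) (Y i \<omega>)"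
      let ?gv = "\<lambda>i. g (Y i \<omega>, snd (snd (V i \<omega>)))"
      have L: "\<bar>?L i + ln (cens_surv (Y i \<omega>))\<bar> < 3 * \<eta>" if i: "i < n" for i
      proof -
        have "(\<Sum>j | j < n \<and> Y j \<omega> < Y i \<omega> \<and> D j \<omega> = 0. 1 / (n * obs_surv (Y j \<omega>))) = oracle_hazard n \<omega> (Y i \<omega>)"
          unfolding oracle_hazard_def sum_divide_distrib
          by (rule sum.mono_neutral_cong_left) (auto simp: mult.commute)
        hence "\<bar>?L i - oracle_hazard n \<omega> (Y i \<omega>)\<bar> \<le> hazard_error n \<omega>"
          using log_inv_cens_approx[OF i, of "\<lambda>i. Y i \<omega>" "\<lambda>i. D i \<omega>" "\<lambda>j. 1 / (n * obs_surv (Y j \<omega>))"]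
          unfolding hazard_error_def by simp
        moreover have "hazard_error n \<omega> < \<eta>" using good by auto
        moreover have "\<bar>oracle_hazard n \<omega> (Y i \<omega>) - (- ln (cens_surv (Y i \<omega>)))\<bar> < 2 * \<eta>"
          using good less_imp_le[OF Yt[of i]] by force
        ultimately show ?thesis by linarith
      qed
      have term_bound: "\<bar>D i \<omega> / n * exp (?L i) * ?gv i - u (V i \<omega>) / n\<bar> \<le> (exp (3 * \<eta>) - 1) * (\<bar>u (V i \<omega>)\<bar> / n)"
        if i: "i < n" for i
      proof (cases "D i \<omega> = 1")
        case True
        have G: "cens_surv (Y i \<omega>) > 0" using cens_surv_pos[of "Y i \<omega>"] Yt[of i] by simp
        define x where "x = ?L i + ln (cens_surv (Y i \<omega>))"
        have "exp (?L i) = exp x / cens_surv (Y i \<omega>)" using G by (simp add: x_def exp_add)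
        hence "D i \<omega> / n * exp (?L i) * ?gv i - u (V i \<omega>) / n = (exp x - 1) * (u (V i \<omega>) / n)"
          using True by (simp add: u_def algebra_simps diff_divide_distrib)
        moreover have "\<bar>exp x - 1\<bar> \<le> exp (3 * \<eta>) - 1"
        proof -
          have "\<bar>x\<bar> < 3 * \<eta>" using L[OF i] by (simp add: x_def)
          hence x3: "exp x \<le> exp (3 * \<eta>)" "exp (- (3 * \<eta>)) \<le> exp x" by (auto simp: abs_less_iff)
          have "2 \<le> exp (3 * \<eta>) + exp (- (3 * \<eta>))" using cosh_real_ge_1[of "3 * \<eta>"] by (simp add: cosh_def)
          thus ?thesis using x3 by linarith
        qed
        ultimately show ?thesis by (simp add: abs_mult mult_right_mono divide_right_mono)
      next
        case False
        thus ?thesis using D[of i] \<eta> by (simp add: u_def)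
      qed
      have "km_sum n (\<lambda>i. Y i \<omega>) (\<lambda>i. D i \<omega>) ?gv - (\<Sum>i<n. u (V i \<omega>)) / n = (\<Sum>i<n. D i \<omega> / n * exp (?L i) * ?gv i - u (V i \<omega>) / n)"
        by (subst km_sum_inverse_censoring[OF inj D]) (simp add: sum_subtractf sum_divide_distrib)
      also have "\<bar>\<dots>\<bar> \<le> (\<Sum>i<n. (exp (3 * \<eta>) - 1) * (\<bar>u (V i \<omega>)\<bar> / n))"
        by (rule order.trans[OF sum_abs sum_mono]) (use term_bound in auto)
      also have "\<dots> = e / (2 * K) * ((\<Sum>i<n. \<bar>u (V i \<omega>)\<bar>) / n)"
        unfolding exp\<eta> by (simp add: sum_distrib_left sum_divide_distrib)
      also have "\<dots> \<le> e / (2 * K) * K"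
      proof (intro mult_left_mono)
        show "(\<Sum>i<n. \<bar>u (V i \<omega>)\<bar>) / n \<le> K" using good unfolding K_def by linarith
      qed (use e K in auto)
      also have "\<dots> = e / 2" using K by simp
      finally have "\<bar>km_sum n (\<lambda>i. Y i \<omega>) (\<lambda>i. D i \<omega>) ?gv - (\<Sum>i<n. u (V i \<omega>)) / n\<bar> \<le> e / 2" .
      moreover have "\<bar>(\<Sum>i<n. u (V i \<omega>)) / n - ?Eg\<bar> < e / 2" using good unfolding Eu by linarith
      ultimately show False using far by linarith
    qed
  qed
qed

end

section \<open>Componentwise integration\<close>

lemma integrable_mult_of_squares:
  fixes f g :: "'a \<Rightarrow> real"
  assumes [measurable]: "f \<in> borel_measurable M" "g \<in> borel_measurable M"
    and "integrable M (\<lambda>x. (f x)\<^sup>2)" "integrable M (\<lambda>x. (g x)\<^sup>2)"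
  shows "integrable M (\<lambda>x. f x * g x)"
proof (rule Bochner_Integration.integrable_bound)
  show "integrable M (\<lambda>x. (f x)\<^sup>2 + (g x)\<^sup>2)" using assms by auto
  show "AE x in M. norm (f x * g x) \<le> norm ((f x)\<^sup>2 + (g x)\<^sup>2)"
  proof (rule AE_I2)
    fix x
    have "0 \<le> (\<bar>f x\<bar> - \<bar>g x\<bar>)\<^sup>2" by simp
    hence "2 * (\<bar>f x\<bar> * \<bar>g x\<bar>) \<le> (f x)\<^sup>2 + (g x)\<^sup>2" by (simp add: power2_diff)
    moreover have "0 \<le> \<bar>f x\<bar> * \<bar>g x\<bar>" by simp
    ultimately have "\<bar>f x\<bar> * \<bar>g x\<bar> \<le> (f x)\<^sup>2 + (g x)\<^sup>2" by linarith
    thus "norm (f x * g x) \<le> norm ((f x)\<^sup>2 + (g x)\<^sup>2)" by (simp add: abs_mult)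
  qed
qed simp

lemma borel_measurable_vec_nth [measurable]:
  fixes f :: "'a \<Rightarrow> 'c :: real_normed_vector ^ 'n"
  assumes "f \<in> borel_measurable M"
  shows "(\<lambda>x. f x $ i) \<in> borel_measurable M"
  by (rule measurable_compose[OF assms]) (intro borel_measurable_continuous_onI linear_continuous_on bounded_linear_vec_nth)

lemma integrable_vec_nth_square:
  fixes X :: "'a \<Rightarrow> real ^ 'k"
  assumes [measurable]: "X \<in> borel_measurable M" and "integrable M (\<lambda>\<omega>. (norm (X \<omega>))\<^sup>2)"
  shows "integrable M (\<lambda>\<omega>. (X \<omega> $ i)\<^sup>2)"
  using assms(2)
proof (rule Bochner_Integration.integrable_bound)
  show "AE x in M. norm ((X x $ i)\<^sup>2) \<le> norm ((norm (X x))\<^sup>2)"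
    by (intro AE_I2) (simp add: abs_le_square_iff[symmetric] component_le_norm_cart)
qed measurable

text \<open>
  A vector is the sum of the images of its components under the bounded linear maps \<open>axis i\<close>.
\<close>

lemma integrable_vecI:
  fixes f :: "'a \<Rightarrow> 'c :: euclidean_space ^ 'n"
  assumes "\<And>i. integrable M (\<lambda>x. f x $ i)"
  shows "integrable M f"
proof -
  have "integrable M (\<lambda>x. \<Sum>i\<in>UNIV. axis i (f x $ i))"
    by (intro Bochner_Integration.integrable_sum integrable_bounded_linear[OF _ assms]
         linear_conv_bounded_linear[THEN iffD1] linearI) (auto simp: axis_def vec_eq_iff)
  moreover have "(\<Sum>i\<in>UNIV. axis i (f x $ i)) = f x" for x
    by (simp add: vec_eq_iff axis_def if_distrib sum.delta cong: if_cong)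
  ultimately show ?thesis by simp
qed

lemma integral_vec_nth:
  fixes f :: "'a \<Rightarrow> 'c :: euclidean_space ^ 'n"
  assumes "integrable M f"
  shows "(\<integral>x. f x \<partial>M) $ i = (\<integral>x. f x $ i \<partial>M)"
  using integral_bounded_linear[OF bounded_linear_vec_nth assms] by simp

section \<open>Consistency of the estimator\<close>

theorem theorem4p1:
  fixes M :: "'a measure" and N :: "'b measure"
    and T C U Y \<delta> :: "'a \<Rightarrow> real"
    and X :: "'a \<Rightarrow> real ^ 'k" and Z :: "'a \<Rightarrow> real ^ 'l"
    and \<beta>\<^sub>0 :: "real ^ 'k"
    and Ys \<delta>s :: "nat \<Rightarrow> 'b \<Rightarrow> real"
    and Xs :: "nat \<Rightarrow> 'b \<Rightarrow> real ^ 'k" and Zs :: "nat \<Rightarrow> 'b \<Rightarrow> real ^ 'l"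
    and \<beta>hat :: "nat \<Rightarrow> 'b \<Rightarrow> real ^ 'k"
  assumes "prob_space M"
    and "T \<in> borel_measurable M" "C \<in> borel_measurable M" "U \<in> borel_measurable M"
    and "X \<in> borel_measurable M" "Z \<in> borel_measurable M"
    and "AE \<omega> in M. T \<omega> = X \<omega> \<bullet> \<beta>\<^sub>0 + U \<omega>"
    and "Y = (\<lambda>\<omega>. min (T \<omega>) (C \<omega>))"
    and "\<delta> = (\<lambda>\<omega>. if T \<omega> \<le> C \<omega> then 1 else 0)"
    and "continuous_on UNIV (cdf (distr M borel Y))"
    and "integrable M (\<lambda>\<omega>. (norm (Z \<omega>))\<^sup>2)"
    and "integrable M (\<lambda>\<omega>. (norm (X \<omega>))\<^sup>2)"
    and "integrable M (\<lambda>\<omega>. \<bar>Y \<omega>\<bar>\<^sup>2)"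
    and "(\<integral>\<omega>. U \<omega> *\<^sub>R Z \<omega> \<partial>M) = 0"
    and "pos_definite (\<integral>\<omega>. outer (Z \<omega>) (Z \<omega>) \<partial>M)"
    and "rank (\<integral>\<omega>. outer (Z \<omega>) (X \<omega>) \<partial>M) = CARD('k)"
    and "indep_rv M C (\<lambda>\<omega>. (T \<omega>, X \<omega>, Z \<omega>))"
    and "tau M T < tau M C"
    and "prob_space N"
    and "prob_space.indep_vars N (\<lambda>_. borel) (\<lambda>i \<omega>. (Ys i \<omega>, \<delta>s i \<omega>, Xs i \<omega>, Zs i \<omega>)) UNIV"
    and "\<And>i. distr N borel (\<lambda>\<omega>. (Ys i \<omega>, \<delta>s i \<omega>, Xs i \<omega>, Zs i \<omega>)) =
             distr M borel (\<lambda>\<omega>. (Y \<omega>, \<delta> \<omega>, X \<omega>, Z \<omega>))"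
    and "c2sls_estimator N Ys \<delta>s Xs Zs \<beta>hat"
  shows "converges_in_probability N \<beta>hat \<beta>\<^sub>0"
proof -
  interpret M: prob_space M by fact
  note [measurable] = assms(2-6)
  have Yeq: "Y \<omega> = min (T \<omega>) (C \<omega>)" for \<omega> using assms(8) by simp
  obtain \<tau> where \<tau>: "AE \<omega> in M. T \<omega> \<le> \<tau>" "\<And>s. s < \<tau> \<Longrightarrow> M.prob {\<omega> \<in> space M. s \<le> T \<omega>} > 0"
    "M.prob {\<omega> \<in> space M. \<tau> \<le> C \<omega>} > 0"
    by (rule M.tau_less_separates[OF assms(2,3) assms(18)]) blast
  have "M.prob {\<omega> \<in> space M. Y \<omega> = s} = 0" for s
    using assms(10) by (intro M.continuous_cdf_no_atom) (simp_all add: assms(8))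
  hence no_atom: "M.prob {\<omega> \<in> space M. min (T \<omega>) (C \<omega>) = s} = 0" for s by (simp add: Yeq)
  interpret R: random_censoring M T C "\<lambda>\<omega>. (X \<omega>, Z \<omega>)" \<tau>
    by unfold_locales (use \<tau> assms(17) no_atom in auto)
  interpret N: prob_space N by fact
  define V where "V i \<omega> = (Ys i \<omega>, \<delta>s i \<omega>, Xs i \<omega>, Zs i \<omega>)" for i \<omega>
  interpret S: censored_sample M T C "\<lambda>\<omega>. (X \<omega>, Z \<omega>)" \<tau> N V
    by unfold_locales (use assms(20,21) in \<open>simp_all add: V_def[abs_def] assms(8,9)\<close>)

  have X2: "integrable M (\<lambda>\<omega>. (X \<omega> $ j)\<^sup>2)" for j by (intro integrable_vec_nth_square assms)
  have Z2: "integrable M (\<lambda>\<omega>. (Z \<omega> $ j)\<^sup>2)" for j by (intro integrable_vec_nth_square assms)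
  have T2: "integrable M (\<lambda>\<omega>. (T \<omega>)\<^sup>2)"
    using assms(13) by (intro R.integrable_square_uncensored) (simp add: Yeq)
  have iZZ: "integrable M (\<lambda>\<omega>. Z \<omega> $ i * Z \<omega> $ j)" for i j by (intro integrable_mult_of_squares X2 Z2) measurable
  have iZX: "integrable M (\<lambda>\<omega>. Z \<omega> $ i * X \<omega> $ j)" for i j by (intro integrable_mult_of_squares X2 Z2) measurable
  have iTZ: "integrable M (\<lambda>\<omega>. T \<omega> * Z \<omega> $ i)" for i by (intro integrable_mult_of_squares T2 Z2) measurable

  define A0 where "A0 = (\<integral>\<omega>. outer (Z \<omega>) (Z \<omega>) \<partial>M)"
  define B0 where "B0 = (\<integral>\<omega>. outer (Z \<omega>) (X \<omega>) \<partial>M)"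
  have vi: "integrable M (\<lambda>\<omega>. outer (Z \<omega>) (Z \<omega>) $ i)" "integrable M (\<lambda>\<omega>. outer (Z \<omega>) (X \<omega>) $ i)" for i
    by (intro integrable_vecI; simp add: outer_def iZZ iZX)+
  have A0: "A0 $ i $ j = M.expectation (\<lambda>\<omega>. Z \<omega> $ i * Z \<omega> $ j)" for i j
    unfolding A0_def by (simp add: integral_vec_nth integrable_vecI vi) (simp add: outer_def)
  have B0: "B0 $ i $ j = M.expectation (\<lambda>\<omega>. Z \<omega> $ i * X \<omega> $ j)" for i j
    unfolding B0_def by (simp add: integral_vec_nth integrable_vecI vi) (simp add: outer_def)
  have c0: "(B0 *v \<beta>\<^sub>0) $ i = M.expectation (\<lambda>\<omega>. T \<omega> * Z \<omega> $ i)" for i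
  proof -
    have eqU: "AE \<omega> in M. T \<omega> * Z \<omega> $ j - (\<Sum>k\<in>UNIV. (Z \<omega> $ j * X \<omega> $ k) * \<beta>\<^sub>0 $ k) = (U \<omega> *\<^sub>R Z \<omega>) $ j" for j
      using assms(7)
    proof eventually_elim
      case (elim \<omega>)
      have "T \<omega> * Z \<omega> $ j = (\<Sum>k\<in>UNIV. (Z \<omega> $ j * X \<omega> $ k) * \<beta>\<^sub>0 $ k) + U \<omega> * Z \<omega> $ j"
        unfolding elim by (simp add: inner_vec_def distrib_right distrib_left sum_distrib_left ac_simps)
      thus ?case by simp
    qed
    have iS: "integrable M (\<lambda>\<omega>. T \<omega> * Z \<omega> $ j - (\<Sum>k\<in>UNIV. (Z \<omega> $ j * X \<omega> $ k) * \<beta>\<^sub>0 $ k))" for j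
      by (intro Bochner_Integration.integrable_diff iTZ Bochner_Integration.integrable_sum integrable_mult_left iZX)
    \<comment> \<open>\<open>U Z\<close> is integrable, and its integral may be taken componentwise, by the second moments of \<open>T\<close>, \<open>X\<close> and \<open>Z\<close>.\<close>
    have iU: "integrable M (\<lambda>\<omega>. (U \<omega> *\<^sub>R Z \<omega>) $ j)" for j
      by (rule integrable_cong_AE_imp[OF iS]) (use eqU[of j] in \<open>auto elim: eventually_mono\<close>)
    have "0 = (\<integral>\<omega>. U \<omega> *\<^sub>R Z \<omega> \<partial>M) $ i" by (simp add: assms(14))
    also have "\<dots> = M.expectation (\<lambda>\<omega>. (U \<omega> *\<^sub>R Z \<omega>) $ i)" by (rule integral_vec_nth) (rule integrable_vecI[OF iU])
    also have "\<dots> = M.expectation (\<lambda>\<omega>. T \<omega> * Z \<omega> $ i - (\<Sum>k\<in>UNIV. (Z \<omega> $ i * X \<omega> $ k) * \<beta>\<^sub>0 $ k))"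
      by (rule integral_cong_AE) (use eqU[of i] in \<open>auto elim: eventually_mono\<close>)
    also have "\<dots> = M.expectation (\<lambda>\<omega>. T \<omega> * Z \<omega> $ i) - (\<Sum>k\<in>UNIV. B0 $ i $ k * \<beta>\<^sub>0 $ k)"
      using iTZ iZX by (simp add: B0)
    finally show ?thesis by (simp add: matrix_vector_mult_def)
  qed

  let ?y = "\<lambda>\<omega> i. Ys i \<omega>" and ?d = "\<lambda>\<omega> i. \<delta>s i \<omega>" and ?x = "\<lambda>\<omega> i. Xs i \<omega>" and ?z = "\<lambda>\<omega> i. Zs i \<omega>"
  define A where "A n \<omega> = km_ZZ n (?y \<omega>) (?d \<omega>) (?z \<omega>)" for n \<omega>
  define B where "B n \<omega> = km_sum n (?y \<omega>) (?d \<omega>) (\<lambda>i. outer (Zs i \<omega>) (Xs i \<omega>))" for n \<omega>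
  define c where "c n \<omega> = km_sum n (?y \<omega>) (?d \<omega>) (\<lambda>i. Ys i \<omega> *\<^sub>R Zs i \<omega>)" for n \<omega>
  have mz: "(\<lambda>w :: real \<times> (real ^ 'k) \<times> (real ^ 'l). snd (snd w) $ i) \<in> borel_measurable (borel \<Otimes>\<^sub>M borel)"
    and mx: "(\<lambda>w :: real \<times> (real ^ 'k) \<times> (real ^ 'l). fst (snd w) $ j) \<in> borel_measurable (borel \<Otimes>\<^sub>M borel)" for i j
    unfolding borel_prod[symmetric] by measurable
  have vA: "vanishing N (\<lambda>n \<omega>. e < dist (A n \<omega>) A0)" if "e > 0" for e
  proof (intro N.vanishing_dist_vec that)
    fix i and e :: real assume e: "e > 0"
    have "vanishing N (\<lambda>n \<omega>. e / 2 < dist (A n \<omega> $ i) (A0 $ i))"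
    proof (rule N.vanishing_dist_vec)
      fix j and e :: real assume "e > 0"
      from S.km_sum_consistent[OF borel_measurable_times[OF mz[of i] mz[of j]] _ this] 
      show "vanishing N (\<lambda>n \<omega>. e \<le> dist (A n \<omega> $ i $ j) (A0 $ i $ j))"
        by (simp add: iZZ A0 A_def km_ZZ_def km_sum_vec_nth outer_def V_def dist_real_def)
    qed (use e in simp)
    thus "vanishing N (\<lambda>n \<omega>. e \<le> dist (A n \<omega> $ i) (A0 $ i))"
      by (rule vanishing_imp) (use e in auto)
  qed
  have vB: "vanishing N (\<lambda>n \<omega>. e < dist (B n \<omega>) B0)" if "e > 0" for e
  proof (intro N.vanishing_dist_vec that)
    fix i and e :: real assume e: "e > 0"
    have "vanishing N (\<lambda>n \<omega>. e / 2 < dist (B n \<omega> $ i) (B0 $ i))"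
    proof (rule N.vanishing_dist_vec)
      fix j and e :: real assume "e > 0"
      from S.km_sum_consistent[OF borel_measurable_times[OF mz[of i] mx[of j]] _ this] 
      show "vanishing N (\<lambda>n \<omega>. e \<le> dist (B n \<omega> $ i $ j) (B0 $ i $ j))"
        by (simp add: iZX B0 B_def km_sum_vec_nth outer_def V_def dist_real_def)
    qed (use e in simp)
    thus "vanishing N (\<lambda>n \<omega>. e \<le> dist (B n \<omega> $ i) (B0 $ i))"
      by (rule vanishing_imp) (use e in auto)
  qed
  have vc: "vanishing N (\<lambda>n \<omega>. e < dist (c n \<omega>) (B0 *v \<beta>\<^sub>0))" if "e > 0" for e
  proof (rule N.vanishing_dist_vec[OF _ that])
    fix i and e :: real assume "e > 0"
    from S.km_sum_consistent[OF borel_measurable_times[OF measurable_fst mz[of i]] _ this] 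
    show "vanishing N (\<lambda>n \<omega>. e \<le> dist (c n \<omega> $ i) ((B0 *v \<beta>\<^sub>0) $ i))"
      by (simp add: iTZ c0 c_def km_sum_vec_nth V_def dist_real_def)
  qed

  show ?thesis
  proof (rule N.vanishing_converges_in_probability)
    show "\<beta>hat n \<in> borel_measurable N" for n using assms(22) by (simp add: c2sls_estimator_def)
    fix e :: real assume "e > 0"
    \<comment> \<open>Near the limiting moments both matrices are invertible, so there the estimator is given by the formula.\<close>
    from two_stage_continuous[OF assms(15,16) this, of \<beta>\<^sub>0]
    obtain r where r: "r > 0" "\<And>A B c. dist A A0 \<le> r \<Longrightarrow> dist B B0 \<le> r \<Longrightarrow> dist c (B0 *v \<beta>\<^sub>0) \<le> r \<Longrightarrow>
       invertible A \<and> invertible (transpose (matrix_inv A ** B) ** A ** (matrix_inv A ** B)) \<and> dist (two_stage A B c) \<beta>\<^sub>0 \<le> e"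
      unfolding A0_def[symmetric] B0_def[symmetric] by blast
    have "vanishing N (\<lambda>n \<omega>. r < dist (A n \<omega>) A0 \<or> r < dist (B n \<omega>) B0 \<or> r < dist (c n \<omega>) (B0 *v \<beta>\<^sub>0))"
      by (intro N.vanishing_disj vA vB vc r)
    thus "vanishing N (\<lambda>n \<omega>. e < dist (\<beta>hat n \<omega>) \<beta>\<^sub>0)"
    proof (rule vanishing_imp)
      fix n
      have "AE \<omega> in N. invertible (A n \<omega>) \<and> invertible (transpose (matrix_inv (A n \<omega>) ** B n \<omega>) ** A n \<omega> ** (matrix_inv (A n \<omega>) ** B n \<omega>)) \<longrightarrow>
          \<beta>hat n \<omega> = two_stage (A n \<omega>) (B n \<omega>) (c n \<omega>)"
        using assms(22) unfolding c2sls_estimator_def c2sls_def second_step_matrix_def Gamma_hat_def two_stage_def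
          A_def B_def c_def by blast
      thus "AE \<omega> in N. e < dist (\<beta>hat n \<omega>) \<beta>\<^sub>0 \<longrightarrow>
          r < dist (A n \<omega>) A0 \<or> r < dist (B n \<omega>) B0 \<or> r < dist (c n \<omega>) (B0 *v \<beta>\<^sub>0)"
      proof eventually_elim
        case (elim \<omega>)
        show ?case
        proof (rule impI, rule ccontr)
          assume far: "e < dist (\<beta>hat n \<omega>) \<beta>\<^sub>0"
            and near: "\<not> (r < dist (A n \<omega>) A0 \<or> r < dist (B n \<omega>) B0 \<or> r < dist (c n \<omega>) (B0 *v \<beta>\<^sub>0))"
          have "invertible (A n \<omega>) \<and> invertible (transpose (matrix_inv (A n \<omega>) ** B n \<omega>) ** A n \<omega> ** (matrix_inv (A n \<omega>) ** B n \<omega>)) \<and>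
             dist (two_stage (A n \<omega>) (B n \<omega>) (c n \<omega>)) \<beta>\<^sub>0 \<le> e"
            using near by (intro r(2)) auto
          thus False using elim far by auto
        qed
      qed
    qed
  qed
qed

end
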